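(* Let $n\ge1$, let $\mathcal{E}_*$ be a Hilbert space and let $K:\mathbb{B}^n\times\mathbb{B}^n\to\mathcal{B}(\mathcal{E}_* )$ be a kernel on the open unit ball $\mathbb{B}^n$ of $\mathbb{C}^n$ (not assumed to be analytic in $z_1,\dots,z_n$). Then there exist a Hilbert space $\mathcal{E}$ and a multiplier $\Theta\in\mathcal{M}_n(\mathcal{E},\mathcal{E}_* )$ such that \[ K(\mathbf{z},\mathbf{w})=\frac{I_{\mathcal{E}_*}-\Theta(\mathbf{z})\Theta(\mathbf{w})^*}{1-\langle\mathbf{z},\mathbf{w}\rangle}\qquad(\mathbf{z},\mathbf{w}\in\mathbb{B}^n) \] if and only if the function $(\mathbf{z},\mathbf{w})\mapsto I_{\mathcal{E}_*}-(1-\langle\mathbf{z},\mathbf{w}\rangle)K(\mathbf{z},\mathbf{w})$ is a kernel on $\mathbb{B}^n$.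
   Context: $\mathbb{B}^n=\{\mathbf{z}\in\mathbb{C}^n:\sum_{i=1}^n|z_i|^2<1\}$ and $\langle\mathbf{z},\mathbf{w}\rangle=\sum_{i=1}^nz_i\bar{w}_i$. For a set $\Omega$, a function $K:\Omega\times\Omega\to\mathcal{B}(\mathcal{E}_* )$ is called a kernel (written $K\ge 0$) if $\sum_{i,j=1}^m\langle K(\mathbf{z}_i,\mathbf{z}_j)\eta_j,\eta_i\rangle_{\mathcal{E}_*}\ge 0$ for all $m\ge1$, $\mathbf{z}_1,\dots,\mathbf{z}_m\in\Omega$ and $\eta_1,\dots,\eta_m\in\mathcal{E}_*$. The Drury–Arveson space $H^2_n$ is the reproducing kernel Hilbert space on $\mathbb{B}^n$ with kernel $\frac{1}{1-\langle\mathbf{z},\mathbf{w}\rangle}$. For Hilbert spaces $\mathcal{E},\mathcal{E}_*$, the multiplier space $\mathcal{M}_n(\mathcal{E},\mathcal{E}_* )$ is the set of all functions $\Theta:\mathbb{B}^n\to\mathcal{B}(\mathcal{E},\mathcal{E}_* )$ such that $\Theta(H^2_n\otimes\mathcal{E})\subseteq H^2_n\otimes\mathcal{E}_*$ (pointwise multiplication, with $H^2_n\otimes\mathcal{E}$ viewed as a space of $\mathcal{E}$-valued functions on $\mathbb{B}^n$), normed by the operator norm of the multiplication operator $M_\Theta$. *)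

theory Defs
  imports
    "HOL-Analysis.Analysis"
    "HOL-Library.Nonpos_Ints"
    "HOL-Algebra.Module"
begin

section \<open>Complex Hilbert spaces\<close>

text \<open>
  Hilbert spaces carry an explicit carrier, so that one can quantify existentially over them.
  The underlying vector space is a module over the complex numbers in the sense of HOL-Algebra;
  the ring multiplication and unit that the module record inherits play no role.
  The inner product is linear in its first argument.
\<close>

definition complex_ring :: "complex ring" where
  "complex_ring = \<lparr>carrier = UNIV, mult = (*), one = 1, zero = 0, add = (+)\<rparr>"

record 'a hilbert = "(complex, 'a) module" +
  cinner :: "'a \<Rightarrow> 'a \<Rightarrow> complex"

definition cnorm :: "'a hilbert \<Rightarrow> 'a \<Rightarrow> real" where
  "cnorm H x = sqrt (Re (cinner H x x))"

locale hilbert_space =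
  fixes H :: "'a hilbert"
  assumes is_module: "Module.module complex_ring H"
    and cinner_commute:
      "\<lbrakk>x \<in> carrier H; y \<in> carrier H\<rbrakk> \<Longrightarrow> cinner H x y = cnj (cinner H y x)"
    and cinner_add_left:
      "\<lbrakk>x \<in> carrier H; y \<in> carrier H; z \<in> carrier H\<rbrakk>
        \<Longrightarrow> cinner H (x \<oplus>\<^bsub>H\<^esub> y) z = cinner H x z + cinner H y z"
    and cinner_smult_left:
      "\<lbrakk>x \<in> carrier H; y \<in> carrier H\<rbrakk> \<Longrightarrow> cinner H (c \<odot>\<^bsub>H\<^esub> x) y = c * cinner H x y"
    and cinner_nonneg: "x \<in> carrier H \<Longrightarrow> cinner H x x \<in> \<real>\<^sub>\<ge>\<^sub>0"
    and cinner_definite: "\<lbrakk>x \<in> carrier H; cinner H x x = 0\<rbrakk> \<Longrightarrow> x = \<zero>\<^bsub>H\<^esub>"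
    and complete:
      "\<lbrakk>\<And>i. X i \<in> carrier H;
        \<And>e. 0 < e \<Longrightarrow> \<exists>N. \<forall>i\<ge>N. \<forall>j\<ge>N. cnorm H (X i \<ominus>\<^bsub>H\<^esub> X j) < e\<rbrakk>
        \<Longrightarrow> \<exists>x\<in>carrier H. (\<lambda>i. cnorm H (X i \<ominus>\<^bsub>H\<^esub> x)) \<longlonglongrightarrow> 0"

definition complex_hilbert :: "complex hilbert" where
  "complex_hilbert = \<lparr>carrier = UNIV, mult = (*), one = 1, zero = 0, add = (+),
     smult = (*), cinner = (\<lambda>x y. x * cnj y)\<rparr>"

lemma hilbert_space_complex_hilbert: "hilbert_space complex_hilbert"
proof (rule hilbert_space.intro)
  have inv: "\<exists>y. y + x = 0" for x :: complex
    by (rule exI[of _ "- x"]) simp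
  have "abelian_group complex_ring"
    by (rule abelian_groupI) (auto simp: complex_ring_def inv)
  moreover have "comm_monoid complex_ring"
    by (rule comm_monoidI) (auto simp: complex_ring_def)
  ultimately have cr: "cring complex_ring"
    by (rule cringI) (simp add: complex_ring_def algebra_simps)
  have ag: "abelian_group complex_hilbert"
    by (rule abelian_groupI) (auto simp: complex_hilbert_def inv)
  show m: "Module.module complex_ring complex_hilbert"
    by (intro moduleI cr ag) (auto simp: complex_hilbert_def complex_ring_def algebra_simps)
  interpret M: Module.module complex_ring complex_hilbert by (rule m)
  have "\<ominus>\<^bsub>complex_hilbert\<^esub> y = - y" for y
    by (rule M.minus_equality) (auto simp: complex_hilbert_def)
  then have minus: "x \<ominus>\<^bsub>complex_hilbert\<^esub> y = x - y" for x y
    by (simp add: a_minus_def complex_hilbert_def)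
  have cn: "cnorm complex_hilbert x = cmod x" for x
    by (simp add: cnorm_def complex_hilbert_def cmod_def power2_eq_square)
  show "\<exists>x\<in>carrier complex_hilbert. (\<lambda>i. cnorm complex_hilbert (X i \<ominus>\<^bsub>complex_hilbert\<^esub> x)) \<longlonglongrightarrow> 0"
    if "\<And>e. 0 < e \<Longrightarrow> \<exists>N. \<forall>i\<ge>N. \<forall>j\<ge>N. cnorm complex_hilbert (X i \<ominus>\<^bsub>complex_hilbert\<^esub> X j) < e" for X
  proof -
    have "Cauchy X"
      using that by (auto simp: Cauchy_def minus cn dist_norm)
    then obtain x where "X \<longlonglongrightarrow> x"
      using Cauchy_convergent convergent_def by blast
    then have "(\<lambda>i. cmod (X i - x)) \<longlonglongrightarrow> 0"
      using LIM_zero tendsto_norm_zero by blast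
    then show ?thesis
      unfolding minus cn by (intro bexI) (auto simp: complex_hilbert_def)
  qed
  show "cinner complex_hilbert x x \<in> \<real>\<^sub>\<ge>\<^sub>0" for x
    by (simp add: complex_hilbert_def complex_norm_square[symmetric] flip: of_real_power)
qed (auto simp: complex_hilbert_def algebra_simps)

text \<open>
  Bounded operators. Only the values on the carrier matter, so operator identities are
  stated pointwise on the carrier.
\<close>

definition bounded_operators :: "'a hilbert \<Rightarrow> 'b hilbert \<Rightarrow> ('a \<Rightarrow> 'b) set" where
  "bounded_operators E F = {T \<in> carrier E \<rightarrow> carrier F.
     (\<forall>x\<in>carrier E. \<forall>y\<in>carrier E. T (x \<oplus>\<^bsub>E\<^esub> y) = T x \<oplus>\<^bsub>F\<^esub> T y) \<and>
     (\<forall>c. \<forall>x\<in>carrier E. T (c \<odot>\<^bsub>E\<^esub> x) = c \<odot>\<^bsub>F\<^esub> T x) \<and>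
     (\<exists>B. \<forall>x\<in>carrier E. cnorm F (T x) \<le> B * cnorm E x)}"

definition adjoint_op :: "'a hilbert \<Rightarrow> 'b hilbert \<Rightarrow> ('a \<Rightarrow> 'b) \<Rightarrow> 'b \<Rightarrow> 'a" where
  "adjoint_op E F T y =
     (THE x. x \<in> carrier E \<and> (\<forall>u\<in>carrier E. cinner F (T u) y = cinner E u x))"

section \<open>Kernels, reproducing kernel Hilbert spaces and tensor products\<close>

definition is_kernel ::
    "'s set \<Rightarrow> 'b hilbert \<Rightarrow> ('s \<Rightarrow> 's \<Rightarrow> 'b \<Rightarrow> 'b) \<Rightarrow> bool" where
  "is_kernel \<Omega> F K \<longleftrightarrow>
     (\<forall>z\<in>\<Omega>. \<forall>w\<in>\<Omega>. K z w \<in> bounded_operators F F) \<and>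
     (\<forall>m\<ge>1. \<forall>(z :: nat \<Rightarrow> 's) (\<eta> :: nat \<Rightarrow> 'b).
        (\<forall>i<m. z i \<in> \<Omega> \<and> \<eta> i \<in> carrier F) \<longrightarrow>
        (\<Sum>i<m. \<Sum>j<m. cinner F (K (z i) (z j) (\<eta> j)) (\<eta> i)) \<in> \<real>\<^sub>\<ge>\<^sub>0)"

text \<open>
  Hilbert spaces whose elements are extensional \<open>F\<close>-valued functions on \<open>\<Omega>\<close>, with pointwise
  operations and bounded point evaluations.
\<close>

definition function_hilbert_space :: "'s set \<Rightarrow> 'b hilbert \<Rightarrow> ('s \<Rightarrow> 'b) hilbert \<Rightarrow> bool" where
  "function_hilbert_space \<Omega> F H \<longleftrightarrow>
     hilbert_space H \<and>
     carrier H \<subseteq> \<Omega> \<rightarrow>\<^sub>E carrier F \<and>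
     (\<forall>f\<in>carrier H. \<forall>g\<in>carrier H. f \<oplus>\<^bsub>H\<^esub> g = (\<lambda>z\<in>\<Omega>. f z \<oplus>\<^bsub>F\<^esub> g z)) \<and>
     (\<forall>c. \<forall>f\<in>carrier H. c \<odot>\<^bsub>H\<^esub> f = (\<lambda>z\<in>\<Omega>. c \<odot>\<^bsub>F\<^esub> f z)) \<and>
     (\<forall>z\<in>\<Omega>. (\<lambda>f. f z) \<in> bounded_operators H F)"

definition is_rkhs ::
    "'s set \<Rightarrow> ('s \<Rightarrow> 's \<Rightarrow> complex) \<Rightarrow> ('s \<Rightarrow> complex) hilbert \<Rightarrow> bool" where
  "is_rkhs \<Omega> k H \<longleftrightarrow>
     function_hilbert_space \<Omega> complex_hilbert H \<and>
     (\<forall>w\<in>\<Omega>. (\<lambda>z\<in>\<Omega>. k z w) \<in> carrier H \<and>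
        (\<forall>f\<in>carrier H. cinner H f (\<lambda>z\<in>\<Omega>. k z w) = f w))"

definition elementary_tensor ::
    "'s set \<Rightarrow> 'e hilbert \<Rightarrow> ('s \<Rightarrow> complex) \<Rightarrow> 'e \<Rightarrow> 's \<Rightarrow> 'e" where
  "elementary_tensor \<Omega> E f \<eta> = (\<lambda>z\<in>\<Omega>. f z \<odot>\<^bsub>E\<^esub> \<eta>)"

text \<open>
  The Hilbert space tensor product of a space \<open>H\<close> of scalar functions on \<open>\<Omega>\<close> with \<open>E\<close>, viewed as a
  space of \<open>E\<close>-valued functions on \<open>\<Omega>\<close>: the elementary tensors span a dense subspace, and
  the inner product is multiplicative on them.
\<close>

definition is_function_tensor ::
    "'s set \<Rightarrow> ('s \<Rightarrow> complex) hilbert \<Rightarrow> 'e hilbert \<Rightarrow> ('s \<Rightarrow> 'e) hilbert \<Rightarrow> bool" where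
  "is_function_tensor \<Omega> H E T \<longleftrightarrow>
     function_hilbert_space \<Omega> E T \<and>
     (\<forall>f\<in>carrier H. \<forall>\<eta>\<in>carrier E. elementary_tensor \<Omega> E f \<eta> \<in> carrier T) \<and>
     (\<forall>f\<in>carrier H. \<forall>g\<in>carrier H. \<forall>\<eta>\<in>carrier E. \<forall>\<zeta>\<in>carrier E.
        cinner T (elementary_tensor \<Omega> E f \<eta>) (elementary_tensor \<Omega> E g \<zeta>) =
        cinner H f g * cinner E \<eta> \<zeta>) \<and>
     (\<forall>F\<in>carrier T. \<forall>e>0. \<exists>(m :: nat) f \<eta>.
        (\<forall>i<m. f i \<in> carrier H \<and> \<eta> i \<in> carrier E) \<and>
        cnorm T (F \<ominus>\<^bsub>T\<^esub> (\<Oplus>\<^bsub>T\<^esub>i\<in>{..<m}. elementary_tensor \<Omega> E (f i) (\<eta> i))) < e)"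

section \<open>The Drury--Arveson space and its multipliers\<close>

definition unit_ball :: "(complex ^ 'n) set" where
  "unit_ball = {z. (\<Sum>i\<in>UNIV. (cmod (z $ i))\<^sup>2) < 1}"

definition herm :: "complex ^ 'n \<Rightarrow> complex ^ 'n \<Rightarrow> complex" where
  "herm z w = (\<Sum>i\<in>UNIV. z $ i * cnj (w $ i))"

text \<open>
  The spaces chosen below exist (for the second, if \<open>E\<close> is a Hilbert space), and each is unique as an inner product space. The choice operator
  is used because record components are total functions: the values of the operations and of
  the inner product off the carrier (and the unused ring multiplication) are not determined.
\<close>

definition drury_arveson :: "((complex ^ 'n) \<Rightarrow> complex) hilbert" where
  "drury_arveson = (SOME H. is_rkhs unit_ball (\<lambda>z w. 1 / (1 - herm z w)) H)"

definition drury_arveson_tensor :: "'e hilbert \<Rightarrow> ((complex ^ 'n) \<Rightarrow> 'e) hilbert" where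
  "drury_arveson_tensor E = (SOME T. is_function_tensor unit_ball drury_arveson E T)"

definition multipliers ::
    "'e hilbert \<Rightarrow> 'b hilbert \<Rightarrow> ((complex ^ 'n) \<Rightarrow> 'e \<Rightarrow> 'b) set" where
  "multipliers E F = {\<Theta>.
     (\<forall>z\<in>unit_ball. \<Theta> z \<in> bounded_operators E F) \<and>
     (\<forall>f\<in>carrier (drury_arveson_tensor E).
        (\<lambda>z\<in>unit_ball. \<Theta> z (f z)) \<in> carrier (drury_arveson_tensor F))}"

end

theory Submission
  imports Defs
begin

text \<open>
  If \<open>K\<close> has the stated form, then \<open>I - (1 - \<langle>z,w\<rangle>) K(z,w) = \<Theta>(z) \<Theta>(w)\<^sup>*\<close>, which is a Gram kernel; nothing
  about the Drury--Arveson space is needed. Conversely, if \<open>L = I - (1 - \<langle>z,w\<rangle>) K\<close> is a kernel, let \<open>E\<close>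
  be the reproducing kernel Hilbert space of \<open>L\<close>, whose elements are functions on the ball with values
  in the given space, and let \<open>\<Theta>(z)\<close> be the evaluation at \<open>z\<close>. Then \<open>\<Theta>(w)\<^sup>* \<eta> = L(\<cdot>,w) \<eta>\<close>, so
  \<open>\<Theta>(z) \<Theta>(w)\<^sup>* = L(z,w)\<close>, and positivity of \<open>K\<close> says precisely that
  \<open>k\<^sub>w \<otimes> \<eta> \<mapsto> k\<^sub>w \<otimes> \<Theta>(w)\<^sup>* \<eta>\<close> is a contraction on the span of the kernel functions. Its adjoint is
  multiplication by \<open>\<Theta>\<close>.
\<close>

section \<open>Inner product spaces and the Riesz representation\<close>

text \<open>Existence of \<open>E\<close> is asserted at a fixed type of vectors, so the completion
  behind it cannot consist of classes of Cauchy sequences: each class has to be replaced by the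
  function on the ball that it defines. The form on finitely supported sections, from which that
  completion starts, is in general neither definite nor complete, and definiteness of the completed
  space is itself a consequence of Cauchy-Schwarz. Hence the geometry is first developed for
  semi-inner products. The Drury-Arveson space and its tensor products are fixed by choice
  operators, so existence has to be proved before anything is known of them; the construction that
  yields \<open>E\<close> supplies this too. Afterwards they are handled through point evaluations,
  never through monomials or an orthonormal basis. The contraction is not extended to an operator
  whose adjoint is then taken. For each \<open>f\<close> in the source, the required pairings of
  \<open>\<Theta> f\<close> with the kernel functions define a functional on their span; the
  contraction bounds it by the norm of \<open>f\<close>, and the vector that represents it has the
  values of \<open>\<Theta> f\<close>.\<close>

locale semi_inner_space =
  fixes H :: "'a hilbert" (structure)
  assumes is_module: "Module.module complex_ring H"
    and cinner_commute:
      "\<lbrakk>x \<in> carrier H; y \<in> carrier H\<rbrakk> \<Longrightarrow> cinner H x y = cnj (cinner H y x)"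
    and cinner_add_left:
      "\<lbrakk>x \<in> carrier H; y \<in> carrier H; z \<in> carrier H\<rbrakk>
        \<Longrightarrow> cinner H (x \<oplus>\<^bsub>H\<^esub> y) z = cinner H x z + cinner H y z"
    and cinner_smult_left:
      "\<lbrakk>x \<in> carrier H; y \<in> carrier H\<rbrakk> \<Longrightarrow> cinner H (c \<odot>\<^bsub>H\<^esub> x) y = c * cinner H x y"
    and cinner_nonneg: "x \<in> carrier H \<Longrightarrow> cinner H x x \<in> \<real>\<^sub>\<ge>\<^sub>0"

lemma complex_ring_simps [simp]:
  "carrier complex_ring = UNIV" "x \<otimes>\<^bsub>complex_ring\<^esub> y = x * y" "x \<oplus>\<^bsub>complex_ring\<^esub> y = x + y"
  "\<one>\<^bsub>complex_ring\<^esub> = 1" "\<zero>\<^bsub>complex_ring\<^esub> = 0"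
  by (simp_all add: complex_ring_def)

lemma cring_complex_ring: "cring complex_ring"
  using hilbert_space.is_module[OF hilbert_space_complex_hilbert] by (simp add: Module.module_def)

sublocale semi_inner_space \<subseteq> module complex_ring H
  by (rule is_module)

sublocale hilbert_space \<subseteq> semi_inner_space H
  by (rule semi_inner_space.intro)
    (fact is_module cinner_commute cinner_add_left cinner_smult_left cinner_nonneg)+

section \<open>Norm, Cauchy-Schwarz and continuity of a semi-inner product\<close>

context semi_inner_space
begin

lemma smult_in_carrier [simp, intro]: "x \<in> carrier H \<Longrightarrow> c \<odot> x \<in> carrier H"
  using smult_closed[of c x] by simp

lemma cinner_add_right:
  "\<lbrakk>x \<in> carrier H; y \<in> carrier H; z \<in> carrier H\<rbrakk> \<Longrightarrow> cinner H x (y \<oplus> z) = cinner H x y + cinner H x z"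
  by (subst (1 2 3) cinner_commute) (auto simp: cinner_add_left)

lemma cinner_smult_right:
  "\<lbrakk>x \<in> carrier H; y \<in> carrier H\<rbrakk> \<Longrightarrow> cinner H x (c \<odot> y) = cnj c * cinner H x y"
  by (subst (1 2) cinner_commute) (auto simp: cinner_smult_left)

lemma smult_zero: "x \<in> carrier H \<Longrightarrow> 0 \<odot> x = \<zero>"
  using smult_l_null[of x] by simp

lemma cinner_zero_left [simp]: "x \<in> carrier H \<Longrightarrow> cinner H \<zero> x = 0"
  using cinner_smult_left[of x x 0] by (simp add: smult_zero)

lemma cinner_zero_right [simp]: "x \<in> carrier H \<Longrightarrow> cinner H x \<zero> = 0"
  using cinner_smult_right[of x x 0] by (simp add: smult_zero)

lemma cinner_uminus_left: "\<lbrakk>x \<in> carrier H; y \<in> carrier H\<rbrakk> \<Longrightarrow> cinner H (\<ominus> x) y = - cinner H x y"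
  using cinner_add_left[of x "\<ominus> x" y] by (simp add: r_neg eq_neg_iff_add_eq_0 add.commute)

lemma cinner_uminus_right: "\<lbrakk>x \<in> carrier H; y \<in> carrier H\<rbrakk> \<Longrightarrow> cinner H x (\<ominus> y) = - cinner H x y"
  using cinner_add_right[of x y "\<ominus> y"] by (simp add: r_neg eq_neg_iff_add_eq_0 add.commute)

lemma cinner_minus_left:
  "\<lbrakk>x \<in> carrier H; y \<in> carrier H; z \<in> carrier H\<rbrakk> \<Longrightarrow> cinner H (x \<ominus> y) z = cinner H x z - cinner H y z"
  by (simp add: a_minus_def cinner_add_left cinner_uminus_left)

lemma cinner_minus_right:
  "\<lbrakk>x \<in> carrier H; y \<in> carrier H; z \<in> carrier H\<rbrakk> \<Longrightarrow> cinner H x (y \<ominus> z) = cinner H x y - cinner H x z"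
  by (simp add: a_minus_def cinner_add_right cinner_uminus_right)

lemmas cinner_simps = cinner_add_left cinner_add_right cinner_minus_left cinner_minus_right
  cinner_smult_left cinner_smult_right cinner_uminus_left cinner_uminus_right

lemma cinner_finsum_left:
  assumes "\<And>i. i < (m::nat) \<Longrightarrow> f i \<in> carrier H" "y \<in> carrier H"
  shows "cinner H (\<Oplus>i\<in>{..<m}. f i) y = (\<Sum>i<m. cinner H (f i) y)"
  using assms
proof (induction m)
  case (Suc m)
  have "(\<Oplus>i\<in>{..<Suc m}. f i) = f m \<oplus> (\<Oplus>i\<in>{..<m}. f i)"
    unfolding lessThan_Suc by (rule finsum_insert) (use Suc.prems in auto)
  moreover have "(\<Oplus>i\<in>{..<m}. f i) \<in> carrier H"
    by (rule finsum_closed) (use Suc.prems in auto)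
  ultimately show ?case
    using Suc by (simp add: cinner_add_left)
qed simp

lemma cinner_finsum_right:
  assumes "\<And>i. i < (m::nat) \<Longrightarrow> f i \<in> carrier H" "y \<in> carrier H"
  shows "cinner H y (\<Oplus>i\<in>{..<m}. f i) = (\<Sum>i<m. cinner H y (f i))"
proof -
  have "(\<Oplus>i\<in>{..<m}. f i) \<in> carrier H"
    by (rule finsum_closed) (use assms in auto)
  then have "cinner H y (\<Oplus>i\<in>{..<m}. f i) = cnj (\<Sum>i<m. cinner H (f i) y)"
    by (subst cinner_commute) (use assms in \<open>auto simp: cinner_finsum_left\<close>)
  also have "\<dots> = (\<Sum>i<m. cinner H y (f i))"
    unfolding cnj_sum by (rule sum.cong) (use assms in \<open>auto simp flip: cinner_commute\<close>)
  finally show ?thesis .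
qed

lemma cnorm_nonneg [simp]: "x \<in> carrier H \<Longrightarrow> 0 \<le> cnorm H x"
  using cinner_nonneg[of x] by (auto simp: cnorm_def complex_nonneg_Reals_iff)

lemma cinner_self: "x \<in> carrier H \<Longrightarrow> cinner H x x = of_real ((cnorm H x)\<^sup>2)"
  using cinner_nonneg[of x] by (auto simp: cnorm_def complex_nonneg_Reals_iff complex_eq_iff)

lemma cnorm_sq: "x \<in> carrier H \<Longrightarrow> (cnorm H x)\<^sup>2 = Re (cinner H x x)"
  by (simp add: cinner_self)

lemma Re_cinner_commute: "\<lbrakk>x \<in> carrier H; y \<in> carrier H\<rbrakk> \<Longrightarrow> Re (cinner H y x) = Re (cinner H x y)"
  by (subst cinner_commute) auto

lemma cnorm_add_sq:
  "\<lbrakk>x \<in> carrier H; y \<in> carrier H\<rbrakk> \<Longrightarrow>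
    (cnorm H (x \<oplus> y))\<^sup>2 = (cnorm H x)\<^sup>2 + 2 * Re (cinner H x y) + (cnorm H y)\<^sup>2"
  by (simp add: cnorm_sq cinner_simps Re_cinner_commute)

lemma cnorm_minus_sq:
  "\<lbrakk>x \<in> carrier H; y \<in> carrier H\<rbrakk> \<Longrightarrow>
    (cnorm H (x \<ominus> y))\<^sup>2 = (cnorm H x)\<^sup>2 - 2 * Re (cinner H x y) + (cnorm H y)\<^sup>2"
  by (simp add: cnorm_sq cinner_simps Re_cinner_commute)

lemma cnorm_smult: "x \<in> carrier H \<Longrightarrow> cnorm H (c \<odot> x) = cmod c * cnorm H x"
proof -
  assume x: "x \<in> carrier H"
  have "cinner H (c \<odot> x) (c \<odot> x) = of_real ((cmod c * cnorm H x)\<^sup>2)"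
    using x by (simp add: cinner_smult_left cinner_smult_right cinner_self[OF x] power_mult_distrib complex_norm_square mult.assoc del: of_real_power)
  then have "(cnorm H (c \<odot> x))\<^sup>2 = (cmod c * cnorm H x)\<^sup>2"
    using x by (simp only: cnorm_sq smult_in_carrier Re_complex_of_real)
  then show ?thesis
    using x by (simp add: power2_eq_iff_nonneg)
qed

text \<open>A vector of norm zero may be nonzero here, so \<open>y\<close> cannot be normalised at
  once. Shifting \<open>x\<close> along \<open>y\<close> by real multiples of \<open>a\<close> gives
  a real quadratic in \<open>s\<close> that is never negative; for nonzero \<open>a\<close> this
  forces \<open>Y > 0\<close>, and then \<open>s = 1 / Y\<close> is its minimiser.\<close>

lemma cauchy_schwarz:
  assumes "x \<in> carrier H" "y \<in> carrier H"
  shows "cmod (cinner H x y) \<le> cnorm H x * cnorm H y"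
proof (cases "cinner H x y = 0")
  case False
  define a X Y where "a = cinner H x y" and "X = (cnorm H x)\<^sup>2" and "Y = (cnorm H y)\<^sup>2"
  have pos: "(cmod a)\<^sup>2 > 0"
    using False by (simp add: a_def)
  have *: "0 \<le> X - 2 * s * (cmod a)\<^sup>2 + s\<^sup>2 * (cmod a)\<^sup>2 * Y" for s :: real
  proof -
    have "0 \<le> (cnorm H (x \<ominus> (of_real s * a) \<odot> y))\<^sup>2"
      by simp
    also have "\<dots> = X - 2 * Re (cnj (of_real s * a) * a) + (cmod (of_real s * a))\<^sup>2 * Y"
      using assms by (simp add: cnorm_minus_sq cnorm_smult cinner_simps a_def X_def Y_def power_mult_distrib)
    also have "Re (cnj (of_real s * a) * a) = s * (cmod a)\<^sup>2"
      by (simp add: cmod_power2 algebra_simps) (simp add: power2_eq_square algebra_simps)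
    finally show ?thesis
      by (simp add: norm_mult power_mult_distrib)
  qed
  have "Y \<noteq> 0"
  proof
    assume "Y = 0"
    \<comment> \<open>For \<open>Y = 0\<close> the bound is affine in \<open>s\<close> with negative
      slope; at this \<open>s\<close> it would read \<open>0 \<le> - 1\<close>.\<close>
    with *[of "(X + 1) / (2 * (cmod a)\<^sup>2)"] pos show False
      by simp
  qed
  then have "Y > 0" by (simp add: Y_def)
  with *[of "1 / Y"] have "(cmod a)\<^sup>2 \<le> X * Y"
    by (simp add: field_simps power2_eq_square)
  then have "(cmod a)\<^sup>2 \<le> (cnorm H x * cnorm H y)\<^sup>2"
    by (simp add: X_def Y_def power_mult_distrib)
  then show ?thesis
    unfolding a_def using assms by (simp add: power2_le_iff_abs_le)
qed (use assms in simp)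

lemma cnorm_triangle:
  assumes "x \<in> carrier H" "y \<in> carrier H"
  shows "cnorm H (x \<oplus> y) \<le> cnorm H x + cnorm H y"
proof -
  have "Re (cinner H x y) \<le> cnorm H x * cnorm H y"
    using cauchy_schwarz[OF assms] complex_Re_le_cmod order_trans by blast
  then have "(cnorm H (x \<oplus> y))\<^sup>2 \<le> (cnorm H x + cnorm H y)\<^sup>2"
    using assms by (simp add: cnorm_add_sq power2_sum)
  then show ?thesis
    using assms by (simp add: power2_le_iff_abs_le)
qed

lemma minus_add_minus:
  assumes "x \<in> carrier H" "y \<in> carrier H" "z \<in> carrier H"
  shows "(x \<ominus> y) \<oplus> (y \<ominus> z) = x \<ominus> z"
  using assms by (simp add: a_minus_def a_assoc r_neg1)

lemma cnorm_triangle_minus: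
  assumes "x \<in> carrier H" "y \<in> carrier H" "z \<in> carrier H"
  shows "cnorm H (x \<ominus> z) \<le> cnorm H (x \<ominus> y) + cnorm H (y \<ominus> z)"
  using cnorm_triangle[of "x \<ominus> y" "y \<ominus> z"] assms by (simp add: minus_add_minus)

lemma cnorm_minus_commute:
  "\<lbrakk>x \<in> carrier H; y \<in> carrier H\<rbrakk> \<Longrightarrow> cnorm H (x \<ominus> y) = cnorm H (y \<ominus> x)"
  unfolding cnorm_def by (simp add: cinner_simps)

lemma smult_minus_right: "\<lbrakk>x \<in> carrier H; y \<in> carrier H\<rbrakk> \<Longrightarrow> c \<odot> (x \<ominus> y) = c \<odot> x \<ominus> c \<odot> y"
  using smult_r_distr[of c x "\<ominus> y"] smult_r_minus[of c y] by (simp add: a_minus_def)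

lemma minus_minus: "\<lbrakk>x \<in> carrier H; y \<in> carrier H\<rbrakk> \<Longrightarrow> x \<ominus> (x \<ominus> y) = y"
  by (simp add: a_minus_def minus_add a_assoc[symmetric] r_neg)

lemma minus_zero [simp]: "x \<in> carrier H \<Longrightarrow> x \<ominus> \<zero> = x"
  using minus_equality[of \<zero> \<zero>] by (simp add: a_minus_def)

lemma minus_eq_zeroD: "\<lbrakk>x \<in> carrier H; y \<in> carrier H; x \<ominus> y = \<zero>\<rbrakk> \<Longrightarrow> x = y"
  using minus_minus[of x y] by simp

lemma cnorm_zero [simp]: "cnorm H \<zero> = 0"
  by (simp add: cnorm_def)

lemma cinner_diff_bound:
  assumes "x \<in> carrier H" "x' \<in> carrier H" "y \<in> carrier H" "y' \<in> carrier H"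
  shows "cmod (cinner H x y - cinner H x' y') \<le>
    cnorm H (x \<ominus> x') * cnorm H y + cnorm H x' * cnorm H (y \<ominus> y')"
proof -
  have "cinner H x y - cinner H x' y' = cinner H (x \<ominus> x') y + cinner H x' (y \<ominus> y')"
    using assms by (simp add: cinner_simps)
  also have "cmod \<dots> \<le> cmod (cinner H (x \<ominus> x') y) + cmod (cinner H x' (y \<ominus> y'))"
    by (rule norm_triangle_ineq)
  also have "\<dots> \<le> cnorm H (x \<ominus> x') * cnorm H y + cnorm H x' * cnorm H (y \<ominus> y')"
    using assms by (intro add_mono cauchy_schwarz) auto
  finally show ?thesis .
qed

lemma cnorm_diff_bound:
  assumes "x \<in> carrier H" "y \<in> carrier H"
  shows "\<bar>cnorm H x - cnorm H y\<bar> \<le> cnorm H (x \<ominus> y)"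
proof -
  have "cnorm H x \<le> cnorm H (x \<ominus> y) + cnorm H y"
    using cnorm_triangle_minus[of x y "\<zero>"] assms by simp
  moreover have "cnorm H y \<le> cnorm H (x \<ominus> y) + cnorm H x"
    using cnorm_triangle_minus[of y x "\<zero>"] assms cnorm_minus_commute[of x y] by simp
  ultimately show ?thesis by simp
qed

lemma tendsto_cnorm:
  assumes "\<And>n. X n \<in> carrier H" "x \<in> carrier H" "(\<lambda>n. cnorm H (X n \<ominus> x)) \<longlonglongrightarrow> 0"
  shows "(\<lambda>n. cnorm H (X n)) \<longlonglongrightarrow> cnorm H x"
proof -
  have "(\<lambda>n. cnorm H (X n) - cnorm H x) \<longlonglongrightarrow> 0"
    by (rule Lim_null_comparison[OF _ assms(3)]) (use assms cnorm_diff_bound in auto)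
  then show ?thesis by (simp add: LIM_zero_iff)
qed

lemma tendsto_cinner:
  assumes "\<And>n. X n \<in> carrier H" "x \<in> carrier H" "(\<lambda>n. cnorm H (X n \<ominus> x)) \<longlonglongrightarrow> 0"
    and "\<And>n. Y n \<in> carrier H" "y \<in> carrier H" "(\<lambda>n. cnorm H (Y n \<ominus> y)) \<longlonglongrightarrow> 0"
  shows "(\<lambda>n. cinner H (X n) (Y n)) \<longlonglongrightarrow> cinner H x y"
proof -
  have "(\<lambda>n. cnorm H (X n \<ominus> x) * cnorm H (Y n) + cnorm H x * cnorm H (Y n \<ominus> y)) \<longlonglongrightarrow>
      0 * cnorm H y + cnorm H x * 0"
    by (intro tendsto_intros assms tendsto_cnorm)
  then have *: "(\<lambda>n. cnorm H (X n \<ominus> x) * cnorm H (Y n) + cnorm H x * cnorm H (Y n \<ominus> y)) \<longlonglongrightarrow> 0"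
    by simp
  have "(\<lambda>n. cinner H (X n) (Y n) - cinner H x y) \<longlonglongrightarrow> 0"
    by (rule Lim_null_comparison[OF _ *]) (use assms cinner_diff_bound in auto)
  then show ?thesis by (simp add: LIM_zero_iff)
qed

definition Cauchy_seq :: "(nat \<Rightarrow> 'a) \<Rightarrow> bool" where
  "Cauchy_seq X \<longleftrightarrow> (\<forall>n. X n \<in> carrier H) \<and>
     (\<forall>e>0. \<exists>N. \<forall>i\<ge>N. \<forall>j\<ge>N. cnorm H (X i \<ominus> X j) < e)"

lemma Cauchy_seq_carrier: "Cauchy_seq X \<Longrightarrow> X n \<in> carrier H"
  by (simp add: Cauchy_seq_def)

text \<open>
  Minimising \<open>\<parallel>x\<parallel>\<^sup>2 - 2 Re a\<close> over the graph \<open>S\<close> of a bounded functional: by the parallelogram law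
  a minimising sequence is Cauchy, and by the variational inequality it represents the functional.
\<close>

lemma bounded_functional_Cauchy_seq:
  fixes S :: "('a \<times> complex) set"
  assumes S: "fst ` S \<subseteq> carrier H" and zero: "(\<zero>, 0) \<in> S"
    and add: "\<And>x a y b. (x, a) \<in> S \<Longrightarrow> (y, b) \<in> S \<Longrightarrow> (x \<oplus> y, a + b) \<in> S"
    and scale: "\<And>c x a. (x, a) \<in> S \<Longrightarrow> (c \<odot> x, c * a) \<in> S"
    and bound: "\<And>x a. (x, a) \<in> S \<Longrightarrow> cmod a \<le> M * cnorm H x"
  shows "\<exists>X. Cauchy_seq X \<and> (\<forall>n. X n \<in> fst ` S) \<and> (\<forall>(s, b)\<in>S. (\<lambda>n. cinner H s (X n)) \<longlonglongrightarrow> b)"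
proof -
  define J where "J = (\<lambda>(x, a). (cnorm H x)\<^sup>2 - 2 * Re a)"
  define m where "m = Inf (J ` S)"
  have carr: "x \<in> carrier H" if "(x, a) \<in> S" for x a
    using S that by force
  \<comment> \<open>Completing the square: with \<open>t\<close> the norm of \<open>x\<close>,
    \<open>J\<close> is at least \<open>t\<^sup>2 - 2 * M * t\<close>.\<close>
  have J_lower: "- M\<^sup>2 \<le> J p" if "p \<in> S" for p
  proof -
    obtain x a where p: "p = (x, a)" by (cases p)
    have "Re a \<le> M * cnorm H x"
      using bound that complex_Re_le_cmod order_trans unfolding p by blast
    moreover have "0 \<le> (cnorm H x - M)\<^sup>2" by simp
    ultimately show ?thesis
      unfolding p J_def by (simp add: power2_diff mult.commute)
  qed
  then have bdd: "bdd_below (J ` S)"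
    by (intro bdd_belowI[of _ "- M\<^sup>2"]) auto
  have m_le: "m \<le> J p" if "p \<in> S" for p
    unfolding m_def by (rule cInf_lower[OF _ bdd]) (use that in auto)
  have "\<exists>p\<in>S. J p < m + 1 / real (Suc n)" for n
  proof -
    have "m < m + 1 / real (Suc n)" by simp
    then show ?thesis
      unfolding m_def using cInf_lessD[of "J ` S"] zero by (metis (no_types, lifting) empty_iff image_iff)
  qed
  then obtain p where p: "\<And>n. p n \<in> S" "\<And>n. J (p n) < m + 1 / real (Suc n)"
    by metis
  define X a where "X = (\<lambda>n. fst (p n))" and "a = (\<lambda>n. snd (p n))"
  have Xa: "(X n, a n) \<in> S" for n
    by (simp add: X_def a_def p)
  have JX: "(cnorm H (X n))\<^sup>2 - 2 * Re (a n) < m + 1 / real (Suc n)" for n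
    using p(2)[of n] unfolding J_def X_def a_def by (simp add: split_beta)
  have Xc [simp]: "X n \<in> carrier H" for n
    using Xa carr by blast
  \<comment> \<open>At the midpoint \<open>J\<close> is still at least \<open>m\<close>, so the
    parallelogram law bounds the squared distance by twice the sum of the excesses of
    \<open>J\<close> over \<open>m\<close> at the two terms.\<close>
  have dist: "(cnorm H (X i \<ominus> X j))\<^sup>2 \<le> 2 / real (Suc i) + 2 / real (Suc j)" for i j
  proof -
    have "((1 / 2) \<odot> (X i \<oplus> X j), (1 / 2) * (a i + a j)) \<in> S"
      by (intro scale add Xa)
    from m_le[OF this] have "4 * m \<le> (cnorm H (X i \<oplus> X j))\<^sup>2 - 4 * Re (a i + a j)"
      by (simp add: J_def cnorm_smult power_divide) argo
    moreover have "(cnorm H (X i \<ominus> X j))\<^sup>2 + (cnorm H (X i \<oplus> X j))\<^sup>2 = 2 * (cnorm H (X i))\<^sup>2 + 2 * (cnorm H (X j))\<^sup>2"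
      by (simp add: cnorm_add_sq cnorm_minus_sq)
    ultimately show ?thesis
      using JX[of i] JX[of j] by (simp add: algebra_simps)
  qed
  have cau: "Cauchy_seq X"
    unfolding Cauchy_seq_def
  proof safe
    fix e :: real assume e: "0 < e"
    then obtain N where N: "4 / e\<^sup>2 < real (Suc N)"
      by (metis reals_Archimedean2 less_trans of_nat_less_iff lessI)
    have "cnorm H (X i \<ominus> X j) < e" if "i \<ge> N" "j \<ge> N" for i j
    proof -
      have "2 / real (Suc i) \<le> 2 / real (Suc N)" "2 / real (Suc j) \<le> 2 / real (Suc N)"
        using that by (auto intro!: divide_left_mono)
      then have "(cnorm H (X i \<ominus> X j))\<^sup>2 \<le> 4 / real (Suc N)"
        using dist[of i j] by linarith
      also have "\<dots> < e\<^sup>2"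
        using N e by (simp add: field_simps)
      finally show ?thesis
        using e by (simp add: power_less_imp_less_base)
    qed
    then show "\<exists>N. \<forall>i\<ge>N. \<forall>j\<ge>N. cnorm H (X i \<ominus> X j) < e" by blast
  qed simp
  have lim: "(\<lambda>n. cinner H s (X n)) \<longlonglongrightarrow> b" if sb: "(s, b) \<in> S" for s b
  proof -
    have s [simp]: "s \<in> carrier H" using sb carr by blast
    \<comment> \<open>The summand \<open>1\<close> keeps \<open>C\<close> positive when
      \<open>s\<close> has norm zero.\<close>
    define C where "C = (cnorm H s)\<^sup>2 + 1"
    have C: "C > 0" unfolding C_def by (simp add: add_nonneg_pos)
    define d where "d = (\<lambda>n. cinner H s (X n) - b)"
    have d: "(cmod (d n))\<^sup>2 \<le> C * (1 / real (Suc n))" for n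
    proof -
      \<comment> \<open>This is the minimiser of
        \<open>2 * Re (t * d n) + (cmod t)\<^sup>2 * C\<close>. Moving \<open>X n\<close> by
        \<open>t \<odot> s\<close> lowers \<open>J\<close> by at least
        \<open>(cmod (d n))\<^sup>2 / C\<close>, while \<open>J\<close> at \<open>X n\<close>
        exceeds the infimum by less than \<open>1 / Suc n\<close>.\<close>
      define t where "t = - cnj (d n) / of_real C"
      have "(X n \<oplus> t \<odot> s, a n + t * b) \<in> S"
        by (intro scale add Xa sb)
      from m_le[OF this]
      have "m \<le> (cnorm H (X n))\<^sup>2 + 2 * Re (cinner H (t \<odot> s) (X n)) + (cmod t)\<^sup>2 * (cnorm H s)\<^sup>2 - 2 * Re (a n + t * b)"
        by (simp add: J_def cnorm_add_sq cnorm_smult power_mult_distrib Re_cinner_commute)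
      also have "\<dots> = ((cnorm H (X n))\<^sup>2 - 2 * Re (a n)) + 2 * Re (t * d n) + (cmod t)\<^sup>2 * (cnorm H s)\<^sup>2"
        by (simp add: d_def cinner_simps algebra_simps)
      also have "Re (t * d n) = - (cmod (d n))\<^sup>2 / C"
      proof -
        have "t * d n = - of_real ((cmod (d n))\<^sup>2) / of_real C"
          unfolding t_def complex_norm_square by simp
        also have "\<dots> = of_real (- (cmod (d n))\<^sup>2 / C)" by simp
        finally show ?thesis by (simp only: Re_complex_of_real)
      qed
      also have "(cmod t)\<^sup>2 * (cnorm H s)\<^sup>2 \<le> (cmod t)\<^sup>2 * C"
        by (intro mult_left_mono) (auto simp: C_def)
      also have "(cmod t)\<^sup>2 * C = (cmod (d n))\<^sup>2 / C"
        using C by (simp add: t_def norm_divide power_divide power2_eq_square)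
      finally have "(cmod (d n))\<^sup>2 / C \<le> 1 / real (Suc n)"
        using JX[of n] by simp
      then show ?thesis
        using C by (simp add: field_simps)
    qed
    have lim0: "(\<lambda>n. C * (1 / real (Suc n))) \<longlonglongrightarrow> 0"
      using tendsto_mult[OF tendsto_const[of C] LIMSEQ_Suc[OF lim_1_over_n]] by simp
    have "(\<lambda>n. (cmod (d n))\<^sup>2) \<longlonglongrightarrow> 0"
      by (rule Lim_null_comparison[OF always_eventually lim0]) (use d in \<open>simp only: real_norm_def abs_power2 simp_thms\<close>)
    then have "(\<lambda>n. sqrt ((cmod (d n))\<^sup>2)) \<longlonglongrightarrow> sqrt 0"
      by (intro tendsto_intros)
    then have "d \<longlonglongrightarrow> 0"
      by (simp add: tendsto_norm_zero_iff)
    then show ?thesis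
      unfolding d_def by (simp add: LIM_zero_iff)
  qed
  have XS: "X n \<in> fst ` S" for n
    by (rule image_eqI[OF _ p(1)]) (simp add: X_def)
  show ?thesis
    by (intro exI[of _ X] conjI allI ballI cau XS) (clarify, rule lim)
qed

end

section \<open>Riesz representation on subspaces of a complete space\<close>

context hilbert_space
begin

lemma Cauchy_seq_converges:
  "Cauchy_seq X \<Longrightarrow> \<exists>x\<in>carrier H. (\<lambda>i. cnorm H (X i \<ominus>\<^bsub>H\<^esub> x)) \<longlonglongrightarrow> 0"
  using complete[of X] by (auto simp: Cauchy_seq_def)

lemma eq_if_cinner_eq:
  assumes "x \<in> carrier H" "y \<in> carrier H" "\<And>u. u \<in> carrier H \<Longrightarrow> cinner H u x = cinner H u y"
  shows "x = y"
proof -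
  have "cinner H (x \<ominus>\<^bsub>H\<^esub> y) (x \<ominus>\<^bsub>H\<^esub> y) = 0"
    using assms by (simp add: cinner_minus_right)
  then show ?thesis
    using assms minus_eq_zeroD cinner_definite by (meson minus_closed)
qed

text \<open>The domain of the functional need be neither closed nor dense: the minimising sequence
  stays in it, so the representing vector lies in its closure. The sequence \<open>X\<close> is part
  of the conclusion because density of total families is read off from it in
  \<open>dense_generators\<close>.\<close>

theorem bounded_functional_extension:
  fixes S :: "('a \<times> complex) set"
  assumes S: "fst ` S \<subseteq> carrier H" and zero: "(\<zero>\<^bsub>H\<^esub>, 0) \<in> S"
    and add: "\<And>x a y b. (x, a) \<in> S \<Longrightarrow> (y, b) \<in> S \<Longrightarrow> (x \<oplus>\<^bsub>H\<^esub> y, a + b) \<in> S"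
    and scale: "\<And>c x a. (x, a) \<in> S \<Longrightarrow> (c \<odot>\<^bsub>H\<^esub> x, c * a) \<in> S"
    and bound: "\<And>x a. (x, a) \<in> S \<Longrightarrow> cmod a \<le> M * cnorm H x"
  obtains h X where "h \<in> carrier H" "\<And>s b. (s, b) \<in> S \<Longrightarrow> cinner H s h = b"
    "\<And>n. X n \<in> fst ` S" "(\<lambda>n. cnorm H (X n \<ominus>\<^bsub>H\<^esub> h)) \<longlonglongrightarrow> 0"
proof -
  obtain X where X: "Cauchy_seq X" "\<And>n. X n \<in> fst ` S"
    "\<And>s b. (s, b) \<in> S \<Longrightarrow> (\<lambda>n. cinner H s (X n)) \<longlonglongrightarrow> b"
    using bounded_functional_Cauchy_seq[OF assms] by fast
  obtain h where h: "h \<in> carrier H" "(\<lambda>i. cnorm H (X i \<ominus>\<^bsub>H\<^esub> h)) \<longlonglongrightarrow> 0"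
    using Cauchy_seq_converges[OF X(1)] by blast
  have "cinner H s h = b" if "(s, b) \<in> S" for s b
  proof -
    have "s \<in> carrier H" using that S by force
    then have "(\<lambda>n. cinner H s (X n)) \<longlonglongrightarrow> cinner H s h"
      using h Cauchy_seq_carrier[OF X(1)] by (intro tendsto_cinner) (auto simp: a_minus_def r_neg)
    with X(3)[OF that] show ?thesis
      using LIMSEQ_unique by blast
  qed
  then show ?thesis
    using that h X(2) by blast
qed

end

section \<open>Cauchy sequences in a space that need not be complete\<close>

context semi_inner_space
begin

lemma minus_eq_add_smult: "\<lbrakk>x \<in> carrier H; y \<in> carrier H\<rbrakk> \<Longrightarrow> x \<ominus> y = x \<oplus> (- 1) \<odot> y"
proof -
  assume *: "x \<in> carrier H" "y \<in> carrier H"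
  have "((- 1) + 1) \<odot> y = (- 1) \<odot> y \<oplus> 1 \<odot> y"
    using smult_l_distr[of "- 1" 1 y] * by simp
  then have "(- 1) \<odot> y \<oplus> y = \<zero>"
    using * smult_one[of y] by (simp add: smult_zero)
  then show ?thesis
    using * minus_equality[of "(- 1) \<odot> y" y] by (simp add: a_minus_def)
qed

lemma Cauchy_seq_const: "x \<in> carrier H \<Longrightarrow> Cauchy_seq (\<lambda>_. x)"
  by (auto simp: Cauchy_seq_def a_minus_def r_neg)

lemma Cauchy_seq_smult:
  assumes "Cauchy_seq X"
  shows "Cauchy_seq (\<lambda>n. c \<odot> X n)"
  unfolding Cauchy_seq_def
proof safe
  show "c \<odot> X n \<in> carrier H" for n
    using assms by (simp add: Cauchy_seq_carrier)
  fix e :: real assume e: "e > 0"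
  \<comment> \<open>The summand \<open>1\<close> covers \<open>c = 0\<close>.\<close>
  have "e / (cmod c + 1) > 0"
    using e by (simp add: add_nonneg_pos)
  then obtain N where N: "\<And>i j. i \<ge> N \<Longrightarrow> j \<ge> N \<Longrightarrow> cnorm H (X i \<ominus> X j) < e / (cmod c + 1)"
    using assms unfolding Cauchy_seq_def by blast
  have "cnorm H (c \<odot> X i \<ominus> c \<odot> X j) < e" if "i \<ge> N" "j \<ge> N" for i j
  proof -
    have "cnorm H (c \<odot> X i \<ominus> c \<odot> X j) = cmod c * cnorm H (X i \<ominus> X j)"
      using assms by (simp add: Cauchy_seq_carrier cnorm_smult flip: smult_minus_right)
    also have "\<dots> \<le> (cmod c + 1) * cnorm H (X i \<ominus> X j)"
      using assms by (intro mult_right_mono) (auto simp: Cauchy_seq_carrier)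
    also have "\<dots> < e"
      using N[OF that] by (simp add: pos_less_divide_eq add_nonneg_pos mult.commute)
    finally show ?thesis .
  qed
  then show "\<exists>N. \<forall>i\<ge>N. \<forall>j\<ge>N. cnorm H (c \<odot> X i \<ominus> c \<odot> X j) < e" by blast
qed

lemma Cauchy_seq_add:
  assumes "Cauchy_seq X" "Cauchy_seq Y"
  shows "Cauchy_seq (\<lambda>n. X n \<oplus> Y n)"
  unfolding Cauchy_seq_def
proof safe
  show "X n \<oplus> Y n \<in> carrier H" for n
    using assms by (simp add: Cauchy_seq_carrier)
  fix e :: real assume e: "e > 0"
  obtain N where N: "\<And>i j. i \<ge> N \<Longrightarrow> j \<ge> N \<Longrightarrow> cnorm H (X i \<ominus> X j) < e / 2"
    using assms(1) half_gt_zero[OF e] unfolding Cauchy_seq_def by blast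
  obtain N' where N': "\<And>i j. i \<ge> N' \<Longrightarrow> j \<ge> N' \<Longrightarrow> cnorm H (Y i \<ominus> Y j) < e / 2"
    using assms(2) half_gt_zero[OF e] unfolding Cauchy_seq_def by blast
  have "cnorm H ((X i \<oplus> Y i) \<ominus> (X j \<oplus> Y j)) < e" if "i \<ge> max N N'" "j \<ge> max N N'" for i j
  proof -
    have "(X i \<oplus> Y i) \<ominus> (X j \<oplus> Y j) = (X i \<ominus> X j) \<oplus> (Y i \<ominus> Y j)"
      using assms by (simp add: Cauchy_seq_carrier a_minus_def minus_add a_ac)
    then have "cnorm H ((X i \<oplus> Y i) \<ominus> (X j \<oplus> Y j)) \<le> cnorm H (X i \<ominus> X j) + cnorm H (Y i \<ominus> Y j)"
      using assms by (simp add: Cauchy_seq_carrier cnorm_triangle)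
    also have "\<dots> < e"
      using N[of i j] N'[of i j] that by simp
    finally show ?thesis .
  qed
  then show "\<exists>N. \<forall>i\<ge>N. \<forall>j\<ge>N. cnorm H ((X i \<oplus> Y i) \<ominus> (X j \<oplus> Y j)) < e" by blast
qed

lemma Cauchy_seq_minus: "\<lbrakk>Cauchy_seq X; Cauchy_seq Y\<rbrakk> \<Longrightarrow> Cauchy_seq (\<lambda>n. X n \<ominus> Y n)"
  using Cauchy_seq_add[OF _ Cauchy_seq_smult[of Y "- 1"], of X]
  by (simp add: minus_eq_add_smult Cauchy_seq_carrier)

lemma Cauchy_seq_bounded:
  assumes "Cauchy_seq X"
  obtains B where "B > 0" "\<And>n. cnorm H (X n) \<le> B"
proof -
  have "Cauchy (\<lambda>n. cnorm H (X n))"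
  proof (rule metric_CauchyI)
    fix e :: real assume "e > 0"
    then obtain N where N: "\<And>i j. i \<ge> N \<Longrightarrow> j \<ge> N \<Longrightarrow> cnorm H (X i \<ominus> X j) < e"
      using assms unfolding Cauchy_seq_def by blast
    have "dist (cnorm H (X i)) (cnorm H (X j)) < e" if "i \<ge> N" "j \<ge> N" for i j
      using cnorm_diff_bound[of "X i" "X j"] N[OF that] assms
      by (simp add: Cauchy_seq_carrier dist_real_def)
    then show "\<exists>M. \<forall>m\<ge>M. \<forall>n\<ge>M. dist (cnorm H (X m)) (cnorm H (X n)) < e" by blast
  qed
  then have "Bseq (\<lambda>n. cnorm H (X n))"
    by (rule Cauchy_Bseq)
  then obtain B where "B > 0" "\<And>n. norm (cnorm H (X n)) \<le> B"
    by (auto simp: Bseq_def)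
  with that show ?thesis
    by (metis abs_ge_self order_trans real_norm_def)
qed

lemma convergent_cinner_Cauchy_seq:
  assumes "Cauchy_seq X" "Cauchy_seq Y"
  shows "convergent (\<lambda>n. cinner H (X n) (Y n))"
proof (rule Cauchy_convergent, rule metric_CauchyI)
  fix e :: real assume e: "e > 0"
  obtain B where B: "B > 0" "\<And>n. cnorm H (X n) \<le> B"
    using Cauchy_seq_bounded[OF assms(1)] by blast
  obtain C where C: "C > 0" "\<And>n. cnorm H (Y n) \<le> C"
    using Cauchy_seq_bounded[OF assms(2)] by blast
  have "e / (2 * C) > 0" "e / (2 * B) > 0" using e B C by auto
  then obtain N N' where N: "\<And>i j. i \<ge> N \<Longrightarrow> j \<ge> N \<Longrightarrow> cnorm H (X i \<ominus> X j) < e / (2 * C)"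
    and N': "\<And>i j. i \<ge> N' \<Longrightarrow> j \<ge> N' \<Longrightarrow> cnorm H (Y i \<ominus> Y j) < e / (2 * B)"
    using assms unfolding Cauchy_seq_def by meson
  have "dist (cinner H (X i) (Y i)) (cinner H (X j) (Y j)) < e"
    if "i \<ge> max N N'" "j \<ge> max N N'" for i j
  proof -
    note [simp] = Cauchy_seq_carrier[OF assms(1)] Cauchy_seq_carrier[OF assms(2)]
    have "dist (cinner H (X i) (Y i)) (cinner H (X j) (Y j)) \<le>
        cnorm H (X i \<ominus> X j) * cnorm H (Y i) + cnorm H (X j) * cnorm H (Y i \<ominus> Y j)"
      unfolding dist_norm by (intro cinner_diff_bound) auto
    also have "\<dots> \<le> cnorm H (X i \<ominus> X j) * C + B * cnorm H (Y i \<ominus> Y j)"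
      by (intro add_mono mult_left_mono mult_right_mono B C) auto
    also have "cnorm H (X i \<ominus> X j) * C < e / 2"
      using N[of i j] that C by (simp add: field_simps)
    also have "B * cnorm H (Y i \<ominus> Y j) < e / 2"
      using N'[of i j] that B by (simp add: field_simps)
    finally show ?thesis by simp
  qed
  then show "\<exists>M. \<forall>m\<ge>M. \<forall>n\<ge>M. dist (cinner H (X m) (Y m)) (cinner H (X n) (Y n)) < e" by blast
qed

text \<open>Split the square of the norm of \<open>X n\<close> by a fixed late term
  \<open>X N\<close>: the pairing with \<open>X N\<close> is small by weak convergence, the pairing
  with \<open>X n \<ominus> X N\<close> by boundedness and the Cauchy property. This is what makes
  the inner product of the completion independent of the sequences that represent its
  elements.\<close>

lemma weakly_null_Cauchy_seq:
  assumes X: "Cauchy_seq X" and weak: "\<And>u. u \<in> carrier H \<Longrightarrow> (\<lambda>n. cinner H (X n) u) \<longlonglongrightarrow> 0"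
  shows "(\<lambda>n. cnorm H (X n)) \<longlonglongrightarrow> 0"
proof (rule LIMSEQ_I)
  fix e :: real assume e: "e > 0"
  note [simp] = Cauchy_seq_carrier[OF X]
  obtain B where B: "B > 0" "\<And>n. cnorm H (X n) \<le> B"
    using Cauchy_seq_bounded[OF X] by blast
  have "e\<^sup>2 / (2 * B) > 0" using e B by simp
  then obtain N where N: "\<And>i j. i \<ge> N \<Longrightarrow> j \<ge> N \<Longrightarrow> cnorm H (X i \<ominus> X j) < e\<^sup>2 / (2 * B)"
    using X unfolding Cauchy_seq_def by blast
  have "e\<^sup>2 / 2 > 0" using e by simp
  from LIMSEQ_D[OF weak[of "X N"] this]
  obtain N' where N': "\<And>n. n \<ge> N' \<Longrightarrow> cmod (cinner H (X n) (X N)) < e\<^sup>2 / 2" by auto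
  have "norm (cnorm H (X n) - 0) < e" if "n \<ge> max N N'" for n
  proof -
    have "(cnorm H (X n))\<^sup>2 = Re (cinner H (X n) (X n \<ominus> X N) + cinner H (X n) (X N))"
      by (simp add: cinner_minus_right cnorm_sq)
    also have "\<dots> \<le> cmod (cinner H (X n) (X n \<ominus> X N)) + cmod (cinner H (X n) (X N))"
      by (intro order_trans[OF complex_Re_le_cmod] norm_triangle_ineq)
    also have "cmod (cinner H (X n) (X n \<ominus> X N)) \<le> B * cnorm H (X n \<ominus> X N)"
      by (intro order_trans[OF cauchy_schwarz] mult_right_mono B) auto
    also have "B * cnorm H (X n \<ominus> X N) < e\<^sup>2 / 2"
      using N[of n N] that B by (simp add: field_simps)
    also have "cmod (cinner H (X n) (X N)) < e\<^sup>2 / 2"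
      using N' that by simp
    finally have "(cnorm H (X n))\<^sup>2 < e\<^sup>2" by simp
    then show ?thesis
      using e by (simp add: power_less_imp_less_base)
  qed
  then show "\<exists>no. \<forall>n\<ge>no. norm (cnorm H (X n) - 0) < e" by blast
qed

end

lemma (in semi_inner_space) smult_one_left: "x \<in> carrier H \<Longrightarrow> 1 \<odot> x = x"
  using smult_one[of x] by simp

lemma (in semi_inner_space) smult_add_left: "x \<in> carrier H \<Longrightarrow> (a + b) \<odot> x = a \<odot> x \<oplus> b \<odot> x"
  using smult_l_distr[of a b x] by simp

lemma (in semi_inner_space) smult_assoc: "x \<in> carrier H \<Longrightarrow> (a * b) \<odot> x = a \<odot> (b \<odot> x)"
  using smult_assoc1[of a b x] by simp

text \<open>All axioms hold pointwise, and extensionality on \<open>\<Omega>\<close> turns pointwise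
  equality into equality; additive inverses are multiples by \<open>- 1\<close>. Both the sections
  and the completed function space get their module structure from here.\<close>

lemma (in semi_inner_space) function_space_module:
  fixes E :: "('s \<Rightarrow> 'a) hilbert"
  assumes carr: "carrier E \<subseteq> \<Omega> \<rightarrow>\<^sub>E carrier H"
    and zero: "\<zero>\<^bsub>E\<^esub> = (\<lambda>z\<in>\<Omega>. \<zero>\<^bsub>H\<^esub>)" "\<zero>\<^bsub>E\<^esub> \<in> carrier E"
    and add: "\<And>f g. f \<in> carrier E \<Longrightarrow> g \<in> carrier E \<Longrightarrow> f \<oplus>\<^bsub>E\<^esub> g = (\<lambda>z\<in>\<Omega>. f z \<oplus>\<^bsub>H\<^esub> g z)"
      "\<And>f g. f \<in> carrier E \<Longrightarrow> g \<in> carrier E \<Longrightarrow> f \<oplus>\<^bsub>E\<^esub> g \<in> carrier E"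
    and smult: "\<And>c f. f \<in> carrier E \<Longrightarrow> c \<odot>\<^bsub>E\<^esub> f = (\<lambda>z\<in>\<Omega>. c \<odot>\<^bsub>H\<^esub> f z)"
      "\<And>c f. f \<in> carrier E \<Longrightarrow> c \<odot>\<^bsub>E\<^esub> f \<in> carrier E"
  shows "Module.module complex_ring E"
proof -
  have val: "f z \<in> carrier H" if "f \<in> carrier E" "z \<in> \<Omega>" for f z
    using carr that by blast
  have ext: "f = g" if "f \<in> carrier E" "g \<in> carrier E" "\<And>z. z \<in> \<Omega> \<Longrightarrow> f z = g z" for f g
    using carr that by (meson PiE_ext subsetD)
  have [simp]: "(f \<oplus>\<^bsub>E\<^esub> g) z = f z \<oplus>\<^bsub>H\<^esub> g z" "(c \<odot>\<^bsub>E\<^esub> f) z = c \<odot>\<^bsub>H\<^esub> f z" "\<zero>\<^bsub>E\<^esub> z = \<zero>\<^bsub>H\<^esub>"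
    if "f \<in> carrier E" "g \<in> carrier E" "z \<in> \<Omega>" for f g c z
    using that by (simp_all add: add(1) smult(1) zero(1))
  note [simp] = zero(2) add(2) smult(2) val
  have ag: "abelian_group E"
  proof (rule abelian_groupI)
    fix f assume f: "f \<in> carrier E"
    have "(- 1) \<odot>\<^bsub>H\<^esub> f z \<oplus>\<^bsub>H\<^esub> f z = \<zero>\<^bsub>H\<^esub>" if "z \<in> \<Omega>" for z
      using smult_l_distr[of "- 1" 1 "f z"] smult_one[of "f z"] val[OF f that] by (simp add: smult_zero)
    then have "(- 1) \<odot>\<^bsub>E\<^esub> f \<oplus>\<^bsub>E\<^esub> f = \<zero>\<^bsub>E\<^esub>"
      by (intro ext) (use f in auto)
    then show "\<exists>g\<in>carrier E. g \<oplus>\<^bsub>E\<^esub> f = \<zero>\<^bsub>E\<^esub>"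
      using smult(2)[OF f] by blast
    show "\<zero>\<^bsub>E\<^esub> \<oplus>\<^bsub>E\<^esub> f = f"
      by (rule ext) (use f in auto)
  next
    fix f g assume fg: "f \<in> carrier E" "g \<in> carrier E"
    show "f \<oplus>\<^bsub>E\<^esub> g = g \<oplus>\<^bsub>E\<^esub> f"
      by (rule ext) (use fg in \<open>auto simp: a_comm\<close>)
    fix h assume h: "h \<in> carrier E"
    show "f \<oplus>\<^bsub>E\<^esub> g \<oplus>\<^bsub>E\<^esub> h = f \<oplus>\<^bsub>E\<^esub> (g \<oplus>\<^bsub>E\<^esub> h)"
      by (rule ext) (use fg h in \<open>auto simp: a_assoc\<close>)
  qed auto
  show ?thesis
    by (intro moduleI cring_complex_ring ag)
      (auto intro!: ext simp: smult_add_left smult_r_distr smult_assoc smult_one_left)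
qed

section \<open>The reproducing kernel Hilbert space of an operator-valued kernel\<close>

locale operator_kernel = hilbert_space H for H :: "'b hilbert" (structure) +
  fixes \<Omega> :: "'s set" and L :: "'s \<Rightarrow> 's \<Rightarrow> 'b \<Rightarrow> 'b"
  assumes kernel: "is_kernel \<Omega> H L"
begin

lemma L_bounded: "z \<in> \<Omega> \<Longrightarrow> w \<in> \<Omega> \<Longrightarrow> L z w \<in> bounded_operators H H"
  using kernel by (simp add: is_kernel_def)

lemma L_closed [simp]: "z \<in> \<Omega> \<Longrightarrow> w \<in> \<Omega> \<Longrightarrow> x \<in> carrier H \<Longrightarrow> L z w x \<in> carrier H"
  using L_bounded[of z w] by (auto simp: bounded_operators_def)

lemma L_add: "z \<in> \<Omega> \<Longrightarrow> w \<in> \<Omega> \<Longrightarrow> x \<in> carrier H \<Longrightarrow> y \<in> carrier H \<Longrightarrow> L z w (x \<oplus> y) = L z w x \<oplus> L z w y"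
  using L_bounded[of z w] by (simp add: bounded_operators_def)

lemma L_smult: "z \<in> \<Omega> \<Longrightarrow> w \<in> \<Omega> \<Longrightarrow> x \<in> carrier H \<Longrightarrow> L z w (c \<odot> x) = c \<odot> L z w x"
  using L_bounded[of z w] by (simp add: bounded_operators_def)

lemma L_zero [simp]: "z \<in> \<Omega> \<Longrightarrow> w \<in> \<Omega> \<Longrightarrow> L z w \<zero> = \<zero>"
  using L_smult[of z w \<zero> 0] by (simp add: smult_zero)

section \<open>Finitely supported sections and their Gram form\<close>

definition supp :: "('s \<Rightarrow> 'b) \<Rightarrow> 's set" where
  "supp v = {z\<in>\<Omega>. v z \<noteq> \<zero>}"

text \<open>The value at \<open>z\<close>, paired with \<open>\<eta>\<close>, of the combination of
  kernel functions that has coefficients \<open>v w\<close>. Pairing before summing keeps all sums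
  scalar.\<close>

definition ev :: "('s \<Rightarrow> 'b) \<Rightarrow> 's \<Rightarrow> 'b \<Rightarrow> complex" where
  "ev v z \<eta> = (\<Sum>w\<in>supp v. cinner H (L z w (v w)) \<eta>)"

text \<open>
  The finitely supported section \<open>v\<close> stands for the function \<open>\<Sum>w. L \<cdot> w (v w)\<close>.
\<close>

definition sections :: "('s \<Rightarrow> 'b) hilbert" where
  "sections = \<lparr>carrier = {v \<in> \<Omega> \<rightarrow>\<^sub>E carrier H. finite (supp v)}, mult = undefined, one = undefined,
     zero = (\<lambda>z\<in>\<Omega>. \<zero>), add = (\<lambda>u v. \<lambda>z\<in>\<Omega>. u z \<oplus> v z), smult = (\<lambda>c v. \<lambda>z\<in>\<Omega>. c \<odot> v z),
     cinner = (\<lambda>v u. \<Sum>z\<in>supp u. ev v z (u z))\<rparr>"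

text \<open>The section standing for the single kernel function
  \<open>\<lambda>x. L x z \<eta>\<close>. Pairing with it in \<open>sections\<close> is evaluation
  at \<open>z\<close> against \<open>\<eta>\<close>.\<close>

definition delta :: "'s \<Rightarrow> 'b \<Rightarrow> 's \<Rightarrow> 'b" where
  "delta z \<eta> = (\<lambda>w\<in>\<Omega>. if w = z then \<eta> else \<zero>)"

lemma sections_simps [simp]:
  "\<zero>\<^bsub>sections\<^esub> = (\<lambda>z\<in>\<Omega>. \<zero>)" "u \<oplus>\<^bsub>sections\<^esub> v = (\<lambda>z\<in>\<Omega>. u z \<oplus> v z)"
  "c \<odot>\<^bsub>sections\<^esub> v = (\<lambda>z\<in>\<Omega>. c \<odot> v z)"
  by (simp_all add: sections_def)

lemma sections_carrier: "v \<in> carrier sections \<longleftrightarrow> v \<in> \<Omega> \<rightarrow>\<^sub>E carrier H \<and> finite (supp v)"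
  by (simp add: sections_def)

lemma sections_val [simp]: "v \<in> carrier sections \<Longrightarrow> z \<in> \<Omega> \<Longrightarrow> v z \<in> carrier H"
  by (auto simp: sections_carrier)

lemma supp_subset: "supp v \<subseteq> \<Omega>"
  by (auto simp: supp_def)

text \<open>Supports change under addition and scaling, so linearity is proved by summing over one
  finite set that contains all supports involved; the extra terms vanish because
  \<open>L z w\<close> maps zero to zero.\<close>

lemma ev_eq:
  assumes "finite A" "supp v \<subseteq> A" "A \<subseteq> \<Omega>" "z \<in> \<Omega>" "\<eta> \<in> carrier H"
  shows "ev v z \<eta> = (\<Sum>w\<in>A. cinner H (L z w (v w)) \<eta>)"
  unfolding ev_def by (rule sum.mono_neutral_left) (use assms in \<open>auto simp: supp_def\<close>)

lemma ev_add_right: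
  assumes "v \<in> carrier sections" "z \<in> \<Omega>" "\<eta> \<in> carrier H" "\<zeta> \<in> carrier H"
  shows "ev v z (\<eta> \<oplus> \<zeta>) = ev v z \<eta> + ev v z \<zeta>"
  unfolding ev_def sum.distrib[symmetric]
  by (rule sum.cong) (use assms supp_subset[of v] in \<open>auto simp: subset_iff intro!: cinner_add_right\<close>)

lemma ev_smult_right:
  assumes "v \<in> carrier sections" "z \<in> \<Omega>" "\<eta> \<in> carrier H"
  shows "ev v z (c \<odot> \<eta>) = cnj c * ev v z \<eta>"
  unfolding ev_def sum_distrib_left
  by (rule sum.cong) (use assms supp_subset[of v] in \<open>auto simp: subset_iff intro!: cinner_smult_right\<close>)

lemma ev_zero_right:
  assumes "v \<in> carrier sections" "z \<in> \<Omega>"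
  shows "ev v z \<zero> = 0"
  using ev_smult_right[OF assms, of \<zero> 0] by (simp add: smult_zero)

lemma cinner_sections_eq:
  assumes "v \<in> carrier sections" "finite A" "supp u \<subseteq> A" "A \<subseteq> \<Omega>"
  shows "cinner sections v u = (\<Sum>z\<in>A. ev v z (u z))"
proof -
  have "cinner sections v u = (\<Sum>z\<in>supp u. ev v z (u z))"
    by (simp add: sections_def)
  also have "\<dots> = (\<Sum>z\<in>A. ev v z (u z))"
    by (rule sum.mono_neutral_left) (use assms in \<open>auto simp: supp_def ev_zero_right\<close>)
  finally show ?thesis .
qed

lemma sections_closed:
  shows "(\<lambda>z\<in>\<Omega>. \<zero>) \<in> carrier sections"
    and "u \<in> carrier sections \<Longrightarrow> v \<in> carrier sections \<Longrightarrow> (\<lambda>z\<in>\<Omega>. u z \<oplus> v z) \<in> carrier sections"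
    and "u \<in> carrier sections \<Longrightarrow> (\<lambda>z\<in>\<Omega>. c \<odot> u z) \<in> carrier sections"
    and "\<eta> \<in> carrier H \<Longrightarrow> delta z \<eta> \<in> carrier sections"
proof -
  show "(\<lambda>z\<in>\<Omega>. \<zero>) \<in> carrier sections"
    by (auto simp: sections_carrier supp_def)
  show "(\<lambda>z\<in>\<Omega>. u z \<oplus> v z) \<in> carrier sections" if "u \<in> carrier sections" "v \<in> carrier sections"
  proof -
    have "supp (\<lambda>z\<in>\<Omega>. u z \<oplus> v z) \<subseteq> supp u \<union> supp v"
      by (auto simp: supp_def)
    with that show ?thesis
      by (auto simp: sections_carrier PiE_mem intro: finite_subset)
  qed
  show "(\<lambda>z\<in>\<Omega>. c \<odot> u z) \<in> carrier sections" if "u \<in> carrier sections"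
  proof -
    have "supp (\<lambda>z\<in>\<Omega>. c \<odot> u z) \<subseteq> supp u"
      by (auto simp: supp_def)
    with that show ?thesis
      by (auto simp: sections_carrier PiE_mem intro: finite_subset)
  qed
  show "delta z \<eta> \<in> carrier sections" if "\<eta> \<in> carrier H"
  proof -
    have "supp (delta z \<eta>) \<subseteq> {z}"
      by (auto simp: supp_def delta_def)
    with that show ?thesis
      by (auto simp: sections_carrier delta_def intro: finite_subset)
  qed
qed

lemma ev_add_left:
  assumes "u \<in> carrier sections" "v \<in> carrier sections" "z \<in> \<Omega>" "\<eta> \<in> carrier H"
  shows "ev (u \<oplus>\<^bsub>sections\<^esub> v) z \<eta> = ev u z \<eta> + ev v z \<eta>"
proof -
  define A where "A = supp u \<union> supp v"
  have A: "finite A" "A \<subseteq> \<Omega>" "supp u \<subseteq> A" "supp v \<subseteq> A" "supp (u \<oplus>\<^bsub>sections\<^esub> v) \<subseteq> A"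
    using assms supp_subset by (auto simp: A_def sections_carrier) (auto simp: supp_def)
  have "ev (u \<oplus>\<^bsub>sections\<^esub> v) z \<eta> = (\<Sum>w\<in>A. cinner H (L z w ((u \<oplus>\<^bsub>sections\<^esub> v) w)) \<eta>)"
    by (rule ev_eq) (use A assms in auto)
  also have "\<dots> = (\<Sum>w\<in>A. cinner H (L z w (u w)) \<eta> + cinner H (L z w (v w)) \<eta>)"
  proof (rule sum.cong)
    fix w assume "w \<in> A"
    then have "w \<in> \<Omega>" using A by blast
    then show "cinner H (L z w ((u \<oplus>\<^bsub>sections\<^esub> v) w)) \<eta> = cinner H (L z w (u w)) \<eta> + cinner H (L z w (v w)) \<eta>"
      using assms by (simp add: L_add cinner_add_left)
  qed simp
  also have "\<dots> = ev u z \<eta> + ev v z \<eta>"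
    using A assms by (simp add: sum.distrib ev_eq[where A = A])
  finally show ?thesis .
qed

lemma ev_smult_left:
  assumes "v \<in> carrier sections" "z \<in> \<Omega>" "\<eta> \<in> carrier H"
  shows "ev (c \<odot>\<^bsub>sections\<^esub> v) z \<eta> = c * ev v z \<eta>"
proof -
  have "ev (c \<odot>\<^bsub>sections\<^esub> v) z \<eta> = (\<Sum>w\<in>supp v. cinner H (L z w ((c \<odot>\<^bsub>sections\<^esub> v) w)) \<eta>)"
    by (rule ev_eq) (use assms in \<open>auto simp: supp_def sections_carrier\<close>)
  also have "\<dots> = (\<Sum>w\<in>supp v. c * cinner H (L z w (v w)) \<eta>)"
  proof (rule sum.cong)
    fix w assume "w \<in> supp v"
    then have "w \<in> \<Omega>" using supp_subset by blast
    then show "cinner H (L z w ((c \<odot>\<^bsub>sections\<^esub> v) w)) \<eta> = c * cinner H (L z w (v w)) \<eta>"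
      using assms by (simp add: L_smult cinner_smult_left)
  qed simp
  finally show ?thesis
    by (simp add: ev_def sum_distrib_left)
qed

lemma cinner_sections_add_left:
  assumes "u \<in> carrier sections" "v \<in> carrier sections" "w \<in> carrier sections"
  shows "cinner sections (u \<oplus>\<^bsub>sections\<^esub> v) w = cinner sections u w + cinner sections v w"
proof -
  have A: "finite (supp w)" "\<And>z. z \<in> supp w \<Longrightarrow> z \<in> \<Omega>"
    using assms supp_subset by (auto simp: sections_carrier)
  have "u \<oplus>\<^bsub>sections\<^esub> v \<in> carrier sections"
    using assms by (simp add: sections_closed)
  then have "cinner sections (u \<oplus>\<^bsub>sections\<^esub> v) w = (\<Sum>z\<in>supp w. ev (u \<oplus>\<^bsub>sections\<^esub> v) z (w z))"
    using A by (intro cinner_sections_eq) auto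
  also have "\<dots> = (\<Sum>z\<in>supp w. ev u z (w z) + ev v z (w z))"
    by (rule sum.cong) (use A assms in \<open>simp_all add: ev_add_left del: sections_simps\<close>)
  also have "\<dots> = cinner sections u w + cinner sections v w"
    using A assms by (simp add: sum.distrib cinner_sections_eq[where A = "supp w"] subset_iff)
  finally show ?thesis .
qed

lemma cinner_sections_smult_left:
  assumes "v \<in> carrier sections" "w \<in> carrier sections"
  shows "cinner sections (c \<odot>\<^bsub>sections\<^esub> v) w = c * cinner sections v w"
proof -
  have A: "finite (supp w)" "\<And>z. z \<in> supp w \<Longrightarrow> z \<in> \<Omega>"
    using assms supp_subset by (auto simp: sections_carrier)
  have "c \<odot>\<^bsub>sections\<^esub> v \<in> carrier sections"
    using assms by (simp add: sections_closed)
  then have "cinner sections (c \<odot>\<^bsub>sections\<^esub> v) w = (\<Sum>z\<in>supp w. ev (c \<odot>\<^bsub>sections\<^esub> v) z (w z))"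
    using A by (intro cinner_sections_eq) auto
  also have "\<dots> = (\<Sum>z\<in>supp w. c * ev v z (w z))"
    by (rule sum.cong) (use A assms in \<open>simp_all add: ev_smult_left del: sections_simps\<close>)
  also have "\<dots> = c * cinner sections v w"
    using A assms by (simp add: sum_distrib_left cinner_sections_eq[where A = "supp w"] subset_iff)
  finally show ?thesis .
qed

lemma cinner_sections_add_right:
  assumes "u \<in> carrier sections" "v \<in> carrier sections" "w \<in> carrier sections"
  shows "cinner sections w (u \<oplus>\<^bsub>sections\<^esub> v) = cinner sections w u + cinner sections w v"
proof -
  define A where "A = supp u \<union> supp v"
  have A: "finite A" "A \<subseteq> \<Omega>" "supp u \<subseteq> A" "supp v \<subseteq> A" "supp (u \<oplus>\<^bsub>sections\<^esub> v) \<subseteq> A"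
    using assms supp_subset by (auto simp: A_def sections_carrier) (auto simp: supp_def)
  have "cinner sections w (u \<oplus>\<^bsub>sections\<^esub> v) = (\<Sum>z\<in>A. ev w z ((u \<oplus>\<^bsub>sections\<^esub> v) z))"
    using A assms by (intro cinner_sections_eq) auto
  also have "\<dots> = (\<Sum>z\<in>A. ev w z (u z) + ev w z (v z))"
    by (rule sum.cong) (use A assms in \<open>auto simp: ev_add_right subset_iff\<close>)
  also have "\<dots> = cinner sections w u + cinner sections w v"
    using A assms by (simp add: sum.distrib cinner_sections_eq[where A = A])
  finally show ?thesis .
qed

lemma cinner_sections_smult_right:
  assumes "v \<in> carrier sections" "w \<in> carrier sections"
  shows "cinner sections w (c \<odot>\<^bsub>sections\<^esub> v) = cnj c * cinner sections w v"
proof -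
  have A: "finite (supp v)" "supp v \<subseteq> \<Omega>" "supp (c \<odot>\<^bsub>sections\<^esub> v) \<subseteq> supp v"
    using assms supp_subset by (auto simp: sections_carrier) (auto simp: supp_def)
  have "cinner sections w (c \<odot>\<^bsub>sections\<^esub> v) = (\<Sum>z\<in>supp v. ev w z ((c \<odot>\<^bsub>sections\<^esub> v) z))"
    using A assms by (intro cinner_sections_eq) auto
  also have "\<dots> = (\<Sum>z\<in>supp v. cnj c * ev w z (v z))"
    by (rule sum.cong) (use A assms in \<open>auto simp: ev_smult_right subset_iff\<close>)
  also have "\<dots> = cnj c * cinner sections w v"
    using A assms by (simp add: sum_distrib_left cinner_sections_eq[where A = "supp v"])
  finally show ?thesis .
qed

text \<open>Enumerating the support turns the form into the double sum of \<open>is_kernel\<close>.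
  Since that definition speaks of at least one point, the empty support is a separate case.\<close>

lemma cinner_sections_nonneg:
  assumes v: "v \<in> carrier sections"
  shows "cinner sections v v \<in> \<real>\<^sub>\<ge>\<^sub>0"
proof (cases "supp v = {}")
  case True
  then show ?thesis by (simp add: sections_def)
next
  case False
  define m where "m = card (supp v)"
  have fin: "finite (supp v)"
    using v by (simp add: sections_carrier)
  then obtain h where h: "bij_betw h {..<m} (supp v)"
    using ex_bij_betw_nat_finite[of "supp v"] by (auto simp: m_def atLeast0LessThan)
  then have hv: "h i \<in> \<Omega>" if "i < m" for i
    using that supp_subset by (auto simp: bij_betw_def)
  have "cinner sections v v = (\<Sum>z\<in>supp v. \<Sum>w\<in>supp v. cinner H (L z w (v w)) (v z))"
    by (simp add: sections_def ev_def)
  also have "\<dots> = (\<Sum>i<m. \<Sum>w\<in>supp v. cinner H (L (h i) w (v w)) (v (h i)))"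
    by (rule sum.reindex_bij_betw[OF h, symmetric])
  also have "\<dots> = (\<Sum>i<m. \<Sum>j<m. cinner H (L (h i) (h j) (v (h j))) (v (h i)))"
    by (intro sum.cong refl sum.reindex_bij_betw[OF h, symmetric])
  also have "\<dots> \<in> \<real>\<^sub>\<ge>\<^sub>0"
  proof -
    have "m \<ge> 1"
      using False fin by (simp add: m_def Suc_le_eq card_gt_0_iff)
    moreover have "\<forall>i<m. h i \<in> \<Omega> \<and> v (h i) \<in> carrier H"
      using hv v by simp
    ultimately show ?thesis
      using kernel[unfolded is_kernel_def, THEN conjunct2, rule_format, of m h "\<lambda>i. v (h i)"] by simp
  qed
  finally show ?thesis .
qed

text \<open>Symmetry of the kernel is derived by polarisation: over the complex numbers a form with
  nonnegative diagonal is Hermitian. Reality of the form at \<open>u + v\<close> gives opposite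
  imaginary parts of \<open>a\<close> and \<open>b\<close>, and reality at \<open>u + \<i> v\<close>
  gives equal real parts.\<close>

lemma cinner_sections_commute:
  assumes u: "u \<in> carrier sections" and v: "v \<in> carrier sections"
  shows "cinner sections u v = cnj (cinner sections v u)"
proof -
  define a b where "a = cinner sections u v" and "b = cinner sections v u"
  have closed: "u \<oplus>\<^bsub>sections\<^esub> w \<in> carrier sections" "c \<odot>\<^bsub>sections\<^esub> v \<in> carrier sections"
    if "w \<in> carrier sections" for w c
    using u v that by (simp_all add: sections_closed)
  have real: "Im (cinner sections w w) = 0" if "w \<in> carrier sections" for w
    using cinner_sections_nonneg[OF that] by (simp add: complex_nonneg_Reals_iff)
  have expand: "cinner sections (u \<oplus>\<^bsub>sections\<^esub> w) (u \<oplus>\<^bsub>sections\<^esub> w) =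
      cinner sections u u + cinner sections u w + (cinner sections w u + cinner sections w w)"
    if w: "w \<in> carrier sections" for w
    using closed(1)[OF w] w u
    by (simp add: cinner_sections_add_left cinner_sections_add_right del: sections_simps)
  have "Im (a + b) = 0"
    using real[OF closed(1)[OF v]] real[OF u] real[OF v] unfolding expand[OF v] a_def b_def by simp
  moreover have "Im (cnj \<i> * a + \<i> * b) = 0"
    using real[OF closed(1)[OF closed(2)[OF v, of \<i>]]] real[OF u] real[OF closed(2)[OF v, of \<i>]] u v
    unfolding expand[OF closed(2)[OF v]] a_def b_def
    by (simp add: cinner_sections_smult_left cinner_sections_smult_right del: sections_simps)
  ultimately show ?thesis
    by (simp add: complex_eq_iff flip: a_def b_def)
qed

end

sublocale operator_kernel \<subseteq> S: semi_inner_space sections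
proof (rule semi_inner_space.intro)
  show "Module.module complex_ring sections"
    by (rule function_space_module[of _ \<Omega>]) (simp_all add: sections_closed subset_iff sections_carrier[THEN iffD1])
qed (fact cinner_sections_commute cinner_sections_add_left cinner_sections_smult_left cinner_sections_nonneg)+

section \<open>Completion of the sections by functions on \<open>\<Omega>\<close>\<close>

context operator_kernel
begin

lemma cinner_delta:
  assumes "v \<in> carrier sections" "z \<in> \<Omega>" "\<eta> \<in> carrier H"
  shows "cinner sections v (delta z \<eta>) = ev v z \<eta>"
proof -
  have "cinner sections v (delta z \<eta>) = (\<Sum>w\<in>{z}. ev v w (delta z \<eta> w))"
    by (rule cinner_sections_eq) (use assms in \<open>auto simp: supp_def delta_def\<close>)
  then show ?thesis
    using assms by (simp add: delta_def)
qed

lemma ev_delta: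
  assumes "w \<in> \<Omega>" "z \<in> \<Omega>" "\<eta> \<in> carrier H" "\<zeta> \<in> carrier H"
  shows "ev (delta w \<eta>) z \<zeta> = cinner H (L z w \<eta>) \<zeta>"
proof -
  have "ev (delta w \<eta>) z \<zeta> = (\<Sum>w'\<in>{w}. cinner H (L z w' (delta w \<eta> w')) \<zeta>)"
    by (rule ev_eq) (use assms in \<open>auto simp: supp_def delta_def\<close>)
  then show ?thesis
    using assms by (simp add: delta_def)
qed

lemma ev_minus_left:
  assumes "u \<in> carrier sections" "v \<in> carrier sections" "z \<in> \<Omega>" "\<eta> \<in> carrier H"
  shows "ev (u \<ominus>\<^bsub>sections\<^esub> v) z \<eta> = ev u z \<eta> - ev v z \<eta>"
  using assms S.cinner_minus_left[of u v "delta z \<eta>"] by (simp add: cinner_delta sections_closed)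

text \<open>At every point, \<open>g\<close> is the weak limit of the functions that the sections
  \<open>v n\<close> stand for; by definiteness of \<open>H\<close>, this determines
  \<open>g\<close> from \<open>v\<close>. The converse dependence, up to null sequences, is
  \<open>rep_unique\<close>.\<close>

definition rep :: "('s \<Rightarrow> 'b) \<Rightarrow> (nat \<Rightarrow> 's \<Rightarrow> 'b) \<Rightarrow> bool" where
  "rep g v \<longleftrightarrow> g \<in> \<Omega> \<rightarrow>\<^sub>E carrier H \<and> S.Cauchy_seq v \<and>
     (\<forall>z\<in>\<Omega>. \<forall>\<eta>\<in>carrier H. (\<lambda>n. ev (v n) z \<eta>) \<longlonglongrightarrow> cinner H (g z) \<eta>)"

text \<open>The inner product uses arbitrarily chosen representing sequences; by
  \<open>rep_cinner\<close> all others lead to the same limit.\<close>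

definition rkhs :: "('s \<Rightarrow> 'b) hilbert" where
  "rkhs = \<lparr>carrier = {g. \<exists>v. rep g v}, mult = undefined, one = undefined,
     zero = (\<lambda>z\<in>\<Omega>. \<zero>), add = (\<lambda>f g. \<lambda>z\<in>\<Omega>. f z \<oplus> g z), smult = (\<lambda>c f. \<lambda>z\<in>\<Omega>. c \<odot> f z),
     cinner = (\<lambda>f g. lim (\<lambda>n. cinner sections ((SOME v. rep f v) n) ((SOME v. rep g v) n)))\<rparr>"

lemma rkhs_simps:
  "\<zero>\<^bsub>rkhs\<^esub> = (\<lambda>z\<in>\<Omega>. \<zero>)" "f \<oplus>\<^bsub>rkhs\<^esub> g = (\<lambda>z\<in>\<Omega>. f z \<oplus> g z)" "c \<odot>\<^bsub>rkhs\<^esub> f = (\<lambda>z\<in>\<Omega>. c \<odot> f z)"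
  by (simp_all add: rkhs_def)

lemma rkhs_carrier: "g \<in> carrier rkhs \<longleftrightarrow> (\<exists>v. rep g v)"
  by (simp add: rkhs_def)

lemma rkhs_val [simp]: "g \<in> carrier rkhs \<Longrightarrow> z \<in> \<Omega> \<Longrightarrow> g z \<in> carrier H"
  by (auto simp: rkhs_carrier rep_def)

lemma rep_val: "rep g v \<Longrightarrow> z \<in> \<Omega> \<Longrightarrow> g z \<in> carrier H"
  by (auto simp: rep_def)

lemma rep_section: "rep g v \<Longrightarrow> v n \<in> carrier sections"
  by (auto simp: rep_def S.Cauchy_seq_carrier)

text \<open>Pairing with a section involves only finitely many evaluations, and at each of them both
  sequences have the same limit. So the difference is a weakly null Cauchy sequence.\<close>

lemma rep_unique:
  assumes v: "rep g v" and u: "rep g u"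
  shows "(\<lambda>n. cnorm sections (v n \<ominus>\<^bsub>sections\<^esub> u n)) \<longlonglongrightarrow> 0"
proof (rule S.weakly_null_Cauchy_seq)
  show "S.Cauchy_seq (\<lambda>n. v n \<ominus>\<^bsub>sections\<^esub> u n)"
    using assms by (intro S.Cauchy_seq_minus) (auto simp: rep_def)
  fix w assume w: "w \<in> carrier sections"
  have eq: "cinner sections (v n \<ominus>\<^bsub>sections\<^esub> u n) w = (\<Sum>z\<in>supp w. ev (v n) z (w z) - ev (u n) z (w z))" for n
  proof -
    have "cinner sections (v n \<ominus>\<^bsub>sections\<^esub> u n) w = (\<Sum>z\<in>supp w. ev (v n \<ominus>\<^bsub>sections\<^esub> u n) z (w z))"
      by (simp add: sections_def)
    also have "\<dots> = (\<Sum>z\<in>supp w. ev (v n) z (w z) - ev (u n) z (w z))"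
      by (rule sum.cong) (use w supp_subset[of w] rep_section v u in \<open>auto intro!: ev_minus_left\<close>)
    finally show ?thesis .
  qed
  have "(\<lambda>n. \<Sum>z\<in>supp w. ev (v n) z (w z) - ev (u n) z (w z)) \<longlonglongrightarrow>
      (\<Sum>z\<in>supp w. cinner H (g z) (w z) - cinner H (g z) (w z))"
    using w supp_subset[of w] v u
    by (intro tendsto_sum tendsto_diff) (auto simp: rep_def subset_iff)
  then show "(\<lambda>n. cinner sections (v n \<ominus>\<^bsub>sections\<^esub> u n) w) \<longlonglongrightarrow> 0"
    unfolding eq by simp
qed

text \<open>Replacing the chosen representatives by others changes each of them by a null sequence.
  As Cauchy sequences are bounded, the pairings then also change by a null sequence.\<close>

lemma rep_cinner:
  assumes "rep g v" "rep h u"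
  shows "(\<lambda>n. cinner sections (v n) (u n)) \<longlonglongrightarrow> cinner rkhs g h"
proof -
  define v' u' where "v' = (SOME v. rep g v)" and "u' = (SOME u. rep h u)"
  have v': "rep g v'" and u': "rep h u'"
    unfolding v'_def u'_def by (rule someI[of _ v] someI[of _ u], fact)+
  have cau: "S.Cauchy_seq v" "S.Cauchy_seq u" "S.Cauchy_seq v'" "S.Cauchy_seq u'"
    using assms v' u' by (auto simp: rep_def)
  note [simp] = cau[THEN S.Cauchy_seq_carrier]
  have lim: "(\<lambda>n. cinner sections (v' n) (u' n)) \<longlonglongrightarrow> cinner rkhs g h"
    using S.convergent_cinner_Cauchy_seq[OF cau(3,4)]
    by (simp add: convergent_LIMSEQ_iff rkhs_def v'_def u'_def)
  obtain B where B: "\<And>n. cnorm sections (u n) \<le> B"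
    using S.Cauchy_seq_bounded[OF cau(2)] by blast
  obtain C where C: "\<And>n. cnorm sections (v' n) \<le> C"
    using S.Cauchy_seq_bounded[OF cau(3)] by blast
  have "(\<lambda>n. cnorm sections (v n \<ominus>\<^bsub>sections\<^esub> v' n) * B + C * cnorm sections (u n \<ominus>\<^bsub>sections\<^esub> u' n)) \<longlonglongrightarrow> 0 * B + C * 0"
    by (intro tendsto_intros rep_unique[OF assms(1) v'] rep_unique[OF assms(2) u'])
  then have null: "(\<lambda>n. cnorm sections (v n \<ominus>\<^bsub>sections\<^esub> v' n) * B + C * cnorm sections (u n \<ominus>\<^bsub>sections\<^esub> u' n)) \<longlonglongrightarrow> 0"
    by simp
  have "(\<lambda>n. cinner sections (v n) (u n) - cinner sections (v' n) (u' n)) \<longlonglongrightarrow> 0"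
  proof (rule Lim_null_comparison[OF always_eventually null], rule allI)
    fix n
    have "cmod (cinner sections (v n) (u n) - cinner sections (v' n) (u' n)) \<le>
        cnorm sections (v n \<ominus>\<^bsub>sections\<^esub> v' n) * cnorm sections (u n) + cnorm sections (v' n) * cnorm sections (u n \<ominus>\<^bsub>sections\<^esub> u' n)"
      by (intro S.cinner_diff_bound) auto
    also have "\<dots> \<le> cnorm sections (v n \<ominus>\<^bsub>sections\<^esub> v' n) * B + C * cnorm sections (u n \<ominus>\<^bsub>sections\<^esub> u' n)"
      by (intro add_mono mult_left_mono mult_right_mono B C) auto
    finally show "cmod (cinner sections (v n) (u n) - cinner sections (v' n) (u' n)) \<le>
        cnorm sections (v n \<ominus>\<^bsub>sections\<^esub> v' n) * B + C * cnorm sections (u n \<ominus>\<^bsub>sections\<^esub> u' n)" .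
  qed
  from tendsto_add[OF this lim] show ?thesis by simp
qed

lemma rep_add:
  assumes "rep g v" "rep h u"
  shows "rep (g \<oplus>\<^bsub>rkhs\<^esub> h) (\<lambda>n. v n \<oplus>\<^bsub>sections\<^esub> u n)"
  unfolding rep_def
proof (intro conjI ballI)
  show "g \<oplus>\<^bsub>rkhs\<^esub> h \<in> \<Omega> \<rightarrow>\<^sub>E carrier H"
    using assms by (auto simp: rkhs_simps rep_val)
  show "S.Cauchy_seq (\<lambda>n. v n \<oplus>\<^bsub>sections\<^esub> u n)"
    using assms by (intro S.Cauchy_seq_add) (auto simp: rep_def)
  fix z \<eta> assume z: "z \<in> \<Omega>" "\<eta> \<in> carrier H"
  have "(\<lambda>n. ev (v n) z \<eta> + ev (u n) z \<eta>) \<longlonglongrightarrow> cinner H (g z) \<eta> + cinner H (h z) \<eta>"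
    using assms z by (intro tendsto_add) (auto simp: rep_def)
  moreover have "cinner H (g z) \<eta> + cinner H (h z) \<eta> = cinner H ((g \<oplus>\<^bsub>rkhs\<^esub> h) z) \<eta>"
    using assms z by (auto simp: rkhs_simps rep_val cinner_add_left)
  ultimately show "(\<lambda>n. ev (v n \<oplus>\<^bsub>sections\<^esub> u n) z \<eta>) \<longlonglongrightarrow> cinner H ((g \<oplus>\<^bsub>rkhs\<^esub> h) z) \<eta>"
    using assms z by (simp add: ev_add_left rep_section del: sections_simps)
qed

lemma rep_smult:
  assumes "rep g v"
  shows "rep (c \<odot>\<^bsub>rkhs\<^esub> g) (\<lambda>n. c \<odot>\<^bsub>sections\<^esub> v n)"
  unfolding rep_def
proof (intro conjI ballI)
  show "c \<odot>\<^bsub>rkhs\<^esub> g \<in> \<Omega> \<rightarrow>\<^sub>E carrier H"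
    using assms by (auto simp: rkhs_simps rep_val)
  show "S.Cauchy_seq (\<lambda>n. c \<odot>\<^bsub>sections\<^esub> v n)"
    using assms by (intro S.Cauchy_seq_smult) (auto simp: rep_def)
  fix z \<eta> assume z: "z \<in> \<Omega>" "\<eta> \<in> carrier H"
  have "(\<lambda>n. c * ev (v n) z \<eta>) \<longlonglongrightarrow> c * cinner H (g z) \<eta>"
    using assms z by (intro tendsto_mult_left) (auto simp: rep_def)
  moreover have "c * cinner H (g z) \<eta> = cinner H ((c \<odot>\<^bsub>rkhs\<^esub> g) z) \<eta>"
    using assms z by (auto simp: rkhs_simps rep_val cinner_smult_left)
  ultimately show "(\<lambda>n. ev (c \<odot>\<^bsub>sections\<^esub> v n) z \<eta>) \<longlonglongrightarrow> cinner H ((c \<odot>\<^bsub>rkhs\<^esub> g) z) \<eta>"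
    using assms z by (simp add: ev_smult_left rep_section del: sections_simps)
qed

lemma rep_zero: "rep (\<lambda>z\<in>\<Omega>. \<zero>) (\<lambda>_. \<lambda>z\<in>\<Omega>. \<zero>)"
proof -
  have "supp (\<lambda>z\<in>\<Omega>. \<zero>) = {}"
    by (auto simp: supp_def)
  then have "ev (\<lambda>z\<in>\<Omega>. \<zero>) z \<eta> = 0" for z \<eta>
    by (simp add: ev_def)
  then show ?thesis
    by (auto simp: rep_def sections_closed intro: S.Cauchy_seq_const)
qed

end

text \<open>Each axiom of the form passes from \<open>sections\<close> to the limit along
  representing sequences. Definiteness and completeness come later because their proofs use
  Cauchy-Schwarz in \<open>rkhs\<close>, through the bound on evaluations.\<close>

sublocale operator_kernel \<subseteq> R: semi_inner_space rkhs
proof (rule semi_inner_space.intro)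
  show "Module.module complex_ring rkhs"
  proof (rule function_space_module[of _ \<Omega>])
    show "carrier rkhs \<subseteq> \<Omega> \<rightarrow>\<^sub>E carrier H"
      by (auto simp: rkhs_carrier rep_def)
    show "\<zero>\<^bsub>rkhs\<^esub> \<in> carrier rkhs"
      using rep_zero by (auto simp: rkhs_carrier rkhs_simps)
    show "f \<oplus>\<^bsub>rkhs\<^esub> g \<in> carrier rkhs" if "f \<in> carrier rkhs" "g \<in> carrier rkhs" for f g
      using that rep_add unfolding rkhs_carrier by blast
    show "c \<odot>\<^bsub>rkhs\<^esub> f \<in> carrier rkhs" if "f \<in> carrier rkhs" for c f
      using that rep_smult unfolding rkhs_carrier by blast
  qed (simp_all add: rkhs_simps)
  show "cinner rkhs f g = cnj (cinner rkhs g f)" if fg: "f \<in> carrier rkhs" "g \<in> carrier rkhs" for f g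
  proof -
    obtain v u where vu: "rep f v" "rep g u" using fg by (auto simp: rkhs_carrier)
    have "(\<lambda>n. cnj (cinner sections (u n) (v n))) \<longlonglongrightarrow> cnj (cinner rkhs g f)"
      by (intro tendsto_cnj rep_cinner vu)
    moreover have "cnj (cinner sections (u n) (v n)) = cinner sections (v n) (u n)" for n
      by (rule cinner_sections_commute[symmetric]) (use rep_section vu in auto)
    ultimately show ?thesis
      using rep_cinner[OF vu] LIMSEQ_unique by fastforce
  qed
  show "cinner rkhs (f \<oplus>\<^bsub>rkhs\<^esub> g) h = cinner rkhs f h + cinner rkhs g h"
    if fg: "f \<in> carrier rkhs" "g \<in> carrier rkhs" "h \<in> carrier rkhs" for f g h
  proof -
    obtain v u w where vu: "rep f v" "rep g u" "rep h w" using fg by (auto simp: rkhs_carrier)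
    have "(\<lambda>n. cinner sections (v n) (w n) + cinner sections (u n) (w n)) \<longlonglongrightarrow> cinner rkhs f h + cinner rkhs g h"
      by (intro tendsto_add rep_cinner vu)
    moreover have "cinner sections (v n) (w n) + cinner sections (u n) (w n) = cinner sections (v n \<oplus>\<^bsub>sections\<^esub> u n) (w n)" for n
      by (rule cinner_sections_add_left[symmetric]) (use rep_section vu in auto)
    ultimately show ?thesis
      using rep_cinner[OF rep_add[OF vu(1,2)] vu(3)] LIMSEQ_unique by (simp only:) blast
  qed
  show "cinner rkhs (c \<odot>\<^bsub>rkhs\<^esub> f) g = c * cinner rkhs f g"
    if fg: "f \<in> carrier rkhs" "g \<in> carrier rkhs" for f g c
  proof -
    obtain v u where vu: "rep f v" "rep g u" using fg by (auto simp: rkhs_carrier)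
    have "(\<lambda>n. c * cinner sections (v n) (u n)) \<longlonglongrightarrow> c * cinner rkhs f g"
      by (intro tendsto_mult_left rep_cinner vu)
    moreover have "c * cinner sections (v n) (u n) = cinner sections (c \<odot>\<^bsub>sections\<^esub> v n) (u n)" for n
      by (rule cinner_sections_smult_left[symmetric]) (use rep_section vu in auto)
    ultimately show ?thesis
      using rep_cinner[OF rep_smult[OF vu(1)] vu(2)] LIMSEQ_unique by (simp only:) blast
  qed
  show "cinner rkhs f f \<in> \<real>\<^sub>\<ge>\<^sub>0" if f: "f \<in> carrier rkhs" for f
  proof -
    obtain v where v: "rep f v" using f by (auto simp: rkhs_carrier)
    show ?thesis
      by (rule Lim_in_closed_set[OF closed_nonneg_Reals_complex _ _ rep_cinner[OF v v]])
        (use rep_section v cinner_sections_nonneg in auto)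
  qed
qed

context operator_kernel
begin

lemma rep_delta:
  assumes "w \<in> \<Omega>" "\<eta> \<in> carrier H"
  shows "rep (\<lambda>z\<in>\<Omega>. L z w \<eta>) (\<lambda>_. delta w \<eta>)"
  using assms by (auto simp: rep_def ev_delta sections_closed S.Cauchy_seq_const)

lemma kernel_in_rkhs: "w \<in> \<Omega> \<Longrightarrow> \<eta> \<in> carrier H \<Longrightarrow> (\<lambda>z\<in>\<Omega>. L z w \<eta>) \<in> carrier rkhs"
  using rep_delta rkhs_carrier by blast

text \<open>The kernel function is represented by the constant sequence
  \<open>delta w \<eta>\<close>, so the pairings along representatives are evaluations
  \<open>ev (v n) w \<eta>\<close>. Their limit is known both from \<open>rep_cinner\<close> and
  from the definition of \<open>rep\<close>.\<close>

lemma rkhs_reproducing: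
  assumes "w \<in> \<Omega>" "\<eta> \<in> carrier H" "f \<in> carrier rkhs"
  shows "cinner rkhs f (\<lambda>z\<in>\<Omega>. L z w \<eta>) = cinner H (f w) \<eta>"
proof -
  obtain v where v: "rep f v" using assms by (auto simp: rkhs_carrier)
  have "(\<lambda>n. ev (v n) w \<eta>) \<longlonglongrightarrow> cinner rkhs f (\<lambda>z\<in>\<Omega>. L z w \<eta>)"
    using rep_cinner[OF v rep_delta[OF assms(1,2)]] assms rep_section[OF v] by (simp add: cinner_delta)
  moreover have "(\<lambda>n. ev (v n) w \<eta>) \<longlonglongrightarrow> cinner H (f w) \<eta>"
    using v assms by (simp add: rep_def)
  ultimately show ?thesis
    by (rule LIMSEQ_unique)
qed

text \<open>For \<open>\<eta> = f z\<close> the reproducing property gives the squared norm of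
  \<open>\<eta>\<close> as the pairing of \<open>f\<close> with the kernel function
  \<open>k\<close>, while the squared norm of \<open>k\<close> is the pairing of
  \<open>L z z \<eta>\<close> with \<open>\<eta>\<close>. Cauchy-Schwarz and division by the norm of
  \<open>\<eta>\<close> give the constant \<open>sqrt \<bar>B\<bar>\<close>; the modulus is there
  because \<open>B\<close> is not known to be nonnegative.\<close>

lemma rkhs_evaluation_bound:
  assumes z: "z \<in> \<Omega>"
  shows "\<exists>B. \<forall>f\<in>carrier rkhs. cnorm H (f z) \<le> B * cnorm rkhs f"
proof -
  obtain B where B: "\<And>x. x \<in> carrier H \<Longrightarrow> cnorm H (L z z x) \<le> B * cnorm H x"
    using L_bounded[OF z z] unfolding bounded_operators_def by blast
  have "cnorm H (f z) \<le> sqrt \<bar>B\<bar> * cnorm rkhs f" if f: "f \<in> carrier rkhs" for f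
  proof (cases "cnorm H (f z) = 0")
    case False
    define \<eta> k where "\<eta> = f z" and "k = (\<lambda>z'\<in>\<Omega>. L z' z \<eta>)"
    have \<eta>: "\<eta> \<in> carrier H" and k: "k \<in> carrier rkhs"
      using f z by (simp_all add: \<eta>_def k_def kernel_in_rkhs)
    have "(cnorm rkhs k)\<^sup>2 = Re (cinner H (L z z \<eta>) \<eta>)"
      using rkhs_reproducing[OF z \<eta> k] z by (simp add: R.cnorm_sq[OF k]) (simp add: k_def)
    also have "\<dots> \<le> cnorm H (L z z \<eta>) * cnorm H \<eta>"
      using cauchy_schwarz[of "L z z \<eta>" \<eta>] complex_Re_le_cmod \<eta> z order_trans by (meson L_closed)
    also have "\<dots> \<le> (\<bar>B\<bar> * cnorm H \<eta>) * cnorm H \<eta>"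
    proof (intro mult_right_mono)
      have "B * cnorm H \<eta> \<le> \<bar>B\<bar> * cnorm H \<eta>"
        by (intro mult_right_mono) (use \<eta> in auto)
      then show "cnorm H (L z z \<eta>) \<le> \<bar>B\<bar> * cnorm H \<eta>"
        using B[OF \<eta>] by linarith
    qed (use \<eta> in simp)
    also have "\<dots> = (sqrt \<bar>B\<bar> * cnorm H \<eta>)\<^sup>2"
      by (simp add: power_mult_distrib power2_eq_square)
    finally have norm_k: "cnorm rkhs k \<le> sqrt \<bar>B\<bar> * cnorm H \<eta>"
      using \<eta> by (auto intro: power2_le_imp_le)
    have "(cnorm H \<eta>)\<^sup>2 = Re (cinner rkhs f k)"
      using rkhs_reproducing[OF z \<eta> f] \<eta> by (simp add: cnorm_sq k_def) (simp add: \<eta>_def)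
    also have "\<dots> \<le> cnorm rkhs f * cnorm rkhs k"
      using R.cauchy_schwarz[OF f k] complex_Re_le_cmod order_trans by blast
    also have "\<dots> \<le> cnorm rkhs f * (sqrt \<bar>B\<bar> * cnorm H \<eta>)"
      using f by (intro mult_left_mono norm_k) auto
    finally have "cnorm H \<eta> * cnorm H \<eta> \<le> (sqrt \<bar>B\<bar> * cnorm rkhs f) * cnorm H \<eta>"
      by (simp add: power2_eq_square mult_ac)
    moreover have "cnorm H \<eta> > 0"
      using False cnorm_nonneg[OF \<eta>] unfolding \<eta>_def by linarith
    ultimately show ?thesis
      by (simp add: \<eta>_def)
  qed (use f in simp)
  then show ?thesis by blast
qed

lemma rkhs_minus_val:
  "f \<in> carrier rkhs \<Longrightarrow> g \<in> carrier rkhs \<Longrightarrow> z \<in> \<Omega> \<Longrightarrow> (f \<ominus>\<^bsub>rkhs\<^esub> g) z = f z \<ominus> g z"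
  using R.smult_in_carrier[of g "- 1"] by (simp add: R.minus_eq_add_smult minus_eq_add_smult rkhs_simps)

lemma rep_minus: "rep f v \<Longrightarrow> rep g u \<Longrightarrow> rep (f \<ominus>\<^bsub>rkhs\<^esub> g) (\<lambda>n. v n \<ominus>\<^bsub>sections\<^esub> u n)"
  using rep_add[OF _ rep_smult[of g u "- 1"], of f v] rkhs_carrier rep_section
  by (subst R.minus_eq_add_smult, blast, blast, subst S.minus_eq_add_smult) auto

lemma rep_cnorm:
  assumes "rep f v"
  shows "(\<lambda>n. cnorm sections (v n)) \<longlonglongrightarrow> cnorm rkhs f"
  unfolding cnorm_def by (intro tendsto_intros rep_cinner assms)

text \<open>Evaluations are bounded, so a function of norm zero has only zero values. Null vectors
  have thus disappeared in passing from sections to functions, and no quotient is formed.\<close>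

lemma rkhs_definite:
  assumes f: "f \<in> carrier rkhs" and "cinner rkhs f f = 0"
  shows "f = \<zero>\<^bsub>rkhs\<^esub>"
proof -
  have "cnorm rkhs f = 0"
    using assms by (simp add: cnorm_def)
  have "cnorm H (f z) = 0" if z: "z \<in> \<Omega>" for z
  proof -
    obtain B where "cnorm H (f z) \<le> B * cnorm rkhs f"
      using rkhs_evaluation_bound[OF z] f by blast
    with \<open>cnorm rkhs f = 0\<close> show ?thesis
      using cnorm_nonneg[OF rkhs_val[OF f z]] by simp
  qed
  then have "f z = \<zero>" if "z \<in> \<Omega>" for z
    using f that cinner_definite[of "f z"] by (simp add: cinner_self)
  moreover have "f \<in> \<Omega> \<rightarrow>\<^sub>E carrier H"
    using f by (auto simp: rkhs_carrier rep_def)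
  ultimately show ?thesis
    unfolding rkhs_simps by (intro PiE_ext[of f \<Omega> "\<lambda>_. carrier H"]) auto
qed

text \<open>A diagonal argument. From a sequence \<open>v i\<close> representing \<open>X i\<close>,
  take a term \<open>u i\<close> that lies within \<open>\<epsilon> i\<close> of all later ones;
  then \<open>u\<close> inherits the Cauchy property from \<open>X\<close>. The values of
  \<open>X\<close> converge by bounded evaluation and completeness of \<open>H\<close>, and the
  function they converge to is represented by \<open>u\<close>.\<close>

lemma rkhs_complete:
  assumes X: "R.Cauchy_seq X"
  shows "\<exists>f\<in>carrier rkhs. (\<lambda>i. cnorm rkhs (X i \<ominus>\<^bsub>rkhs\<^esub> f)) \<longlonglongrightarrow> 0"
proof -
  note [simp] = R.Cauchy_seq_carrier[OF X]
  define \<epsilon> where "\<epsilon> = (\<lambda>i. 1 / real (Suc i))"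
  have \<epsilon>: "\<epsilon> i > 0" for i by (simp add: \<epsilon>_def)
  have \<epsilon>0: "\<epsilon> \<longlonglongrightarrow> 0"
    unfolding \<epsilon>_def by (rule LIMSEQ_Suc[OF lim_1_over_n])
  have "\<forall>i. \<exists>v. rep (X i) v"
    using R.Cauchy_seq_carrier[OF X] by (simp add: rkhs_carrier)
  then obtain v where v: "\<And>i. rep (X i) (v i)" by metis
  have vc: "S.Cauchy_seq (v i)" for i using v by (simp add: rep_def)
  note [simp] = vc[THEN S.Cauchy_seq_carrier]
  have "\<forall>i. \<exists>N. \<forall>n\<ge>N. cnorm sections (v i n \<ominus>\<^bsub>sections\<^esub> v i N) < \<epsilon> i"
    using vc \<epsilon> unfolding S.Cauchy_seq_def by (meson le_refl)
  then obtain N where N: "\<And>i n. n \<ge> N i \<Longrightarrow> cnorm sections (v i n \<ominus>\<^bsub>sections\<^esub> v i (N i)) < \<epsilon> i"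
    by metis
  define u where "u = (\<lambda>i. v i (N i))"
  have [simp]: "u i \<in> carrier sections" for i by (simp add: u_def)
  \<comment> \<open>For large \<open>n\<close> the path from \<open>u i\<close> to
    \<open>u j\<close> goes through \<open>v i n\<close> and \<open>v j n\<close>. The left side is
    free of \<open>n\<close>, so the limit may be taken on the right, where it produces the norm in
    \<open>rkhs\<close>.\<close>
  have "cnorm sections (u i \<ominus>\<^bsub>sections\<^esub> u j) \<le> \<epsilon> i + cnorm rkhs (X i \<ominus>\<^bsub>rkhs\<^esub> X j) + \<epsilon> j" for i j
  proof (rule tendsto_lowerbound)
    show "(\<lambda>n. \<epsilon> i + cnorm sections (v i n \<ominus>\<^bsub>sections\<^esub> v j n) + \<epsilon> j) \<longlonglongrightarrow> \<epsilon> i + cnorm rkhs (X i \<ominus>\<^bsub>rkhs\<^esub> X j) + \<epsilon> j"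
      by (intro tendsto_intros rep_cnorm rep_minus v)
    show "\<forall>\<^sub>F n in sequentially. cnorm sections (u i \<ominus>\<^bsub>sections\<^esub> u j) \<le> \<epsilon> i + cnorm sections (v i n \<ominus>\<^bsub>sections\<^esub> v j n) + \<epsilon> j"
      using eventually_ge_at_top[of "max (N i) (N j)"]
    proof eventually_elim
      case (elim n)
      have "cnorm sections (u i \<ominus>\<^bsub>sections\<^esub> u j) \<le> cnorm sections (u i \<ominus>\<^bsub>sections\<^esub> v i n) + cnorm sections (v i n \<ominus>\<^bsub>sections\<^esub> u j)"
        by (rule S.cnorm_triangle_minus) auto
      also have "cnorm sections (v i n \<ominus>\<^bsub>sections\<^esub> u j) \<le> cnorm sections (v i n \<ominus>\<^bsub>sections\<^esub> v j n) + cnorm sections (v j n \<ominus>\<^bsub>sections\<^esub> u j)"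
        by (rule S.cnorm_triangle_minus) auto
      also have "cnorm sections (u i \<ominus>\<^bsub>sections\<^esub> v i n) = cnorm sections (v i n \<ominus>\<^bsub>sections\<^esub> u i)"
        by (rule S.cnorm_minus_commute) auto
      finally show ?case
        using N[of i n] N[of j n] elim by (simp add: u_def)
    qed
  qed simp
  note u_dist = this
  have uc: "S.Cauchy_seq u"
    unfolding S.Cauchy_seq_def
  proof safe
    fix e :: real assume e: "e > 0"
    then have e3: "e / 3 > 0" by simp
    obtain N1 where N1: "\<And>i j. i \<ge> N1 \<Longrightarrow> j \<ge> N1 \<Longrightarrow> cnorm rkhs (X i \<ominus>\<^bsub>rkhs\<^esub> X j) < e / 3"
      using X e3 unfolding R.Cauchy_seq_def by blast
    obtain N2 where N2: "\<And>i. i \<ge> N2 \<Longrightarrow> \<epsilon> i < e / 3"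
      using order_tendstoD(2)[OF \<epsilon>0 e3] by (auto simp: eventually_sequentially)
    have "cnorm sections (u i \<ominus>\<^bsub>sections\<^esub> u j) < e" if "i \<ge> max N1 N2" "j \<ge> max N1 N2" for i j
      using u_dist[of i j] N1[of i j] N2[of i] N2[of j] that by simp
    then show "\<exists>N. \<forall>i\<ge>N. \<forall>j\<ge>N. cnorm sections (u i \<ominus>\<^bsub>sections\<^esub> u j) < e" by blast
  qed simp
  have "\<exists>x\<in>carrier H. (\<lambda>i. cnorm H (X i z \<ominus> x)) \<longlonglongrightarrow> 0" if z: "z \<in> \<Omega>" for z
  proof (rule Cauchy_seq_converges)
    obtain B where B: "\<And>f. f \<in> carrier rkhs \<Longrightarrow> cnorm H (f z) \<le> B * cnorm rkhs f"
      using rkhs_evaluation_bound[OF z] by blast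
    show "Cauchy_seq (\<lambda>i. X i z)"
      unfolding Cauchy_seq_def
    proof safe
      fix e :: real assume e: "e > 0"
      have "e / (\<bar>B\<bar> + 1) > 0" using e by (simp add: add_nonneg_pos)
      then obtain N where N: "\<And>i j. i \<ge> N \<Longrightarrow> j \<ge> N \<Longrightarrow> cnorm rkhs (X i \<ominus>\<^bsub>rkhs\<^esub> X j) < e / (\<bar>B\<bar> + 1)"
        using X unfolding R.Cauchy_seq_def by blast
      have "cnorm H (X i z \<ominus> X j z) < e" if "i \<ge> N" "j \<ge> N" for i j
      proof -
        have "cnorm H (X i z \<ominus> X j z) \<le> B * cnorm rkhs (X i \<ominus>\<^bsub>rkhs\<^esub> X j)"
          using B[of "X i \<ominus>\<^bsub>rkhs\<^esub> X j"] z by (simp add: rkhs_minus_val)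
        also have "\<dots> \<le> (\<bar>B\<bar> + 1) * cnorm rkhs (X i \<ominus>\<^bsub>rkhs\<^esub> X j)"
          by (intro mult_right_mono) auto
        also have "\<dots> < e"
          using N[OF that] by (simp add: pos_less_divide_eq add_nonneg_pos mult.commute)
        finally show ?thesis .
      qed
      then show "\<exists>N. \<forall>i\<ge>N. \<forall>j\<ge>N. cnorm H (X i z \<ominus> X j z) < e" by blast
    qed (use z in simp)
  qed
  then obtain f where f: "\<And>z. z \<in> \<Omega> \<Longrightarrow> f z \<in> carrier H" "\<And>z. z \<in> \<Omega> \<Longrightarrow> (\<lambda>i. cnorm H (X i z \<ominus> f z)) \<longlonglongrightarrow> 0"
    by metis
  define g where "g = restrict f \<Omega>"
  \<comment> \<open>Along \<open>v i\<close> the evaluations tend to the value of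
    \<open>X i\<close>, and all late terms of \<open>v i\<close> are within
    \<open>\<epsilon> i\<close> of \<open>u i\<close>. Pairing with \<open>delta z \<eta>\<close>
    turns this into a bound that survives the limit.\<close>
  have near: "cmod (ev (u i) z \<eta> - cinner H (X i z) \<eta>) \<le> \<epsilon> i * cnorm sections (delta z \<eta>)"
    if z: "z \<in> \<Omega>" and \<eta>: "\<eta> \<in> carrier H" for i z \<eta>
  proof (rule tendsto_upperbound)
    show "(\<lambda>n. cmod (ev (u i) z \<eta> - ev (v i n) z \<eta>)) \<longlonglongrightarrow> cmod (ev (u i) z \<eta> - cinner H (X i z) \<eta>)"
      using v[of i] z \<eta> by (intro tendsto_intros) (auto simp: rep_def)
    show "\<forall>\<^sub>F n in sequentially. cmod (ev (u i) z \<eta> - ev (v i n) z \<eta>) \<le> \<epsilon> i * cnorm sections (delta z \<eta>)"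
      using eventually_ge_at_top[of "N i"]
    proof eventually_elim
      case (elim n)
      have d: "delta z \<eta> \<in> carrier sections" using \<eta> by (rule sections_closed)
      have "ev (u i) z \<eta> - ev (v i n) z \<eta> = cinner sections (u i \<ominus>\<^bsub>sections\<^esub> v i n) (delta z \<eta>)"
        using z \<eta> by (simp add: cinner_delta ev_minus_left)
      also have "cmod \<dots> \<le> cnorm sections (u i \<ominus>\<^bsub>sections\<^esub> v i n) * cnorm sections (delta z \<eta>)"
        using d by (intro S.cauchy_schwarz) auto
      also have "cnorm sections (u i \<ominus>\<^bsub>sections\<^esub> v i n) = cnorm sections (v i n \<ominus>\<^bsub>sections\<^esub> u i)"
        by (rule S.cnorm_minus_commute) auto
      also have "\<dots> * cnorm sections (delta z \<eta>) \<le> \<epsilon> i * cnorm sections (delta z \<eta>)"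
        using N[OF elim] d by (intro mult_right_mono) (auto simp: u_def)
      finally show ?case .
    qed
  qed simp
  have rep: "rep g u"
    unfolding rep_def
  proof (intro conjI ballI uc)
    show "g \<in> \<Omega> \<rightarrow>\<^sub>E carrier H" using f by (auto simp: g_def)
    fix z \<eta> assume z: "z \<in> \<Omega>" and \<eta>: "\<eta> \<in> carrier H"
    have "(\<lambda>i. cinner H (X i z) \<eta>) \<longlonglongrightarrow> cinner H (f z) \<eta>"
      using z \<eta> f by (intro tendsto_cinner) (auto simp: a_minus_def r_neg)
    moreover have "(\<lambda>i. ev (u i) z \<eta> - cinner H (X i z) \<eta>) \<longlonglongrightarrow> 0"
      by (rule Lim_null_comparison[OF always_eventually tendsto_mult_left_zero[OF \<epsilon>0]])
        (use near z \<eta> in blast)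
    ultimately show "(\<lambda>i. ev (u i) z \<eta>) \<longlonglongrightarrow> cinner H (g z) \<eta>"
      using tendsto_add z unfolding g_def by fastforce
  qed
  have "(\<lambda>i. cnorm rkhs (X i \<ominus>\<^bsub>rkhs\<^esub> g)) \<longlonglongrightarrow> 0"
  proof (rule LIMSEQ_I)
    fix e :: real assume e: "e > 0"
    then have e3: "e / 3 > 0" by simp
    obtain N1 where N1: "\<And>i j. i \<ge> N1 \<Longrightarrow> j \<ge> N1 \<Longrightarrow> cnorm sections (u i \<ominus>\<^bsub>sections\<^esub> u j) < e / 3"
      using uc e3 unfolding S.Cauchy_seq_def by blast
    obtain N2 where N2: "\<And>i. i \<ge> N2 \<Longrightarrow> \<epsilon> i < e / 3"
      using order_tendstoD(2)[OF \<epsilon>0 e3] by (auto simp: eventually_sequentially)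
    have "norm (cnorm rkhs (X i \<ominus>\<^bsub>rkhs\<^esub> g) - 0) < e" if i: "i \<ge> max N1 N2" for i
    proof -
      \<comment> \<open>One third is spent from \<open>v i n\<close> to \<open>u i\<close>, another
        from \<open>u i\<close> to \<open>u n\<close>. The limit loses strictness, and the last
        third restores it.\<close>
      have "cnorm rkhs (X i \<ominus>\<^bsub>rkhs\<^esub> g) \<le> 2 * e / 3"
      proof (rule tendsto_upperbound[OF rep_cnorm[OF rep_minus[OF v rep]]])
        show "\<forall>\<^sub>F n in sequentially. cnorm sections (v i n \<ominus>\<^bsub>sections\<^esub> u n) \<le> 2 * e / 3"
          using eventually_ge_at_top[of "max N1 (N i)"]
        proof eventually_elim
          case (elim n)
          have "cnorm sections (v i n \<ominus>\<^bsub>sections\<^esub> u n) \<le> cnorm sections (v i n \<ominus>\<^bsub>sections\<^esub> u i) + cnorm sections (u i \<ominus>\<^bsub>sections\<^esub> u n)"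
            by (rule S.cnorm_triangle_minus) auto
          then show ?case
            using N[of i n] N1[of i n] N2[of i] i elim by (simp add: u_def)
        qed
      qed simp
      moreover have "X i \<ominus>\<^bsub>rkhs\<^esub> g \<in> carrier rkhs"
        using rep_minus[OF v rep] rkhs_carrier by blast
      ultimately show ?thesis
        using e by simp
    qed
    then show "\<exists>no. \<forall>n\<ge>no. norm (cnorm rkhs (X n \<ominus>\<^bsub>rkhs\<^esub> g) - 0) < e" by blast
  qed
  moreover have "g \<in> carrier rkhs"
    using rep rkhs_carrier by blast
  ultimately show ?thesis by blast
qed

lemma rkhs_hilbert: "hilbert_space rkhs"
proof (rule hilbert_space.intro)
  show "\<exists>x\<in>carrier rkhs. (\<lambda>i. cnorm rkhs (X i \<ominus>\<^bsub>rkhs\<^esub> x)) \<longlonglongrightarrow> 0"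
    if "\<And>i. X i \<in> carrier rkhs" "\<And>e. 0 < e \<Longrightarrow> \<exists>N. \<forall>i\<ge>N. \<forall>j\<ge>N. cnorm rkhs (X i \<ominus>\<^bsub>rkhs\<^esub> X j) < e" for X
    by (rule rkhs_complete) (use that in \<open>auto simp: R.Cauchy_seq_def\<close>)
qed (fact R.is_module R.cinner_commute R.cinner_add_left R.cinner_smult_left R.cinner_nonneg rkhs_definite)+

lemma rkhs_function_hilbert_space: "function_hilbert_space \<Omega> H rkhs"
  unfolding function_hilbert_space_def
proof (intro conjI ballI allI)
  show "(\<lambda>f. f z) \<in> bounded_operators rkhs H" if "z \<in> \<Omega>" for z
    using that rkhs_evaluation_bound[OF that] by (auto simp: bounded_operators_def rkhs_simps)
qed (auto simp: rkhs_hilbert rkhs_simps rkhs_carrier rep_def)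

end

text \<open>Applied to three kernels: the scalar Drury-Arveson kernel, its multiple of the identity
  of a Hilbert space, and the kernel of the main equivalence. The first two settle the existence
  behind the choice operators.\<close>

theorem rkhs_exists:
  assumes "hilbert_space F" "is_kernel \<Omega> F L"
  obtains E where "function_hilbert_space \<Omega> F E"
    "\<And>w \<eta>. w \<in> \<Omega> \<Longrightarrow> \<eta> \<in> carrier F \<Longrightarrow> (\<lambda>z\<in>\<Omega>. L z w \<eta>) \<in> carrier E"
    "\<And>w \<eta> f. w \<in> \<Omega> \<Longrightarrow> \<eta> \<in> carrier F \<Longrightarrow> f \<in> carrier E \<Longrightarrow>
      cinner E f (\<lambda>z\<in>\<Omega>. L z w \<eta>) = cinner F (f w) \<eta>"
proof -
  interpret operator_kernel F \<Omega> L
    using assms by (simp add: operator_kernel_def operator_kernel_axioms_def)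
  show ?thesis
    using that rkhs_function_hilbert_space kernel_in_rkhs rkhs_reproducing by blast
qed

section \<open>Functionals on generating families and adjoints\<close>

context semi_inner_space
begin

lemma finsum_Suc_front:
  assumes "\<And>i. i < Suc m \<Longrightarrow> f i \<in> carrier H"
  shows "(\<Oplus>i\<in>{..<Suc m}. f i) = f m \<oplus> (\<Oplus>i\<in>{..<m}. f i)"
  unfolding lessThan_Suc by (rule finsum_insert) (use assms in auto)

lemma finsum_pred_closed:
  assumes "P \<zero>" "\<And>x y. x \<in> carrier H \<Longrightarrow> y \<in> carrier H \<Longrightarrow> P x \<Longrightarrow> P y \<Longrightarrow> P (x \<oplus> y)"
    and "\<And>i. i < (m::nat) \<Longrightarrow> f i \<in> carrier H \<and> P (f i)"
  shows "(\<Oplus>i\<in>{..<m}. f i) \<in> carrier H \<and> P (\<Oplus>i\<in>{..<m}. f i)"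
  using assms(3)
proof (induction m)
  case (Suc m)
  then show ?case
    using assms(2) by (subst (1 2) finsum_Suc_front) auto
qed (use assms(1) in simp)

text \<open>A relation and not a function, since a vector may be a sum of generators in several ways
  and the scalars could disagree a priori. Coefficients are absent because the families it is
  applied to are closed under scalar multiples.\<close>

inductive_set generator_sums :: "'i set \<Rightarrow> ('i \<Rightarrow> 'a) \<Rightarrow> ('i \<Rightarrow> complex) \<Rightarrow> ('a \<times> complex) set"
  for I v c where
  zero: "(\<zero>, 0) \<in> generator_sums I v c"
| step: "i \<in> I \<Longrightarrow> (x, a) \<in> generator_sums I v c \<Longrightarrow> (v i \<oplus> x, c i + a) \<in> generator_sums I v c"

lemma generator_sums_finsum:
  assumes "(x, a) \<in> generator_sums I v c" "\<And>i. i \<in> I \<Longrightarrow> v i \<in> carrier H"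
  shows "\<exists>m j. (\<forall>l<m. j l \<in> I) \<and> x = (\<Oplus>l\<in>{..<m::nat}. v (j l)) \<and> a = (\<Sum>l<m. c (j l))"
  using assms(1)
proof (induction rule: generator_sums.induct)
  case zero
  show ?case by (rule exI[of _ 0]) simp
next
  case (step i x a)
  then obtain m j where j: "\<forall>l<m. j l \<in> I" "x = (\<Oplus>l\<in>{..<m::nat}. v (j l))" "a = (\<Sum>l<m. c (j l))"
    by auto
  define k where "k = j(m := i)"
  have "(\<Oplus>l\<in>{..<Suc m}. v (k l)) = v (k m) \<oplus> (\<Oplus>l\<in>{..<m}. v (k l))"
    by (rule finsum_Suc_front) (use assms(2) j step in \<open>auto simp: k_def less_Suc_eq\<close>)
  also have "(\<Oplus>l\<in>{..<m}. v (k l)) = x"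
    unfolding j by (rule finsum_cong') (use assms(2) j in \<open>auto simp: k_def\<close>)
  finally have "(\<Oplus>l\<in>{..<Suc m}. v (k l)) = v i \<oplus> x"
    by (simp add: k_def)
  moreover have "(\<Sum>l<Suc m. c (k l)) = c i + a"
    by (simp add: k_def j)
  moreover have "\<forall>l<Suc m. k l \<in> I"
    using j step by (auto simp: k_def less_Suc_eq)
  ultimately show ?case by metis
qed

end

context hilbert_space
begin

text \<open>
  The bound hypothesis makes \<open>v i \<mapsto> c i\<close> extend to a well-defined bounded functional on the span.
\<close>

lemma functional_on_generators:
  assumes carr: "\<And>i. i \<in> I \<Longrightarrow> v i \<in> carrier H"
    and scale: "\<And>i t. i \<in> I \<Longrightarrow> \<exists>j\<in>I. v j = t \<odot>\<^bsub>H\<^esub> v i \<and> c j = t * c i"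
    and bound: "\<And>m j. (\<And>l. l < m \<Longrightarrow> j l \<in> I) \<Longrightarrow>
      cmod (\<Sum>l<m. c (j l)) \<le> M * cnorm H (\<Oplus>\<^bsub>H\<^esub>l\<in>{..<m::nat}. v (j l))"
  obtains h X where "h \<in> carrier H" "\<And>i. i \<in> I \<Longrightarrow> cinner H (v i) h = c i"
    "\<And>n::nat. \<exists>m j. (\<forall>l<m. j l \<in> I) \<and> X n = (\<Oplus>\<^bsub>H\<^esub>l\<in>{..<m::nat}. v (j l))"
    "(\<lambda>n. cnorm H (X n \<ominus>\<^bsub>H\<^esub> h)) \<longlonglongrightarrow> 0"
proof -
  let ?S = "generator_sums I v c"
  have S: "x \<in> carrier H" if "(x, a) \<in> ?S" for x a
    using that by (induction rule: generator_sums.induct) (auto simp: carr)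
  have S': "fst ` ?S \<subseteq> carrier H"
  proof
    fix x assume "x \<in> fst ` ?S"
    then show "x \<in> carrier H" using S by (metis imageE prod.collapse)
  qed
  have add: "(x \<oplus>\<^bsub>H\<^esub> y, a + b) \<in> ?S" if "(x, a) \<in> ?S" "(y, b) \<in> ?S" for x a y b
    using that(1)
  proof (induction rule: generator_sums.induct)
    case zero
    then show ?case using that(2) S by simp
  next
    case (step i x a)
    then show ?case
      using generator_sums.step[of i I "x \<oplus>\<^bsub>H\<^esub> y" "a + b" v c] S that(2) carr by (simp add: a_assoc add.assoc)
  qed
  have scaleS: "(t \<odot>\<^bsub>H\<^esub> x, t * a) \<in> ?S" if "(x, a) \<in> ?S" for t x a
    using that
  proof (induction rule: generator_sums.induct)
    case zero
    have "t \<odot>\<^bsub>H\<^esub> \<zero>\<^bsub>H\<^esub> = \<zero>\<^bsub>H\<^esub>"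
      using smult_assoc[of "\<zero>\<^bsub>H\<^esub>" t 0] by (simp add: smult_zero)
    then show ?case by (simp add: generator_sums.zero)
  next
    case (step i x a)
    obtain j where "j \<in> I" "v j = t \<odot>\<^bsub>H\<^esub> v i" "c j = t * c i"
      using scale step by blast
    moreover have "x \<in> carrier H" using S step by blast
    ultimately show ?case
      using generator_sums.step[of j I "t \<odot>\<^bsub>H\<^esub> x" "t * a" v c] step carr
      by (simp add: smult_r_distr distrib_left)
  qed
  have bd: "cmod a \<le> M * cnorm H x" if "(x, a) \<in> ?S" for x a
    using generator_sums_finsum[OF that carr] bound by auto
  show ?thesis
  proof (rule bounded_functional_extension[OF S' generator_sums.zero add scaleS bd])
    fix h X
    assume h: "h \<in> carrier H" "\<And>s b. (s, b) \<in> ?S \<Longrightarrow> cinner H s h = b"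
      and X: "\<And>n. X n \<in> fst ` ?S" "(\<lambda>n. cnorm H (X n \<ominus>\<^bsub>H\<^esub> h)) \<longlonglongrightarrow> 0"
    have "\<exists>m j. (\<forall>l<m. j l \<in> I) \<and> X n = (\<Oplus>\<^bsub>H\<^esub>l\<in>{..<m::nat}. v (j l))" for n
    proof -
      obtain a where a: "(X n, a) \<in> ?S" using X(1)[of n] by auto
      then show ?thesis
        using generator_sums_finsum[OF a carr] by blast
    qed
    note X' = this
    have "cinner H (v i) h = c i" if "i \<in> I" for i
      using h(2)[OF generator_sums.step[OF that generator_sums.zero]] carr[OF that] by simp
    then show ?thesis
      by (rule that[OF h(1) _ X' X(2)])
  qed
qed

text \<open>Represent pairing with \<open>f\<close>, restricted to the span of the generators: the
  representing vector is a limit of sums of generators, and totality identifies it with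
  \<open>f\<close>. This takes the place of an orthogonal decomposition along the closed
  span.\<close>

lemma dense_generators:
  assumes carr: "\<And>i. i \<in> I \<Longrightarrow> v i \<in> carrier H"
    and scale: "\<And>i t. i \<in> I \<Longrightarrow> \<exists>j\<in>I. v j = t \<odot>\<^bsub>H\<^esub> v i"
    and total: "\<And>x. x \<in> carrier H \<Longrightarrow> (\<And>i. i \<in> I \<Longrightarrow> cinner H (v i) x = 0) \<Longrightarrow> x = \<zero>\<^bsub>H\<^esub>"
    and f: "f \<in> carrier H"
  obtains X where "\<And>n::nat. \<exists>m j. (\<forall>l<m. j l \<in> I) \<and> X n = (\<Oplus>\<^bsub>H\<^esub>l\<in>{..<m::nat}. v (j l))"
    "(\<lambda>n. cnorm H (X n \<ominus>\<^bsub>H\<^esub> f)) \<longlonglongrightarrow> 0"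
proof -
  have scale': "\<exists>j\<in>I. v j = t \<odot>\<^bsub>H\<^esub> v i \<and> cinner H (v j) f = t * cinner H (v i) f" if i: "i \<in> I" for i t
  proof -
    obtain j where "j \<in> I" "v j = t \<odot>\<^bsub>H\<^esub> v i" using scale i by blast
    then show ?thesis
      using carr[OF i] f by (auto simp: cinner_smult_left)
  qed
  have bound: "cmod (\<Sum>l<m. cinner H (v (j l)) f) \<le> cnorm H f * cnorm H (\<Oplus>\<^bsub>H\<^esub>l\<in>{..<m::nat}. v (j l))"
    if "\<And>l. l < m \<Longrightarrow> j l \<in> I" for m j
  proof -
    have "(\<Oplus>\<^bsub>H\<^esub>l\<in>{..<m}. v (j l)) \<in> carrier H"
      by (rule finsum_closed) (use that carr in auto)
    moreover have "(\<Sum>l<m. cinner H (v (j l)) f) = cinner H (\<Oplus>\<^bsub>H\<^esub>l\<in>{..<m}. v (j l)) f"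
      by (rule cinner_finsum_left[symmetric]) (use that carr f in auto)
    ultimately show ?thesis
      using cauchy_schwarz[OF _ f] by (metis mult.commute)
  qed
  show ?thesis
  proof (rule functional_on_generators[OF carr scale' bound])
    fix h X
    assume h: "h \<in> carrier H" "\<And>i. i \<in> I \<Longrightarrow> cinner H (v i) h = cinner H (v i) f"
      and X: "\<And>n::nat. \<exists>m j. (\<forall>l<m. j l \<in> I) \<and> X n = (\<Oplus>\<^bsub>H\<^esub>l\<in>{..<m::nat}. v (j l))"
        "(\<lambda>n. cnorm H (X n \<ominus>\<^bsub>H\<^esub> h)) \<longlonglongrightarrow> 0"
    have "h \<ominus>\<^bsub>H\<^esub> f = \<zero>\<^bsub>H\<^esub>"
      using h carr f by (intro total) (auto simp: cinner_minus_right)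
    then have "h = f"
      by (rule minus_eq_zeroD[OF h(1) f])
    show ?thesis
      by (rule that[OF X[unfolded \<open>h = f\<close>]])
  qed
qed

end

text \<open>The definite description in \<open>adjoint_op_def\<close> denotes: Riesz for
  \<open>u \<mapsto> cinner F (T u) y\<close> gives existence, and definiteness of \<open>E\<close>
  gives uniqueness.\<close>

lemma adjoint_op:
  assumes E: "hilbert_space E" and F: "hilbert_space F" and T: "T \<in> bounded_operators E F" and y: "y \<in> carrier F"
  shows "adjoint_op E F T y \<in> carrier E"
    and "u \<in> carrier E \<Longrightarrow> cinner F (T u) y = cinner E u (adjoint_op E F T y)"
proof -
  interpret E: hilbert_space E by fact
  interpret F: hilbert_space F by fact
  let ?S = "(\<lambda>u. (u, cinner F (T u) y)) ` carrier E"
  obtain B where TB: "\<And>x. x \<in> carrier E \<Longrightarrow> cnorm F (T x) \<le> B * cnorm E x"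
    using T unfolding bounded_operators_def by blast
  have Tc [simp]: "x \<in> carrier E \<Longrightarrow> T x \<in> carrier F" for x
    using T by (auto simp: bounded_operators_def)
  have Tadd: "x \<in> carrier E \<Longrightarrow> x' \<in> carrier E \<Longrightarrow> T (x \<oplus>\<^bsub>E\<^esub> x') = T x \<oplus>\<^bsub>F\<^esub> T x'"
    and Tsmult: "x \<in> carrier E \<Longrightarrow> T (c \<odot>\<^bsub>E\<^esub> x) = c \<odot>\<^bsub>F\<^esub> T x" for x x' c
    using T by (auto simp: bounded_operators_def)
  have T0: "T \<zero>\<^bsub>E\<^esub> = \<zero>\<^bsub>F\<^esub>"
    using Tsmult[of "\<zero>\<^bsub>E\<^esub>" 0] by (simp add: E.smult_zero F.smult_zero)
  obtain h X where h: "h \<in> carrier E" "\<And>s b. (s, b) \<in> ?S \<Longrightarrow> cinner E s h = b"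
    "\<And>n. X n \<in> fst ` ?S" "(\<lambda>n. cnorm E (X n \<ominus>\<^bsub>E\<^esub> h)) \<longlonglongrightarrow> 0"
  proof (rule E.bounded_functional_extension[of ?S "B * cnorm F y"])
    show "(\<zero>\<^bsub>E\<^esub>, 0) \<in> ?S"
      by (rule image_eqI[of _ _ "\<zero>\<^bsub>E\<^esub>"]) (use y T0 in auto)
    show "(x \<oplus>\<^bsub>E\<^esub> x', a + b) \<in> ?S" if "(x, a) \<in> ?S" "(x', b) \<in> ?S" for x a x' b
      by (rule image_eqI[of _ _ "x \<oplus>\<^bsub>E\<^esub> x'"]) (use y that in \<open>auto simp: Tadd F.cinner_add_left\<close>)
    show "(c \<odot>\<^bsub>E\<^esub> x, c * a) \<in> ?S" if "(x, a) \<in> ?S" for c x a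
      by (rule image_eqI[of _ _ "c \<odot>\<^bsub>E\<^esub> x"]) (use y that in \<open>auto simp: Tsmult F.cinner_smult_left\<close>)
    show "cmod a \<le> B * cnorm F y * cnorm E x" if "(x, a) \<in> ?S" for x a
    proof -
      have x: "x \<in> carrier E" and a: "a = cinner F (T x) y" using that by auto
      have "cmod a \<le> cnorm F (T x) * cnorm F y"
        unfolding a using x y by (intro F.cauchy_schwarz) auto
      also have "\<dots> \<le> (B * cnorm E x) * cnorm F y"
        using TB[OF x] y by (intro mult_right_mono) auto
      finally show ?thesis by (simp add: mult_ac)
    qed
  qed auto
  have "adjoint_op E F T y = h"
    unfolding adjoint_op_def
  proof (rule the_equality)
    show "h \<in> carrier E \<and> (\<forall>u\<in>carrier E. cinner F (T u) y = cinner E u h)"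
      using h(1) h(2)[OF imageI] by simp
    show "x = h" if "x \<in> carrier E \<and> (\<forall>u\<in>carrier E. cinner F (T u) y = cinner E u x)" for x
      by (rule E.eq_if_cinner_eq) (use that h(1) h(2)[OF imageI] in simp_all)
  qed
  with h(1) h(2)[OF imageI] show "adjoint_op E F T y \<in> carrier E"
    and "u \<in> carrier E \<Longrightarrow> cinner F (T u) y = cinner E u (adjoint_op E F T y)"
    by auto
qed

lemma adjoint_op_eqI:
  assumes "hilbert_space E" "x \<in> carrier E" "\<And>u. u \<in> carrier E \<Longrightarrow> cinner F (T u) y = cinner E u x"
  shows "adjoint_op E F T y = x"
  unfolding adjoint_op_def
proof (rule the_equality)
  interpret hilbert_space E by fact
  show "x' = x" if "x' \<in> carrier E \<and> (\<forall>u\<in>carrier E. cinner F (T u) y = cinner E u x')" for x'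
    by (rule eq_if_cinner_eq) (use that assms in auto)
qed (use assms in auto)

section \<open>Hilbert spaces of functions with bounded evaluations\<close>

locale function_space = F: hilbert_space F for F :: "'b hilbert" +
  fixes \<Omega> :: "'s set" and T :: "('s \<Rightarrow> 'b) hilbert"
  assumes fhs: "function_hilbert_space \<Omega> F T"

sublocale function_space \<subseteq> T: hilbert_space T
  using fhs by (simp add: function_hilbert_space_def)

context function_space
begin

lemma val_closed [simp]: "f \<in> carrier T \<Longrightarrow> z \<in> \<Omega> \<Longrightarrow> f z \<in> carrier F"
  using fhs by (auto simp: function_hilbert_space_def)

lemma val_add: "f \<in> carrier T \<Longrightarrow> g \<in> carrier T \<Longrightarrow> f \<oplus>\<^bsub>T\<^esub> g = (\<lambda>z\<in>\<Omega>. f z \<oplus>\<^bsub>F\<^esub> g z)"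
  using fhs by (simp add: function_hilbert_space_def)

lemma val_smult: "f \<in> carrier T \<Longrightarrow> c \<odot>\<^bsub>T\<^esub> f = (\<lambda>z\<in>\<Omega>. c \<odot>\<^bsub>F\<^esub> f z)"
  using fhs by (simp add: function_hilbert_space_def)

text \<open>\<open>function_hilbert_space\<close> prescribes sums and scalar multiples but not the
  zero, which is therefore recovered as a multiple by \<open>0\<close>.\<close>

lemma val_zero: "\<zero>\<^bsub>T\<^esub> = (\<lambda>z\<in>\<Omega>. \<zero>\<^bsub>F\<^esub>)"
proof -
  have "\<zero>\<^bsub>T\<^esub> = 0 \<odot>\<^bsub>T\<^esub> \<zero>\<^bsub>T\<^esub>"
    by (simp add: T.smult_zero)
  also have "\<dots> = (\<lambda>z\<in>\<Omega>. \<zero>\<^bsub>F\<^esub>)"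
    by (auto simp: val_smult F.smult_zero)
  finally show ?thesis .
qed

lemma val_minus: "f \<in> carrier T \<Longrightarrow> g \<in> carrier T \<Longrightarrow> z \<in> \<Omega> \<Longrightarrow> (f \<ominus>\<^bsub>T\<^esub> g) z = f z \<ominus>\<^bsub>F\<^esub> g z"
  using T.smult_in_carrier[of g "- 1"] by (simp add: T.minus_eq_add_smult F.minus_eq_add_smult val_add val_smult)

lemma val_ext: "f \<in> carrier T \<Longrightarrow> g \<in> \<Omega> \<rightarrow>\<^sub>E carrier F \<Longrightarrow> (\<And>z. z \<in> \<Omega> \<Longrightarrow> f z = g z) \<Longrightarrow> f = g"
  using fhs unfolding function_hilbert_space_def by (intro PiE_ext[of f \<Omega> "\<lambda>_. carrier F"]) auto

lemma evaluation_bounded: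
  assumes "z \<in> \<Omega>"
  obtains B where "\<And>f. f \<in> carrier T \<Longrightarrow> cnorm F (f z) \<le> B * cnorm T f"
proof -
  have "(\<lambda>f. f z) \<in> bounded_operators T F"
    using fhs assms by (simp add: function_hilbert_space_def)
  then show ?thesis
    using that unfolding bounded_operators_def by blast
qed

end

section \<open>Tensor products as reproducing kernel spaces\<close>

lemma elementary_tensor_apply [simp]: "z \<in> \<Omega> \<Longrightarrow> elementary_tensor \<Omega> E f \<eta> z = f z \<odot>\<^bsub>E\<^esub> \<eta>"
  by (simp add: elementary_tensor_def)

lemma complex_hilbert_simps [simp]:
  "carrier complex_hilbert = UNIV" "x \<oplus>\<^bsub>complex_hilbert\<^esub> y = x + y" "\<zero>\<^bsub>complex_hilbert\<^esub> = 0"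
  "x \<odot>\<^bsub>complex_hilbert\<^esub> y = x * y" "cinner complex_hilbert x y = x * cnj y"
  by (simp_all add: complex_hilbert_def)

locale scalar_rkhs =
  fixes \<Omega> :: "'s set" and k :: "'s \<Rightarrow> 's \<Rightarrow> complex" and D :: "('s \<Rightarrow> complex) hilbert"
  assumes is_rkhs: "is_rkhs \<Omega> k D"

sublocale scalar_rkhs \<subseteq> D: function_space complex_hilbert \<Omega> D
  using is_rkhs hilbert_space_complex_hilbert
  by (simp add: is_rkhs_def function_space_def function_space_axioms_def)

context scalar_rkhs
begin

definition kf :: "'s \<Rightarrow> 's \<Rightarrow> complex" where
  "kf w = (\<lambda>z\<in>\<Omega>. k z w)"

lemma kf_closed [simp]: "w \<in> \<Omega> \<Longrightarrow> kf w \<in> carrier D"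
  using is_rkhs by (simp add: is_rkhs_def kf_def)

lemma kf_reproducing: "w \<in> \<Omega> \<Longrightarrow> f \<in> carrier D \<Longrightarrow> cinner D f (kf w) = f w"
  using is_rkhs by (simp add: is_rkhs_def kf_def)

text \<open>A function orthogonal to all \<open>kf z\<close> vanishes at every \<open>z\<close>. The
  generators are indexed by a point together with a scalar so that the family is closed under
  scaling.\<close>

lemma kf_dense:
  assumes f: "f \<in> carrier D"
  obtains X where
    "\<And>n::nat. \<exists>m w c. (\<forall>l<m. w l \<in> \<Omega>) \<and> X n = (\<Oplus>\<^bsub>D\<^esub>l\<in>{..<m::nat}. c l \<odot>\<^bsub>D\<^esub> kf (w l))"
    "(\<lambda>n. cnorm D (X n \<ominus>\<^bsub>D\<^esub> f)) \<longlonglongrightarrow> 0"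
proof (rule D.T.dense_generators[of "\<Omega> \<times> UNIV" "\<lambda>(w, c). c \<odot>\<^bsub>D\<^esub> kf w" f])
  fix i :: "'s \<times> complex" and t assume "i \<in> \<Omega> \<times> UNIV"
  then show "\<exists>j\<in>\<Omega> \<times> UNIV. (case j of (w, c) \<Rightarrow> c \<odot>\<^bsub>D\<^esub> kf w) = t \<odot>\<^bsub>D\<^esub> (case i of (w, c) \<Rightarrow> c \<odot>\<^bsub>D\<^esub> kf w)"
    by (intro bexI[of _ "(fst i, t * snd i)"]) (auto simp: D.T.smult_assoc split_beta)
next
  fix x assume x: "x \<in> carrier D"
    and orth: "\<And>i. i \<in> \<Omega> \<times> UNIV \<Longrightarrow> cinner D (case i of (w, c) \<Rightarrow> c \<odot>\<^bsub>D\<^esub> kf w) x = 0"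
  have "x z = 0" if z: "z \<in> \<Omega>" for z
    using orth[of "(z, 1)"] z x kf_reproducing[OF z x] D.T.cinner_commute[of x "kf z"]
    by (simp add: D.T.cinner_smult_left)
  then show "x = \<zero>\<^bsub>D\<^esub>"
    by (intro D.val_ext[OF x]) (auto simp: D.val_zero)
next
  fix X
  assume X: "\<And>n::nat. \<exists>m j. (\<forall>l<m. j l \<in> \<Omega> \<times> UNIV) \<and>
      X n = (\<Oplus>\<^bsub>D\<^esub>l\<in>{..<m::nat}. case j l of (w, c) \<Rightarrow> c \<odot>\<^bsub>D\<^esub> kf w)"
    and lim: "(\<lambda>n. cnorm D (X n \<ominus>\<^bsub>D\<^esub> f)) \<longlonglongrightarrow> 0"
  have "\<exists>m w c. (\<forall>l<m. w l \<in> \<Omega>) \<and> X n = (\<Oplus>\<^bsub>D\<^esub>l\<in>{..<m::nat}. c l \<odot>\<^bsub>D\<^esub> kf (w l))" for n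
  proof -
    obtain m j where j: "\<forall>l<m. j l \<in> \<Omega> \<times> (UNIV :: complex set)"
      "X n = (\<Oplus>\<^bsub>D\<^esub>l\<in>{..<m::nat}. case j l of (w, c) \<Rightarrow> c \<odot>\<^bsub>D\<^esub> kf w)"
      using X[of n] by blast
    show ?thesis
      by (rule exI[of _ m], rule exI[of _ "\<lambda>l. fst (j l)"], rule exI[of _ "\<lambda>l. snd (j l)"])
        (use j in \<open>auto simp: split_beta\<close>)
  qed
  then show ?thesis using lim by (rule that)
qed (use f in auto)

end

text \<open>The tensor product seen as the reproducing kernel space of \<open>k\<close> times the
  identity of \<open>E\<close>. The lemma \<open>function_tensor\<close> and, after it,
  \<open>scalar_times_identityI\<close> show that this description and
  \<open>is_function_tensor\<close> amount to the same.\<close>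

locale scalar_times_identity = scalar_rkhs \<Omega> k D + T: function_space E \<Omega> T
  for \<Omega> :: "'s set" and k and D and E :: "'e hilbert" and T +
  assumes ktensor_closed: "\<And>w \<eta>. w \<in> \<Omega> \<Longrightarrow> \<eta> \<in> carrier E \<Longrightarrow> elementary_tensor \<Omega> E (kf w) \<eta> \<in> carrier T"
    and ktensor_reproducing: "\<And>w \<eta> f. w \<in> \<Omega> \<Longrightarrow> \<eta> \<in> carrier E \<Longrightarrow> f \<in> carrier T \<Longrightarrow>
      cinner T f (elementary_tensor \<Omega> E (kf w) \<eta>) = cinner E (f w) \<eta>"
begin

abbreviation "et \<equiv> elementary_tensor \<Omega> E"

lemma et_add:
  assumes "f \<in> carrier D" "g \<in> carrier D" "\<eta> \<in> carrier E" "et f \<eta> \<in> carrier T" "et g \<eta> \<in> carrier T"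
  shows "et (f \<oplus>\<^bsub>D\<^esub> g) \<eta> = et f \<eta> \<oplus>\<^bsub>T\<^esub> et g \<eta>"
  using assms by (simp add: T.val_add D.val_add) (auto simp: elementary_tensor_def T.F.smult_add_left)

lemma et_smult:
  assumes "f \<in> carrier D" "\<eta> \<in> carrier E" "et f \<eta> \<in> carrier T"
  shows "et (c \<odot>\<^bsub>D\<^esub> f) \<eta> = c \<odot>\<^bsub>T\<^esub> et f \<eta>"
  using assms by (simp add: T.val_smult D.val_smult) (auto simp: elementary_tensor_def T.F.smult_assoc)

lemma et_smult_right:
  assumes "f \<in> carrier D" "\<eta> \<in> carrier E" "et f \<eta> \<in> carrier T"
  shows "et f (c \<odot>\<^bsub>E\<^esub> \<eta>) = c \<odot>\<^bsub>T\<^esub> et f \<eta>"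
  using assms
  by (simp add: T.val_smult) (auto simp: elementary_tensor_def T.F.smult_assoc[symmetric] mult.commute)

lemma et_zero: "\<eta> \<in> carrier E \<Longrightarrow> et \<zero>\<^bsub>D\<^esub> \<eta> = \<zero>\<^bsub>T\<^esub>"
  by (auto simp: T.val_zero D.val_zero elementary_tensor_def T.F.smult_zero)

text \<open>
  The vectors of \<open>D\<close> for which the tensor product behaves well; they turn out to be all of \<open>D\<close>.
\<close>

definition good :: "('s \<Rightarrow> complex) \<Rightarrow> bool" where
  "good x \<longleftrightarrow> x \<in> carrier D \<and> (\<forall>\<eta>\<in>carrier E. et x \<eta> \<in> carrier T) \<and>
     (\<forall>f\<in>carrier D. \<forall>\<eta>\<in>carrier E. \<forall>\<zeta>\<in>carrier E. et f \<eta> \<in> carrier T \<longrightarrow>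
       cinner T (et f \<eta>) (et x \<zeta>) = cinner D f x * cinner E \<eta> \<zeta>)"

text \<open>By the reproducing properties of \<open>T\<close> and \<open>D\<close>, both sides of
  the formula equal \<open>f w * cinner E \<eta> \<zeta>\<close>.\<close>

lemma good_kf: "w \<in> \<Omega> \<Longrightarrow> good (kf w)"
  unfolding good_def using ktensor_closed ktensor_reproducing kf_reproducing
  by (auto simp: T.F.cinner_smult_left)

lemma good_add: "good x \<Longrightarrow> good y \<Longrightarrow> good (x \<oplus>\<^bsub>D\<^esub> y)"
  unfolding good_def by (auto simp: et_add T.T.cinner_add_right D.T.cinner_add_right distrib_right)

lemma good_smult: "good x \<Longrightarrow> good (c \<odot>\<^bsub>D\<^esub> x)"
  unfolding good_def by (auto simp: et_smult T.T.cinner_smult_right D.T.cinner_smult_right mult.assoc)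

lemma good_zero: "good \<zero>\<^bsub>D\<^esub>"
  unfolding good_def by (auto simp: et_zero)

lemma good_minus: "good x \<Longrightarrow> good y \<Longrightarrow> good (x \<ominus>\<^bsub>D\<^esub> y)"
  using good_add[OF _ good_smult[of y "- 1"], of x] by (simp add: good_def D.T.minus_eq_add_smult)

lemma good_closed: "good x \<Longrightarrow> x \<in> carrier D" "good x \<Longrightarrow> \<eta> \<in> carrier E \<Longrightarrow> et x \<eta> \<in> carrier T"
  by (auto simp: good_def)

lemma cinner_good:
  "good x \<Longrightarrow> f \<in> carrier D \<Longrightarrow> \<eta> \<in> carrier E \<Longrightarrow> \<zeta> \<in> carrier E \<Longrightarrow> et f \<eta> \<in> carrier T \<Longrightarrow>
    cinner T (et f \<eta>) (et x \<zeta>) = cinner D f x * cinner E \<eta> \<zeta>"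
  by (simp add: good_def)

lemma et_minus:
  assumes "good x" "good y" "\<eta> \<in> carrier E"
  shows "et (x \<ominus>\<^bsub>D\<^esub> y) \<eta> = et x \<eta> \<ominus>\<^bsub>T\<^esub> et y \<eta>"
  using assms good_closed[OF assms(1)] good_closed[OF assms(2)] good_closed[OF good_smult[OF assms(2), of "- 1"]]
  by (simp add: D.T.minus_eq_add_smult T.T.minus_eq_add_smult et_add et_smult)

lemma cnorm_et_good:
  assumes "good x" "\<eta> \<in> carrier E"
  shows "cnorm T (et x \<eta>) = cnorm D x * cnorm E \<eta>"
proof -
  note c = good_closed(1)[OF assms(1)] good_closed(2)[OF assms]
  have "complex_of_real ((cnorm T (et x \<eta>))\<^sup>2) = complex_of_real ((cnorm D x * cnorm E \<eta>)\<^sup>2)"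
    using cinner_good[OF assms(1) c(1) assms(2,2) c(2)] c assms(2)
    by (simp add: T.T.cinner_self D.T.cinner_self T.F.cinner_self power_mult_distrib)
  then have "(cnorm T (et x \<eta>))\<^sup>2 = (cnorm D x * cnorm E \<eta>)\<^sup>2"
    by (simp only: of_real_eq_iff)
  then show ?thesis
    using c assms(2) by (simp add: power2_eq_iff_nonneg)
qed

text \<open>On good vectors \<open>x \<mapsto> et x \<eta>\<close> multiplies norms by that of
  \<open>\<eta>\<close>. So it sends combinations of kernel functions that converge to
  \<open>f\<close> to a Cauchy sequence in \<open>T\<close>, whose limit can only be
  \<open>et f \<eta>\<close>.\<close>

lemma et_approx:
  assumes f: "f \<in> carrier D"
  obtains X where "\<And>n. good (X n)" "(\<lambda>n. cnorm D (X n \<ominus>\<^bsub>D\<^esub> f)) \<longlonglongrightarrow> 0"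
    "\<And>\<eta>. \<eta> \<in> carrier E \<Longrightarrow> et f \<eta> \<in> carrier T"
    "\<And>\<eta>. \<eta> \<in> carrier E \<Longrightarrow> (\<lambda>n. cnorm T (et (X n) \<eta> \<ominus>\<^bsub>T\<^esub> et f \<eta>)) \<longlonglongrightarrow> 0"
proof (rule kf_dense[OF f])
  fix X
  assume X: "\<And>n::nat. \<exists>m w c. (\<forall>l<m. w l \<in> \<Omega>) \<and> X n = (\<Oplus>\<^bsub>D\<^esub>l\<in>{..<m::nat}. c l \<odot>\<^bsub>D\<^esub> kf (w l))"
    and lim: "(\<lambda>n. cnorm D (X n \<ominus>\<^bsub>D\<^esub> f)) \<longlonglongrightarrow> 0"
  have good: "good (X n)" for n
  proof -
    obtain m w c where w: "\<forall>l<m. w l \<in> \<Omega>" "X n = (\<Oplus>\<^bsub>D\<^esub>l\<in>{..<m::nat}. c l \<odot>\<^bsub>D\<^esub> kf (w l))"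
      using X[of n] by blast
    show ?thesis
      unfolding w(2)
      by (rule conjunct2, rule D.T.finsum_pred_closed)
        (use w(1) in \<open>auto intro: good_zero good_add good_smult good_kf\<close>)
  qed
  note [simp] = good_closed(1)[OF good]
  have *: "et f \<eta> \<in> carrier T \<and> (\<lambda>n. cnorm T (et (X n) \<eta> \<ominus>\<^bsub>T\<^esub> et f \<eta>)) \<longlonglongrightarrow> 0" if \<eta>: "\<eta> \<in> carrier E" for \<eta>
  proof -
    have c [simp]: "et (X n) \<eta> \<in> carrier T" for n
      using good_closed(2)[OF good \<eta>] .
    have "T.T.Cauchy_seq (\<lambda>n. et (X n) \<eta>)"
      unfolding T.T.Cauchy_seq_def
    proof safe
      fix e :: real assume e: "e > 0"
      define C where "C = cnorm E \<eta> + 1"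
      have C: "C > 0" using \<eta> by (simp add: C_def add_nonneg_pos)
      have "e / (2 * C) > 0" using e C by simp
      then obtain N where N: "\<And>n. n \<ge> N \<Longrightarrow> cnorm D (X n \<ominus>\<^bsub>D\<^esub> f) < e / (2 * C)"
        using order_tendstoD(2)[OF lim] by (auto simp: eventually_sequentially)
      have "cnorm T (et (X i) \<eta> \<ominus>\<^bsub>T\<^esub> et (X j) \<eta>) < e" if "i \<ge> N" "j \<ge> N" for i j
      proof -
        have "cnorm D (X i \<ominus>\<^bsub>D\<^esub> X j) \<le> cnorm D (X i \<ominus>\<^bsub>D\<^esub> f) + cnorm D (f \<ominus>\<^bsub>D\<^esub> X j)"
          using f by (intro D.T.cnorm_triangle_minus) auto
        also have "cnorm D (f \<ominus>\<^bsub>D\<^esub> X j) = cnorm D (X j \<ominus>\<^bsub>D\<^esub> f)"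
          using f by (intro D.T.cnorm_minus_commute) auto
        finally have less: "cnorm D (X i \<ominus>\<^bsub>D\<^esub> X j) < e / C"
          using N[OF that(1)] N[OF that(2)] by (simp add: field_simps)
        have "cnorm T (et (X i) \<eta> \<ominus>\<^bsub>T\<^esub> et (X j) \<eta>) = cnorm D (X i \<ominus>\<^bsub>D\<^esub> X j) * cnorm E \<eta>"
          using cnorm_et_good[OF good_minus[OF good good] \<eta>] by (simp add: et_minus[OF good good \<eta>])
        also have "\<dots> \<le> cnorm D (X i \<ominus>\<^bsub>D\<^esub> X j) * C"
          by (intro mult_left_mono) (auto simp: C_def)
        also have "\<dots> < e"
          using less C by (simp add: field_simps)
        finally show ?thesis .
      qed
      then show "\<exists>N. \<forall>i\<ge>N. \<forall>j\<ge>N. cnorm T (et (X i) \<eta> \<ominus>\<^bsub>T\<^esub> et (X j) \<eta>) < e" by blast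
    qed simp
    then obtain t where t: "t \<in> carrier T" "(\<lambda>n. cnorm T (et (X n) \<eta> \<ominus>\<^bsub>T\<^esub> t)) \<longlonglongrightarrow> 0"
      using T.T.Cauchy_seq_converges by blast
    \<comment> \<open>The limit is so far an abstract element of \<open>T\<close>. Its value at
      \<open>z\<close> is tested against \<open>\<zeta>\<close> by pairing with
      \<open>et (kf z) \<zeta>\<close>, where the product formula for the good \<open>X n\<close>
      passes to the limit.\<close>
    have "t = et f \<eta>"
    proof (rule T.val_ext[OF t(1)])
      show "et f \<eta> \<in> \<Omega> \<rightarrow>\<^sub>E carrier E"
        using \<eta> by (auto simp: elementary_tensor_def)
      fix z assume z: "z \<in> \<Omega>"
      show "t z = et f \<eta> z"
      proof (rule T.F.eq_if_cinner_eq)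
        fix \<zeta> assume \<zeta>: "\<zeta> \<in> carrier E"
        have "(\<lambda>n. cinner T (et (kf z) \<zeta>) (et (X n) \<eta>)) \<longlonglongrightarrow> cinner T (et (kf z) \<zeta>) t"
          using z \<zeta> t good_closed(2)[OF good_kf[OF z] \<zeta>] T.T.Cauchy_seq_const
          by (intro T.T.tendsto_cinner) (auto simp: a_minus_def T.T.r_neg)
        moreover have "(\<lambda>n. cinner D (kf z) (X n)) \<longlonglongrightarrow> cinner D (kf z) f"
          using z f lim by (intro D.T.tendsto_cinner) (auto simp: a_minus_def D.T.r_neg)
        then have "(\<lambda>n. cinner D (kf z) (X n) * cinner E \<zeta> \<eta>) \<longlonglongrightarrow> cinner D (kf z) f * cinner E \<zeta> \<eta>"
          by (intro tendsto_mult_right)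
        moreover have "cinner T (et (kf z) \<zeta>) (et (X n) \<eta>) = cinner D (kf z) (X n) * cinner E \<zeta> \<eta>" for n
          using z by (intro cinner_good good \<zeta> \<eta> good_closed(2)[OF good_kf]) auto
        ultimately have "cinner T (et (kf z) \<zeta>) t = cinner D (kf z) f * cinner E \<zeta> \<eta>"
          using LIMSEQ_unique by (simp only:) blast
        moreover have "cinner T (et (kf z) \<zeta>) t = cnj (cinner E (t z) \<zeta>)"
          using ktensor_reproducing[OF z \<zeta> t(1)] T.T.cinner_commute[OF good_closed(2)[OF good_kf[OF z] \<zeta>] t(1)] by simp
        moreover have "cinner D (kf z) f = cnj (f z)"
          using kf_reproducing[OF z f] D.T.cinner_commute[of "kf z" f] z f by simp
        ultimately show "cinner E \<zeta> (t z) = cinner E \<zeta> (et f \<eta> z)"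
          using z \<eta> \<zeta> t T.F.cinner_commute[of \<zeta> "t z"] by (simp add: T.F.cinner_smult_right)
      qed (use t z \<eta> in auto)
    qed
    with t show ?thesis by simp
  qed
  show ?thesis
    by (rule that[OF good lim]) (use * in auto)
qed

text \<open>The product formula with a good second vector already allows any first vector, so one
  limit, taken in \<open>g\<close>, suffices. Density follows from totality of the
  \<open>et (kf w) \<eta>\<close>, a family closed under scaling because scalars are absorbed into
  \<open>\<eta>\<close>.\<close>

lemma function_tensor: "is_function_tensor \<Omega> D E T"
  unfolding is_function_tensor_def
proof (intro conjI ballI allI impI)
  show "function_hilbert_space \<Omega> E T" by (rule T.fhs)
  show "et f \<eta> \<in> carrier T" if "f \<in> carrier D" "\<eta> \<in> carrier E" for f \<eta>
    using et_approx[OF that(1)] that(2) by metis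
  show "cinner T (et f \<eta>) (et g \<zeta>) = cinner D f g * cinner E \<eta> \<zeta>"
    if fg: "f \<in> carrier D" "g \<in> carrier D" and v: "\<eta> \<in> carrier E" "\<zeta> \<in> carrier E" for f g \<eta> \<zeta>
  proof (rule et_approx[OF fg(2)])
    have f: "et f \<eta> \<in> carrier T"
      using et_approx[OF fg(1)] v(1) by metis
    fix X assume X: "\<And>n. good (X n)" "(\<lambda>n. cnorm D (X n \<ominus>\<^bsub>D\<^esub> g)) \<longlonglongrightarrow> 0"
      and g: "\<And>\<eta>. \<eta> \<in> carrier E \<Longrightarrow> et g \<eta> \<in> carrier T"
      and lim: "\<And>\<eta>. \<eta> \<in> carrier E \<Longrightarrow> (\<lambda>n. cnorm T (et (X n) \<eta> \<ominus>\<^bsub>T\<^esub> et g \<eta>)) \<longlonglongrightarrow> 0"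
    have "(\<lambda>n. cinner T (et f \<eta>) (et (X n) \<zeta>)) \<longlonglongrightarrow> cinner T (et f \<eta>) (et g \<zeta>)"
      using f g v lim good_closed(2)[OF X(1)] by (intro T.T.tendsto_cinner) (auto simp: a_minus_def T.T.r_neg)
    moreover have "(\<lambda>n. cinner D f (X n)) \<longlonglongrightarrow> cinner D f g"
      using fg X(2) good_closed(1)[OF X(1)] by (intro D.T.tendsto_cinner) (auto simp: a_minus_def D.T.r_neg)
    then have "(\<lambda>n. cinner D f (X n) * cinner E \<eta> \<zeta>) \<longlonglongrightarrow> cinner D f g * cinner E \<eta> \<zeta>"
      by (intro tendsto_mult_right)
    moreover have "cinner T (et f \<eta>) (et (X n) \<zeta>) = cinner D f (X n) * cinner E \<eta> \<zeta>" for n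
      by (intro cinner_good X fg v f)
    ultimately show ?thesis
      using LIMSEQ_unique by (simp only:) blast
  qed
  show "\<exists>(m::nat) f \<eta>. (\<forall>i<m. f i \<in> carrier D \<and> \<eta> i \<in> carrier E) \<and>
      cnorm T (F \<ominus>\<^bsub>T\<^esub> (\<Oplus>\<^bsub>T\<^esub>i\<in>{..<m}. et (f i) (\<eta> i))) < e"
    if F: "F \<in> carrier T" and e: "e > 0" for F e
  proof (rule T.T.dense_generators[of "\<Omega> \<times> carrier E" "\<lambda>(w, \<eta>). et (kf w) \<eta>" F])
    fix i t assume "i \<in> \<Omega> \<times> carrier E"
    then show "\<exists>j\<in>\<Omega> \<times> carrier E. (case j of (w, \<eta>) \<Rightarrow> et (kf w) \<eta>) = t \<odot>\<^bsub>T\<^esub> (case i of (w, \<eta>) \<Rightarrow> et (kf w) \<eta>)"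
      by (intro bexI[of _ "(fst i, t \<odot>\<^bsub>E\<^esub> snd i)"]) (auto simp: split_beta et_smult_right ktensor_closed)
  next
    fix x assume x: "x \<in> carrier T"
      and orth: "\<And>i. i \<in> \<Omega> \<times> carrier E \<Longrightarrow> cinner T (case i of (w, \<eta>) \<Rightarrow> et (kf w) \<eta>) x = 0"
    have "x z = \<zero>\<^bsub>E\<^esub>" if z: "z \<in> \<Omega>" for z
    proof (rule T.F.eq_if_cinner_eq)
      fix u assume u: "u \<in> carrier E"
      show "cinner E u (x z) = cinner E u \<zero>\<^bsub>E\<^esub>"
        using orth[of "(z, u)"] z x u ktensor_reproducing[OF z u x] T.F.cinner_commute[of u "x z"]
          T.T.cinner_commute[OF x ktensor_closed[OF z u]] by simp
    qed (use x z in auto)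
    then show "x = \<zero>\<^bsub>T\<^esub>"
      by (intro T.val_ext[OF x]) (auto simp: T.val_zero)
  next
    fix X
    assume X: "\<And>n::nat. \<exists>m j. (\<forall>l<m. j l \<in> \<Omega> \<times> carrier E) \<and>
        X n = (\<Oplus>\<^bsub>T\<^esub>l\<in>{..<m::nat}. case j l of (w, \<eta>) \<Rightarrow> et (kf w) \<eta>)"
      and lim: "(\<lambda>n. cnorm T (X n \<ominus>\<^bsub>T\<^esub> F)) \<longlonglongrightarrow> 0"
    obtain n where n: "cnorm T (X n \<ominus>\<^bsub>T\<^esub> F) < e"
      using order_tendstoD(2)[OF lim e] by (auto simp: eventually_sequentially)
    obtain m j where j: "\<forall>l<m. j l \<in> \<Omega> \<times> carrier E"
      "X n = (\<Oplus>\<^bsub>T\<^esub>l\<in>{..<m::nat}. case j l of (w, \<eta>) \<Rightarrow> et (kf w) \<eta>)"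
      using X[of n] by blast
    have "X n \<in> carrier T"
      unfolding j(2) by (rule T.T.finsum_closed) (use j(1) ktensor_closed in \<open>auto simp: split_beta mem_Times_iff\<close>)
    then have "cnorm T (F \<ominus>\<^bsub>T\<^esub> X n) < e"
      using n F T.T.cnorm_minus_commute by metis
    then show ?thesis
      using j by (intro exI[of _ m] exI[of _ "\<lambda>l. kf (fst (j l))"] exI[of _ "\<lambda>l. snd (j l)"])
        (auto simp: split_beta mem_Times_iff)
  qed (use F in \<open>auto simp: ktensor_closed\<close>)
qed

end

text \<open>
  Conversely the axioms of the tensor product force the reproducing property, so that the
  arbitrary choice of a tensor product is harmless.
\<close>

lemma scalar_times_identityI:
  assumes D: "is_rkhs \<Omega> k D" and E: "hilbert_space E" and T: "is_function_tensor \<Omega> D E T"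
  shows "scalar_times_identity \<Omega> k D E T"
proof -
  interpret scalar_rkhs \<Omega> k D by unfold_locales fact
  have "function_space E \<Omega> T"
    using E T by (simp add: function_space_def function_space_axioms_def is_function_tensor_def)
  then interpret T: function_space E \<Omega> T .
  let ?et = "elementary_tensor \<Omega> E"
  have et: "?et f \<eta> \<in> carrier T" if "f \<in> carrier D" "\<eta> \<in> carrier E" for f \<eta>
    using T that by (simp add: is_function_tensor_def)
  have et_cinner: "cinner T (?et f \<eta>) (?et g \<zeta>) = cinner D f g * cinner E \<eta> \<zeta>"
    if "f \<in> carrier D" "g \<in> carrier D" "\<eta> \<in> carrier E" "\<zeta> \<in> carrier E" for f g \<eta> \<zeta>
    using T that unfolding is_function_tensor_def by blast
  have repr: "cinner T f (?et (kf w) \<eta>) = cinner E (f w) \<eta>"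
    if w: "w \<in> \<Omega>" and \<eta>: "\<eta> \<in> carrier E" and f: "f \<in> carrier T" for w \<eta> f
  proof -
    let ?k = "?et (kf w) \<eta>"
    have k: "?k \<in> carrier T" using et w \<eta> by simp
    obtain B where B: "\<And>f. f \<in> carrier T \<Longrightarrow> cnorm E (f w) \<le> B * cnorm T f"
      using T.evaluation_bounded[OF w] by blast
    \<comment> \<open>The first two summands bound the two functionals of \<open>f\<close> that are
      compared; the \<open>1\<close> makes \<open>C\<close> positive.\<close>
    define C where "C = cnorm T ?k + \<bar>B\<bar> * cnorm E \<eta> + 1"
    have C: "C > 0"
      using k \<eta> by (simp add: C_def add_nonneg_pos)
    have small: "cmod (cinner T f ?k - cinner E (f w) \<eta>) \<le> e" if e: "e > 0" for e
    proof -
      have "e / C > 0" using e C by simp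
      then obtain m g \<zeta> where g: "\<forall>i<m. g i \<in> carrier D \<and> \<zeta> i \<in> carrier E"
        "cnorm T (f \<ominus>\<^bsub>T\<^esub> (\<Oplus>\<^bsub>T\<^esub>i\<in>{..<m::nat}. ?et (g i) (\<zeta> i))) < e / C"
        using T f unfolding is_function_tensor_def by meson
      \<comment> \<open>On finite sums of elementary tensors the two functionals agree exactly, by
        the product formula. Density and boundedness carry this over to \<open>f\<close>.\<close>
      define X where "X = (\<Oplus>\<^bsub>T\<^esub>i\<in>{..<m}. ?et (g i) (\<zeta> i))"
      have X: "X \<in> carrier T \<and> cinner T X ?k = cinner E (X w) \<eta>"
        unfolding X_def
      proof (rule T.T.finsum_pred_closed)
        show "cinner T (x \<oplus>\<^bsub>T\<^esub> y) ?k = cinner E ((x \<oplus>\<^bsub>T\<^esub> y) w) \<eta>"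
          if "x \<in> carrier T" "y \<in> carrier T" "cinner T x ?k = cinner E (x w) \<eta>" "cinner T y ?k = cinner E (y w) \<eta>" for x y
          using that k w \<eta> by (subst T.T.cinner_add_left) (auto simp: T.val_add T.F.cinner_add_left)
        show "?et (g i) (\<zeta> i) \<in> carrier T \<and> cinner T (?et (g i) (\<zeta> i)) ?k = cinner E (?et (g i) (\<zeta> i) w) \<eta>"
          if "i < m" for i
          using g(1) that w \<eta> by (simp add: et et_cinner kf_reproducing T.F.cinner_smult_left)
        have "\<zero>\<^bsub>T\<^esub> w = \<zero>\<^bsub>E\<^esub>"
          using w by (simp add: T.val_zero)
        then show "cinner T \<zero>\<^bsub>T\<^esub> ?k = cinner E (\<zero>\<^bsub>T\<^esub> w) \<eta>"
          using k \<eta> by simp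
      qed
      have less: "cnorm T (f \<ominus>\<^bsub>T\<^esub> X) < e / C"
        using g(2) by (simp add: X_def)
      have fX: "f \<ominus>\<^bsub>T\<^esub> X \<in> carrier T" using f X by simp
      have "cinner T f ?k - cinner E (f w) \<eta> = cinner T (f \<ominus>\<^bsub>T\<^esub> X) ?k - cinner E ((f \<ominus>\<^bsub>T\<^esub> X) w) \<eta>"
        using X f k w \<eta> by (simp add: T.T.cinner_minus_left T.val_minus T.F.cinner_minus_left)
      also have "cmod \<dots> \<le> cmod (cinner T (f \<ominus>\<^bsub>T\<^esub> X) ?k) + cmod (cinner E ((f \<ominus>\<^bsub>T\<^esub> X) w) \<eta>)"
        by (rule norm_triangle_ineq4)
      also have "cmod (cinner T (f \<ominus>\<^bsub>T\<^esub> X) ?k) \<le> cnorm T (f \<ominus>\<^bsub>T\<^esub> X) * cnorm T ?k"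
        by (rule T.T.cauchy_schwarz[OF fX k])
      also have "cmod (cinner E ((f \<ominus>\<^bsub>T\<^esub> X) w) \<eta>) \<le> cnorm E ((f \<ominus>\<^bsub>T\<^esub> X) w) * cnorm E \<eta>"
        using fX w \<eta> by (intro T.F.cauchy_schwarz) auto
      also have "\<dots> \<le> (\<bar>B\<bar> * cnorm T (f \<ominus>\<^bsub>T\<^esub> X)) * cnorm E \<eta>"
      proof (rule mult_right_mono)
        show "cnorm E ((f \<ominus>\<^bsub>T\<^esub> X) w) \<le> \<bar>B\<bar> * cnorm T (f \<ominus>\<^bsub>T\<^esub> X)"
          using B[OF fX] mult_right_mono[OF abs_ge_self[of B] T.T.cnorm_nonneg[OF fX]] by linarith
      qed (use \<eta> in simp)
      finally have "cmod (cinner T f ?k - cinner E (f w) \<eta>) \<le>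
          cnorm T (f \<ominus>\<^bsub>T\<^esub> X) * cnorm T ?k + (\<bar>B\<bar> * cnorm T (f \<ominus>\<^bsub>T\<^esub> X)) * cnorm E \<eta>"
        by simp
      also have "\<dots> = cnorm T (f \<ominus>\<^bsub>T\<^esub> X) * C - cnorm T (f \<ominus>\<^bsub>T\<^esub> X)"
        by (simp add: C_def distrib_left mult_ac)
      also have "\<dots> \<le> cnorm T (f \<ominus>\<^bsub>T\<^esub> X) * C"
        using T.T.cnorm_nonneg[OF fX] by linarith
      also have "\<dots> \<le> e"
        using less unfolding pos_less_divide_eq[OF C] by (rule less_imp_le)
      finally show ?thesis .
    qed
    have "cmod (cinner T f ?k - cinner E (f w) \<eta>) \<le> 0"
    proof (rule field_le_epsilon)
      fix e :: real assume "e > 0"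
      then show "cmod (cinner T f ?k - cinner E (f w) \<eta>) \<le> 0 + e"
        unfolding add_0_left by (rule small)
    qed
    then show ?thesis by simp
  qed
  show ?thesis
    by unfold_locales (blast intro: et kf_closed, blast intro: repr)
qed

section \<open>The Drury--Arveson kernel and multipliers\<close>

lemma nonneg_Reals_sum: "(\<And>i. i \<in> A \<Longrightarrow> f i \<in> \<real>\<^sub>\<ge>\<^sub>0) \<Longrightarrow> sum f A \<in> (\<real>\<^sub>\<ge>\<^sub>0 :: complex set)"
  by (induction A rule: infinite_finite_induct) (auto intro: nonneg_Reals_add_I)

lemma norm_herm_less_1:
  assumes z: "z \<in> unit_ball" and w: "w \<in> unit_ball"
  shows "cmod (herm z w) < 1"
proof -
  have sq: "L2_set (\<lambda>i. cmod (v $ i)) UNIV < 1" if "v \<in> unit_ball" for v :: "complex ^ 'n"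
    using that by (simp add: L2_set_def unit_ball_def)
  have "cmod (herm z w) \<le> (\<Sum>i\<in>UNIV. \<bar>cmod (z $ i)\<bar> * \<bar>cmod (w $ i)\<bar>)"
    unfolding herm_def by (rule sum_norm_le) (simp add: norm_mult)
  also have "\<dots> \<le> L2_set (\<lambda>i. cmod (z $ i)) UNIV * L2_set (\<lambda>i. cmod (w $ i)) UNIV"
    by (rule L2_set_mult_ineq)
  also have "\<dots> < 1 * 1"
    using sq[OF z] sq[OF w] L2_set_nonneg by (intro mult_strict_mono') auto
  finally show ?thesis by simp
qed

lemma herm_neq_1: "z \<in> unit_ball \<Longrightarrow> w \<in> unit_ball \<Longrightarrow> 1 - herm z w \<noteq> 0"
  using norm_herm_less_1[of z w] by auto

definition da_kernel :: "complex ^ 'n \<Rightarrow> complex ^ 'n \<Rightarrow> complex" where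
  "da_kernel z w = 1 / (1 - herm z w)"

text \<open>
  Multiplication of a positive matrix by \<open>herm (z i) (z j) = (\<Sum>l. z i $ l * cnj (z j $ l))\<close> keeps it
  positive, as the factors can be absorbed into the coefficients; hence so does multiplication
  by the geometric series \<open>da_kernel (z i) (z j)\<close>.
\<close>

lemma da_kernel_positive:
  fixes z :: "nat \<Rightarrow> complex ^ 'n" and G :: "nat \<Rightarrow> nat \<Rightarrow> complex"
  assumes z: "\<And>i. i < m \<Longrightarrow> z i \<in> unit_ball"
    and G: "\<And>c. (\<Sum>i<m. \<Sum>j<m. cnj (c i) * c j * G i j) \<in> \<real>\<^sub>\<ge>\<^sub>0"
  shows "(\<Sum>i<m. \<Sum>j<m. da_kernel (z i) (z j) * G i j) \<in> \<real>\<^sub>\<ge>\<^sub>0"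
proof -
  have pow: "(\<Sum>i<m. \<Sum>j<m. cnj (c i) * c j * (herm (z i) (z j) ^ p * G i j)) \<in> \<real>\<^sub>\<ge>\<^sub>0" for p c
  \<comment> \<open>The coefficients must vary: one factor \<open>herm\<close> replaces
    \<open>c i\<close> by \<open>c i * cnj (z i $ l)\<close>, for each coordinate
    \<open>l\<close>.\<close>
  proof (induction p arbitrary: c)
    case (Suc p)
    have "(\<Sum>i<m. \<Sum>j<m. cnj (c i) * c j * (herm (z i) (z j) ^ Suc p * G i j)) =
        (\<Sum>i<m. \<Sum>j<m. \<Sum>l\<in>UNIV. cnj (c i * cnj (z i $ l)) * (c j * cnj (z j $ l)) * (herm (z i) (z j) ^ p * G i j))"
    proof (intro sum.cong refl)
      fix i j
      have "cnj (c i) * c j * (herm (z i) (z j) ^ Suc p * G i j) =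
          herm (z i) (z j) * (cnj (c i) * c j * (herm (z i) (z j) ^ p * G i j))"
        by simp
      also have "\<dots> = (\<Sum>l\<in>UNIV. z i $ l * cnj (z j $ l) * (cnj (c i) * c j * (herm (z i) (z j) ^ p * G i j)))"
        by (subst herm_def) (simp only: sum_distrib_right)
      also have "\<dots> = (\<Sum>l\<in>UNIV. cnj (c i * cnj (z i $ l)) * (c j * cnj (z j $ l)) * (herm (z i) (z j) ^ p * G i j))"
        by (intro sum.cong refl) simp
      finally show "cnj (c i) * c j * (herm (z i) (z j) ^ Suc p * G i j) =
          (\<Sum>l\<in>UNIV. cnj (c i * cnj (z i $ l)) * (c j * cnj (z j $ l)) * (herm (z i) (z j) ^ p * G i j))" .
    qed
    also have "\<dots> = (\<Sum>i<m. \<Sum>l\<in>UNIV. \<Sum>j<m. cnj (c i * cnj (z i $ l)) * (c j * cnj (z j $ l)) * (herm (z i) (z j) ^ p * G i j))"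
      by (rule sum.cong[OF refl], rule sum.swap)
    also have "\<dots> = (\<Sum>l\<in>UNIV. \<Sum>i<m. \<Sum>j<m. cnj (c i * cnj (z i $ l)) * (c j * cnj (z j $ l)) * (herm (z i) (z j) ^ p * G i j))"
      by (rule sum.swap)
    also have "\<dots> \<in> \<real>\<^sub>\<ge>\<^sub>0"
      by (intro nonneg_Reals_sum Suc.IH)
    finally show ?case .
  qed (use G in simp)
  have "(\<lambda>n. \<Sum>p<n. herm (z i) (z j) ^ p) \<longlonglongrightarrow> da_kernel (z i) (z j)" if "i < m" "j < m" for i j
    using geometric_sums[OF norm_herm_less_1[OF z[OF that(1)] z[OF that(2)]]]
    by (simp add: sums_def da_kernel_def)
  then have lim: "(\<lambda>n. \<Sum>i<m. \<Sum>j<m. (\<Sum>p<n. herm (z i) (z j) ^ p) * G i j) \<longlonglongrightarrow>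
      (\<Sum>i<m. \<Sum>j<m. da_kernel (z i) (z j) * G i j)"
    by (intro tendsto_sum tendsto_mult_right) auto
  have "(\<Sum>i<m. \<Sum>j<m. (\<Sum>p<n. herm (z i) (z j) ^ p) * G i j) \<in> \<real>\<^sub>\<ge>\<^sub>0" for n
  proof -
    have "(\<Sum>i<m. \<Sum>j<m. (\<Sum>p<n. herm (z i) (z j) ^ p) * G i j) =
        (\<Sum>i<m. \<Sum>p<n. \<Sum>j<m. herm (z i) (z j) ^ p * G i j)"
      unfolding sum_distrib_right by (rule sum.cong[OF refl], rule sum.swap)
    also have "\<dots> = (\<Sum>p<n. \<Sum>i<m. \<Sum>j<m. herm (z i) (z j) ^ p * G i j)"
      by (rule sum.swap)
    also have "\<dots> \<in> \<real>\<^sub>\<ge>\<^sub>0"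
      by (rule nonneg_Reals_sum) (use pow[of "\<lambda>_. 1"] in simp)
    finally show ?thesis .
  qed
  then show ?thesis
    by (intro Lim_in_closed_set[OF closed_nonneg_Reals_complex _ _ lim]) auto
qed

text \<open>\<open>da_kernel_positive\<close> applies to the Gram matrix of the
  \<open>\<eta> i\<close>, whose quadratic form is the squared norm of the combination with
  coefficients \<open>c j\<close>.\<close>

lemma is_kernel_da_kernel:
  assumes "hilbert_space E"
  shows "is_kernel unit_ball E (\<lambda>z w \<eta>. da_kernel z w \<odot>\<^bsub>E\<^esub> \<eta>)"
  unfolding is_kernel_def
proof (intro conjI ballI allI impI)
  interpret hilbert_space E by fact
  show "(\<lambda>\<eta>. c \<odot>\<^bsub>E\<^esub> \<eta>) \<in> bounded_operators E E" for c
    unfolding bounded_operators_def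
    by (auto simp: smult_r_distr cnorm_smult mult.commute intro!: exI[of _ "cmod c"] simp flip: smult_assoc)
  fix m :: nat and z :: "nat \<Rightarrow> complex ^ 'n" and \<eta>
  assume z: "\<forall>i<m. z i \<in> unit_ball \<and> \<eta> i \<in> carrier E"
  have "(\<Sum>i<m. \<Sum>j<m. da_kernel (z i) (z j) * cinner E (\<eta> j) (\<eta> i)) \<in> \<real>\<^sub>\<ge>\<^sub>0"
  proof (rule da_kernel_positive)
    fix c :: "nat \<Rightarrow> complex"
    let ?x = "\<Oplus>\<^bsub>E\<^esub>j\<in>{..<m}. c j \<odot>\<^bsub>E\<^esub> \<eta> j"
    have x: "?x \<in> carrier E"
      by (rule finsum_closed) (use z in auto)
    have "(\<Sum>i<m. \<Sum>j<m. cnj (c i) * c j * cinner E (\<eta> j) (\<eta> i)) = (\<Sum>i<m. cinner E ?x (c i \<odot>\<^bsub>E\<^esub> \<eta> i))"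
      using z by (intro sum.cong refl) (simp add: cinner_finsum_left cinner_smult_left cinner_smult_right sum_distrib_left mult_ac)
    also have "\<dots> = cinner E ?x ?x"
      by (rule cinner_finsum_right[symmetric]) (use z x in auto)
    also have "\<dots> \<in> \<real>\<^sub>\<ge>\<^sub>0"
      by (rule cinner_nonneg[OF x])
    finally show "(\<Sum>i<m. \<Sum>j<m. cnj (c i) * c j * cinner E (\<eta> j) (\<eta> i)) \<in> \<real>\<^sub>\<ge>\<^sub>0" .
  qed (use z in simp)
  also have "(\<Sum>i<m. \<Sum>j<m. da_kernel (z i) (z j) * cinner E (\<eta> j) (\<eta> i)) =
      (\<Sum>i<m. \<Sum>j<m. cinner E (da_kernel (z i) (z j) \<odot>\<^bsub>E\<^esub> \<eta> j) (\<eta> i))"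
    using z by (intro sum.cong refl) (simp add: cinner_smult_left)
  finally show "(\<Sum>i<m. \<Sum>j<m. cinner E (da_kernel (z i) (z j) \<odot>\<^bsub>E\<^esub> \<eta> j) (\<eta> i)) \<in> \<real>\<^sub>\<ge>\<^sub>0" .
qed

text \<open>Over \<open>complex_hilbert\<close> an operator-valued reproducing kernel space is a
  scalar one: take \<open>\<eta> = 1\<close>. This provides the witness for the choice
  operator.\<close>

lemma is_rkhs_drury_arveson:
  "is_rkhs unit_ball da_kernel (drury_arveson :: ((complex ^ 'n) \<Rightarrow> complex) hilbert)"
proof -
  have "\<exists>H :: ((complex ^ 'n) \<Rightarrow> complex) hilbert. is_rkhs unit_ball (\<lambda>z w. 1 / (1 - herm z w)) H"
  proof (rule rkhs_exists[OF hilbert_space_complex_hilbert is_kernel_da_kernel[OF hilbert_space_complex_hilbert]])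
    fix H :: "((complex ^ 'n) \<Rightarrow> complex) hilbert"
    assume H: "function_hilbert_space unit_ball complex_hilbert H"
      "\<And>w \<eta>. w \<in> unit_ball \<Longrightarrow> \<eta> \<in> carrier complex_hilbert \<Longrightarrow>
        (\<lambda>z\<in>unit_ball. da_kernel z w \<odot>\<^bsub>complex_hilbert\<^esub> \<eta>) \<in> carrier H"
      "\<And>w \<eta> f. w \<in> unit_ball \<Longrightarrow> \<eta> \<in> carrier complex_hilbert \<Longrightarrow> f \<in> carrier H \<Longrightarrow>
        cinner H f (\<lambda>z\<in>unit_ball. da_kernel z w \<odot>\<^bsub>complex_hilbert\<^esub> \<eta>) = cinner complex_hilbert (f w) \<eta>"
    show ?thesis
      using H(1) H(2)[of _ 1] H(3)[of _ 1]
      by (intro exI[of _ H]) (simp add: is_rkhs_def da_kernel_def)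
  qed
  then show ?thesis
    unfolding drury_arveson_def da_kernel_def[abs_def] by (rule someI_ex)
qed

text \<open>The witness is the reproducing kernel space of \<open>da_kernel\<close> times the
  identity, not a completed algebraic tensor product; its kernel functions are the elementary
  tensors of \<open>kf w\<close> and \<open>\<eta>\<close>.\<close>

lemma is_function_tensor_drury_arveson:
  fixes E :: "'e hilbert"
  assumes E: "hilbert_space E"
  shows "is_function_tensor unit_ball drury_arveson E (drury_arveson_tensor E :: ((complex ^ 'n) \<Rightarrow> 'e) hilbert)"
proof -
  interpret scalar_rkhs unit_ball da_kernel "drury_arveson :: ((complex ^ 'n) \<Rightarrow> complex) hilbert"
    by unfold_locales (rule is_rkhs_drury_arveson)
  interpret E: hilbert_space E by fact
  have kf: "elementary_tensor unit_ball E (kf w) \<eta> = (\<lambda>z\<in>unit_ball. da_kernel z w \<odot>\<^bsub>E\<^esub> \<eta>)" for w :: "complex ^ 'n" and \<eta>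
    by (auto simp: elementary_tensor_def kf_def)
  have "\<exists>T :: ((complex ^ 'n) \<Rightarrow> 'e) hilbert. is_function_tensor unit_ball drury_arveson E T"
  proof (rule rkhs_exists[OF E is_kernel_da_kernel[OF E]])
    fix T :: "((complex ^ 'n) \<Rightarrow> 'e) hilbert"
    assume T: "function_hilbert_space unit_ball E T"
      "\<And>w \<eta>. w \<in> unit_ball \<Longrightarrow> \<eta> \<in> carrier E \<Longrightarrow> (\<lambda>z\<in>unit_ball. da_kernel z w \<odot>\<^bsub>E\<^esub> \<eta>) \<in> carrier T"
      "\<And>w \<eta> f. w \<in> unit_ball \<Longrightarrow> \<eta> \<in> carrier E \<Longrightarrow> f \<in> carrier T \<Longrightarrow>
        cinner T f (\<lambda>z\<in>unit_ball. da_kernel z w \<odot>\<^bsub>E\<^esub> \<eta>) = cinner E (f w) \<eta>"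
    interpret function_space E unit_ball T
      by unfold_locales (rule T(1))
    interpret scalar_times_identity unit_ball da_kernel drury_arveson E T
      by unfold_locales (simp_all add: kf T)
    show ?thesis using function_tensor by blast
  qed
  then show ?thesis
    unfolding drury_arveson_tensor_def by (rule someI_ex)
qed

text \<open>All later arguments reach the chosen spaces through this instance.\<close>

lemma scalar_times_identity_drury_arveson:
  fixes E :: "'e hilbert"
  assumes "hilbert_space E"
  shows "scalar_times_identity unit_ball da_kernel drury_arveson E (drury_arveson_tensor E :: ((complex ^ 'n) \<Rightarrow> 'e) hilbert)"
  by (intro scalar_times_identityI is_rkhs_drury_arveson assms is_function_tensor_drury_arveson)

section \<open>Gram sums of kernel functions and the multiplier property\<close>

lemma (in scalar_times_identity) cinner_ktensor:
  assumes "w \<in> \<Omega>" "z \<in> \<Omega>" "\<eta> \<in> carrier E" "\<zeta> \<in> carrier E"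
  shows "cinner T (et (kf w) \<eta>) (et (kf z) \<zeta>) = k z w * cinner E \<eta> \<zeta>"
  using assms by (simp add: ktensor_reproducing ktensor_closed T.F.cinner_smult_left) (simp add: kf_def)

lemma (in scalar_times_identity) cinner_ktensor_sum:
  assumes "\<And>i. i < m \<Longrightarrow> z i \<in> \<Omega> \<and> \<eta> i \<in> carrier E"
  shows "(\<Oplus>\<^bsub>T\<^esub>i\<in>{..<m::nat}. et (kf (z i)) (\<eta> i)) \<in> carrier T"
    and "complex_of_real ((cnorm T (\<Oplus>\<^bsub>T\<^esub>i\<in>{..<m::nat}. et (kf (z i)) (\<eta> i)))\<^sup>2) =
      (\<Sum>i<m. \<Sum>j<m. k (z i) (z j) * cinner E (\<eta> j) (\<eta> i))"
proof -
  let ?x = "\<Oplus>\<^bsub>T\<^esub>i\<in>{..<m}. et (kf (z i)) (\<eta> i)"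
  have c: "i < m \<Longrightarrow> et (kf (z i)) (\<eta> i) \<in> carrier T" for i
    using assms ktensor_closed by blast
  show x: "?x \<in> carrier T"
    by (rule T.T.finsum_closed) (use c in auto)
  have "complex_of_real ((cnorm T ?x)\<^sup>2) = cinner T ?x ?x"
    by (rule T.T.cinner_self[OF x, symmetric])
  also have "\<dots> = (\<Sum>i<m. cinner T ?x (et (kf (z i)) (\<eta> i)))"
    by (rule T.T.cinner_finsum_right) (use c x in auto)
  also have "\<dots> = (\<Sum>i<m. \<Sum>j<m. cinner T (et (kf (z j)) (\<eta> j)) (et (kf (z i)) (\<eta> i)))"
    by (intro sum.cong refl T.T.cinner_finsum_left) (use c in auto)
  also have "\<dots> = (\<Sum>i<m. \<Sum>j<m. k (z i) (z j) * cinner E (\<eta> j) (\<eta> i))"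
    by (intro sum.cong refl cinner_ktensor) (use assms in auto)
  finally show "complex_of_real ((cnorm T ?x)\<^sup>2) = (\<Sum>i<m. \<Sum>j<m. k (z i) (z j) * cinner E (\<eta> j) (\<eta> i))" .
qed

text \<open>
  The kernel \<open>K\<close> says that the would-be adjoint \<open>kf w \<otimes> \<eta> \<mapsto> kf w \<otimes> (\<Theta> w)\<^sup>* \<eta>\<close> of multiplication by
  \<open>\<Theta>\<close> is a contraction, so \<open>\<Theta> f\<close> is represented by a vector of the target space.
\<close>

lemma multiplier_if_kernel:
  fixes E :: "'e hilbert" and F :: "'b hilbert" and \<Theta> :: "complex ^ 'n \<Rightarrow> 'e \<Rightarrow> 'b"
  assumes E: "hilbert_space E" and F: "hilbert_space F"
    and \<Theta>: "\<And>z. z \<in> unit_ball \<Longrightarrow> \<Theta> z \<in> bounded_operators E F"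
    and K: "is_kernel unit_ball F K"
    and K_eq: "\<And>z w \<eta>. z \<in> unit_ball \<Longrightarrow> w \<in> unit_ball \<Longrightarrow> \<eta> \<in> carrier F \<Longrightarrow>
      K z w \<eta> = da_kernel z w \<odot>\<^bsub>F\<^esub> (\<eta> \<ominus>\<^bsub>F\<^esub> \<Theta> z (adjoint_op E F (\<Theta> w) \<eta>))"
  shows "\<Theta> \<in> multipliers E F"
proof -
  interpret E: hilbert_space E by fact
  interpret F: hilbert_space F by fact
  interpret TE: scalar_times_identity unit_ball da_kernel drury_arveson E "drury_arveson_tensor E :: ((complex ^ 'n) \<Rightarrow> 'e) hilbert"
    by (rule scalar_times_identity_drury_arveson[OF E])
  interpret TF: scalar_times_identity unit_ball da_kernel drury_arveson F "drury_arveson_tensor F :: ((complex ^ 'n) \<Rightarrow> 'b) hilbert"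
    by (rule scalar_times_identity_drury_arveson[OF F])
  let ?TE = "drury_arveson_tensor E :: ((complex ^ 'n) \<Rightarrow> 'e) hilbert"
  let ?TF = "drury_arveson_tensor F :: ((complex ^ 'n) \<Rightarrow> 'b) hilbert"
  define A where "A = (\<lambda>z. adjoint_op E F (\<Theta> z))"
  have A [simp]: "A z \<eta> \<in> carrier E" if "z \<in> unit_ball" "\<eta> \<in> carrier F" for z \<eta>
    unfolding A_def using that by (intro adjoint_op E F \<Theta>)
  have A_adj: "cinner F (\<Theta> z u) \<eta> = cinner E u (A z \<eta>)" if "z \<in> unit_ball" "\<eta> \<in> carrier F" "u \<in> carrier E" for z \<eta> u
    unfolding A_def using that by (intro adjoint_op E F \<Theta>)
  have \<Theta>c [simp]: "\<Theta> z u \<in> carrier F" if "z \<in> unit_ball" "u \<in> carrier E" for z u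
    using \<Theta>[OF that(1)] that(2) by (auto simp: bounded_operators_def)
  have K_A: "K z w \<eta> = da_kernel z w \<odot>\<^bsub>F\<^esub> (\<eta> \<ominus>\<^bsub>F\<^esub> \<Theta> z (A w \<eta>))"
    if "z \<in> unit_ball" "w \<in> unit_ball" "\<eta> \<in> carrier F" for z w \<eta>
    using K_eq[OF that] by (simp add: A_def)
  have contraction: "cnorm ?TE (\<Oplus>\<^bsub>?TE\<^esub>i\<in>{..<m}. elementary_tensor unit_ball E (TE.kf (z i)) (A (z i) (\<eta> i))) \<le>
      cnorm ?TF (\<Oplus>\<^bsub>?TF\<^esub>i\<in>{..<m}. elementary_tensor unit_ball F (TE.kf (z i)) (\<eta> i))"
    if z: "\<And>i. i < m \<Longrightarrow> z i \<in> unit_ball \<and> \<eta> i \<in> carrier F" for m :: nat and z \<eta>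
  proof (cases "m = 0")
    case False
    let ?x = "\<Oplus>\<^bsub>?TF\<^esub>i\<in>{..<m}. elementary_tensor unit_ball F (TE.kf (z i)) (\<eta> i)"
    let ?y = "\<Oplus>\<^bsub>?TE\<^esub>i\<in>{..<m}. elementary_tensor unit_ball E (TE.kf (z i)) (A (z i) (\<eta> i))"
    have z': "z i \<in> unit_ball \<and> A (z i) (\<eta> i) \<in> carrier E" if "i < m" for i
      using z[OF that] by simp
    \<comment> \<open>Subtracting the two Gram sums leaves the sum that is nonnegative because
      \<open>K\<close> is a kernel. That property concerns at least one point, so the empty sum is a
      case of its own.\<close>
    have "complex_of_real ((cnorm ?TF ?x)\<^sup>2) - complex_of_real ((cnorm ?TE ?y)\<^sup>2) =
        (\<Sum>i<m. \<Sum>j<m. da_kernel (z i) (z j) * cinner F (\<eta> j) (\<eta> i)) -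
        (\<Sum>i<m. \<Sum>j<m. da_kernel (z i) (z j) * cinner E (A (z j) (\<eta> j)) (A (z i) (\<eta> i)))"
      using TF.cinner_ktensor_sum(2)[OF z] TE.cinner_ktensor_sum(2)[OF z'] by simp
    also have "\<dots> = (\<Sum>i<m. \<Sum>j<m. cinner F (K (z i) (z j) (\<eta> j)) (\<eta> i))"
      unfolding sum_subtractf[symmetric]
    proof (intro sum.cong refl)
      fix i j assume "i \<in> {..<m}" "j \<in> {..<m}"
      then have ij: "z i \<in> unit_ball" "z j \<in> unit_ball" "\<eta> i \<in> carrier F" "\<eta> j \<in> carrier F"
        using z by auto
      have "cinner F (K (z i) (z j) (\<eta> j)) (\<eta> i) =
          da_kernel (z i) (z j) * (cinner F (\<eta> j) (\<eta> i) - cinner F (\<Theta> (z i) (A (z j) (\<eta> j))) (\<eta> i))"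
        using ij by (simp add: K_A F.cinner_smult_left F.cinner_minus_left)
      also have "cinner F (\<Theta> (z i) (A (z j) (\<eta> j))) (\<eta> i) = cinner E (A (z j) (\<eta> j)) (A (z i) (\<eta> i))"
        using ij by (intro A_adj) auto
      finally show "da_kernel (z i) (z j) * cinner F (\<eta> j) (\<eta> i) -
          da_kernel (z i) (z j) * cinner E (A (z j) (\<eta> j)) (A (z i) (\<eta> i)) = cinner F (K (z i) (z j) (\<eta> j)) (\<eta> i)"
        by (simp add: right_diff_distrib)
    qed
    also have "\<dots> \<in> \<real>\<^sub>\<ge>\<^sub>0"
      using K[unfolded is_kernel_def, THEN conjunct2, rule_format, of m z \<eta>] z False by simp
    finally have "complex_of_real ((cnorm ?TF ?x)\<^sup>2 - (cnorm ?TE ?y)\<^sup>2) \<in> \<real>\<^sub>\<ge>\<^sub>0"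
      by simp
    then have "(cnorm ?TE ?y)\<^sup>2 \<le> (cnorm ?TF ?x)\<^sup>2"
      by (simp only: nonneg_Reals_of_real_iff diff_ge_0_iff_ge)
    then show ?thesis
      by (rule power2_le_imp_le) (rule TF.T.T.cnorm_nonneg[OF TF.cinner_ktensor_sum(1)[OF z]])
  qed (simp add: cnorm_def)
  \<comment> \<open>Each kernel function is assigned the value that pairing it with
    \<open>\<Theta> f\<close> would give; the candidate stands in the second slot because
    functionals are represented there. Scalars are again absorbed into
    \<open>\<eta>\<close>.\<close>
  have "(\<lambda>z\<in>unit_ball. \<Theta> z (f z)) \<in> carrier ?TF" if f: "f \<in> carrier ?TE" for f
  proof (rule TF.T.T.functional_on_generators[of "unit_ball \<times> carrier F"
        "\<lambda>(w, \<eta>). elementary_tensor unit_ball F (TE.kf w) \<eta>" "\<lambda>(w, \<eta>). cinner F \<eta> (\<Theta> w (f w))" "cnorm ?TE f"])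
    show "(case i of (w, \<eta>) \<Rightarrow> elementary_tensor unit_ball F (TE.kf w) \<eta>) \<in> carrier ?TF"
      if "i \<in> unit_ball \<times> carrier F" for i
      using that TF.ktensor_closed by auto
    show "\<exists>j\<in>unit_ball \<times> carrier F.
        (case j of (w, \<eta>) \<Rightarrow> elementary_tensor unit_ball F (TE.kf w) \<eta>) =
          t \<odot>\<^bsub>?TF\<^esub> (case i of (w, \<eta>) \<Rightarrow> elementary_tensor unit_ball F (TE.kf w) \<eta>) \<and>
        (case j of (w, \<eta>) \<Rightarrow> cinner F \<eta> (\<Theta> w (f w))) = t * (case i of (w, \<eta>) \<Rightarrow> cinner F \<eta> (\<Theta> w (f w)))"
      if "i \<in> unit_ball \<times> carrier F" for i t
      by (rule bexI[of _ "(fst i, t \<odot>\<^bsub>F\<^esub> snd i)"])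
        (use that f in \<open>auto simp: TF.et_smult_right TF.ktensor_closed F.cinner_smult_left\<close>)
    show "cmod (\<Sum>l<m. case j l of (w, \<eta>) \<Rightarrow> cinner F \<eta> (\<Theta> w (f w))) \<le>
        cnorm ?TE f * cnorm ?TF (\<Oplus>\<^bsub>?TF\<^esub>l\<in>{..<m}. case j l of (w, \<eta>) \<Rightarrow> elementary_tensor unit_ball F (TE.kf w) \<eta>)"
      if j: "\<And>l. l < m \<Longrightarrow> j l \<in> unit_ball \<times> carrier F" for m :: nat and j
    proof -
      define z \<eta> where "z = (\<lambda>l. fst (j l))" and "\<eta> = (\<lambda>l. snd (j l))"
      have z: "z l \<in> unit_ball \<and> \<eta> l \<in> carrier F" if "l < m" for l
        using j[OF that] by (auto simp: z_def \<eta>_def)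
      let ?y = "\<Oplus>\<^bsub>?TE\<^esub>l\<in>{..<m}. elementary_tensor unit_ball E (TE.kf (z l)) (A (z l) (\<eta> l))"
      have y: "?y \<in> carrier ?TE"
        by (rule TE.cinner_ktensor_sum(1)) (use z in auto)
      \<comment> \<open>Moving \<open>\<Theta>\<close> across as \<open>A\<close> turns the
        prescribed values into conjugated pairings of \<open>f\<close> with kernel functions of the
        source. They add up to one pairing with \<open>?y\<close>, and \<open>contraction\<close>
        controls the norm of \<open>?y\<close>.\<close>
      have "(\<Sum>l<m. cinner F (\<eta> l) (\<Theta> (z l) (f (z l)))) = (\<Sum>l<m. cnj (cinner ?TE f (elementary_tensor unit_ball E (TE.kf (z l)) (A (z l) (\<eta> l)))))"
      proof (intro sum.cong refl)
        fix l assume "l \<in> {..<m}"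
        then have l: "z l \<in> unit_ball" "\<eta> l \<in> carrier F" using z by auto
        then have "cinner F (\<eta> l) (\<Theta> (z l) (f (z l))) = cnj (cinner F (\<Theta> (z l) (f (z l))) (\<eta> l))"
          using f by (intro F.cinner_commute) auto
        then show "cinner F (\<eta> l) (\<Theta> (z l) (f (z l))) = cnj (cinner ?TE f (elementary_tensor unit_ball E (TE.kf (z l)) (A (z l) (\<eta> l))))"
          using l f by (simp add: TE.ktensor_reproducing A_adj)
      qed
      also have "\<dots> = cnj (cinner ?TE f ?y)"
        unfolding cnj_sum[symmetric]
        by (subst TE.T.T.cinner_finsum_right) (use z f TE.ktensor_closed in auto)
      finally have "cmod (\<Sum>l<m. cinner F (\<eta> l) (\<Theta> (z l) (f (z l)))) = cmod (cinner ?TE f ?y)"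
        by simp
      also have "\<dots> \<le> cnorm ?TE f * cnorm ?TE ?y"
        by (rule TE.T.T.cauchy_schwarz[OF f y])
      also have "\<dots> \<le> cnorm ?TE f * cnorm ?TF (\<Oplus>\<^bsub>?TF\<^esub>i\<in>{..<m}. elementary_tensor unit_ball F (TE.kf (z i)) (\<eta> i))"
        using f by (intro mult_left_mono contraction z) auto
      finally show ?thesis
        by (simp add: z_def \<eta>_def split_beta)
    qed
  next
    fix h
    assume h: "h \<in> carrier ?TF"
      and h_eq: "\<And>i. i \<in> unit_ball \<times> carrier F \<Longrightarrow>
        cinner ?TF (case i of (w, \<eta>) \<Rightarrow> elementary_tensor unit_ball F (TE.kf w) \<eta>) h = (case i of (w, \<eta>) \<Rightarrow> cinner F \<eta> (\<Theta> w (f w)))"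
    have "h = (\<lambda>z\<in>unit_ball. \<Theta> z (f z))"
    proof (rule TF.T.val_ext[OF h])
      fix z :: "complex ^ 'n" assume z: "z \<in> unit_ball"
      have "h z = \<Theta> z (f z)"
      proof (rule F.eq_if_cinner_eq)
        fix \<eta> assume \<eta>: "\<eta> \<in> carrier F"
        have "cinner F \<eta> (h z) = cnj (cinner F (h z) \<eta>)"
          using h z \<eta> by (intro F.cinner_commute) auto
        also have "cinner F (h z) \<eta> = cinner ?TF h (elementary_tensor unit_ball F (TE.kf z) \<eta>)"
          by (rule TF.ktensor_reproducing[OF z \<eta> h, symmetric])
        also have "cnj \<dots> = cinner ?TF (elementary_tensor unit_ball F (TE.kf z) \<eta>) h"
          by (rule TF.T.T.cinner_commute[OF TF.ktensor_closed[OF z \<eta>] h, symmetric])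
        finally show "cinner F \<eta> (h z) = cinner F \<eta> (\<Theta> z (f z))"
          using h_eq[of "(z, \<eta>)"] z \<eta> by simp
      qed (use h z f in auto)
      then show "h z = (\<lambda>z\<in>unit_ball. \<Theta> z (f z)) z" using z by simp
    qed (use f in auto)
    with h show ?thesis by simp
  qed
  with \<Theta> show ?thesis by (simp add: multipliers_def)
qed

text \<open>The double sum is the squared norm of the sum of the \<open>A (z j) (\<eta> j)\<close>.
  The boundedness that \<open>is_kernel\<close> asks of each operator is inherited from
  \<open>K\<close>.\<close>

lemma kernel_if_multiplier:
  fixes E :: "'e hilbert" and F :: "'b hilbert" and \<Theta> :: "complex ^ 'n \<Rightarrow> 'e \<Rightarrow> 'b"
  assumes E: "hilbert_space E" and F: "hilbert_space F" and K: "is_kernel unit_ball F K"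
    and \<Theta>: "\<Theta> \<in> multipliers E F"
    and K_eq: "\<And>z w \<eta>. z \<in> unit_ball \<Longrightarrow> w \<in> unit_ball \<Longrightarrow> \<eta> \<in> carrier F \<Longrightarrow>
      K z w \<eta> = (1 / (1 - herm z w)) \<odot>\<^bsub>F\<^esub> (\<eta> \<ominus>\<^bsub>F\<^esub> \<Theta> z (adjoint_op E F (\<Theta> w) \<eta>))"
  shows "is_kernel unit_ball F (\<lambda>z w \<eta>. \<eta> \<ominus>\<^bsub>F\<^esub> (1 - herm z w) \<odot>\<^bsub>F\<^esub> K z w \<eta>)"
proof -
  interpret E: hilbert_space E by fact
  interpret F: hilbert_space F by fact
  have \<Theta>b: "\<Theta> z \<in> bounded_operators E F" if "z \<in> unit_ball" for z
    using \<Theta> that by (simp add: multipliers_def)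
  define A where "A = (\<lambda>z. adjoint_op E F (\<Theta> z))"
  have A [simp]: "A z \<eta> \<in> carrier E" if "z \<in> unit_ball" "\<eta> \<in> carrier F" for z \<eta>
    unfolding A_def using that by (intro adjoint_op E F \<Theta>b)
  have A_adj: "cinner F (\<Theta> z u) \<eta> = cinner E u (A z \<eta>)" if "z \<in> unit_ball" "\<eta> \<in> carrier F" "u \<in> carrier E" for z \<eta> u
    unfolding A_def using that by (intro adjoint_op E F \<Theta>b)
  have \<Theta>c [simp]: "\<Theta> z u \<in> carrier F" if "z \<in> unit_ball" "u \<in> carrier E" for z u
    using \<Theta>b[OF that(1)] that(2) by (auto simp: bounded_operators_def)
  have eq: "\<eta> \<ominus>\<^bsub>F\<^esub> (1 - herm z w) \<odot>\<^bsub>F\<^esub> K z w \<eta> = \<Theta> z (A w \<eta>)"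
    if "z \<in> unit_ball" "w \<in> unit_ball" "\<eta> \<in> carrier F" for z w \<eta>
  proof -
    have "K z w \<eta> = (1 / (1 - herm z w)) \<odot>\<^bsub>F\<^esub> (\<eta> \<ominus>\<^bsub>F\<^esub> \<Theta> z (A w \<eta>))"
      using K_eq[OF that] by (simp add: A_def)
    then show ?thesis
      using that herm_neq_1[of z w] by (simp add: F.smult_one_left F.minus_minus flip: F.smult_assoc)
  qed
  show ?thesis
    unfolding is_kernel_def
  proof (intro conjI ballI allI impI)
    fix z w :: "complex ^ 'n" assume zw: "z \<in> unit_ball" "w \<in> unit_ball"
    have Kb: "K z w \<in> bounded_operators F F"
      using K zw by (simp add: is_kernel_def)
    then obtain B where B: "\<And>x. x \<in> carrier F \<Longrightarrow> cnorm F (K z w x) \<le> B * cnorm F x"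
      unfolding bounded_operators_def by blast
    have Kc [simp]: "x \<in> carrier F \<Longrightarrow> K z w x \<in> carrier F" for x
      using Kb by (auto simp: bounded_operators_def)
    have Kadd: "x \<in> carrier F \<Longrightarrow> y \<in> carrier F \<Longrightarrow> K z w (x \<oplus>\<^bsub>F\<^esub> y) = K z w x \<oplus>\<^bsub>F\<^esub> K z w y"
      and Ksmult: "x \<in> carrier F \<Longrightarrow> K z w (c \<odot>\<^bsub>F\<^esub> x) = c \<odot>\<^bsub>F\<^esub> K z w x" for x y c
      using Kb by (auto simp: bounded_operators_def)
    let ?h = "1 - herm z w"
    have "cnorm F (x \<ominus>\<^bsub>F\<^esub> ?h \<odot>\<^bsub>F\<^esub> K z w x) \<le> (1 + cmod ?h * B) * cnorm F x" if x: "x \<in> carrier F" for x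
    proof -
      \<comment> \<open>The triangle inequality for differences is routed through zero.\<close>
      have "cnorm F (x \<ominus>\<^bsub>F\<^esub> ?h \<odot>\<^bsub>F\<^esub> K z w x) \<le> cnorm F x + cnorm F (\<zero>\<^bsub>F\<^esub> \<ominus>\<^bsub>F\<^esub> ?h \<odot>\<^bsub>F\<^esub> K z w x)"
        using F.cnorm_triangle_minus[of x "\<zero>\<^bsub>F\<^esub>" "?h \<odot>\<^bsub>F\<^esub> K z w x"] x by simp
      also have "cnorm F (\<zero>\<^bsub>F\<^esub> \<ominus>\<^bsub>F\<^esub> ?h \<odot>\<^bsub>F\<^esub> K z w x) = cmod ?h * cnorm F (K z w x)"
        using x by (subst F.cnorm_minus_commute) (auto simp: F.cnorm_smult)
      also have "\<dots> \<le> cmod ?h * (B * cnorm F x)"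
        by (intro mult_left_mono B x) simp
      finally show ?thesis by (simp add: algebra_simps)
    qed
    moreover have "x \<oplus>\<^bsub>F\<^esub> y \<ominus>\<^bsub>F\<^esub> ?h \<odot>\<^bsub>F\<^esub> K z w (x \<oplus>\<^bsub>F\<^esub> y) =
        (x \<ominus>\<^bsub>F\<^esub> ?h \<odot>\<^bsub>F\<^esub> K z w x) \<oplus>\<^bsub>F\<^esub> (y \<ominus>\<^bsub>F\<^esub> ?h \<odot>\<^bsub>F\<^esub> K z w y)"
      if "x \<in> carrier F" "y \<in> carrier F" for x y
      using that by (simp add: Kadd F.smult_r_distr a_minus_def F.minus_add F.a_ac)
    moreover have "c \<odot>\<^bsub>F\<^esub> x \<ominus>\<^bsub>F\<^esub> ?h \<odot>\<^bsub>F\<^esub> K z w (c \<odot>\<^bsub>F\<^esub> x) = c \<odot>\<^bsub>F\<^esub> (x \<ominus>\<^bsub>F\<^esub> ?h \<odot>\<^bsub>F\<^esub> K z w x)"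
      if "x \<in> carrier F" for c x
      using that by (simp add: Ksmult F.smult_minus_right mult.commute flip: F.smult_assoc)
    ultimately show "(\<lambda>\<eta>. \<eta> \<ominus>\<^bsub>F\<^esub> ?h \<odot>\<^bsub>F\<^esub> K z w \<eta>) \<in> bounded_operators F F"
      unfolding bounded_operators_def by auto
  next
    fix m :: nat and z :: "nat \<Rightarrow> complex ^ 'n" and \<eta>
    assume z: "\<forall>i<m. z i \<in> unit_ball \<and> \<eta> i \<in> carrier F"
    let ?x = "\<Oplus>\<^bsub>E\<^esub>j\<in>{..<m}. A (z j) (\<eta> j)"
    have x: "?x \<in> carrier E"
      by (rule E.finsum_closed) (use z in auto)
    have "(\<Sum>i<m. \<Sum>j<m. cinner F (\<eta> j \<ominus>\<^bsub>F\<^esub> (1 - herm (z i) (z j)) \<odot>\<^bsub>F\<^esub> K (z i) (z j) (\<eta> j)) (\<eta> i)) =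
        (\<Sum>i<m. \<Sum>j<m. cinner E (A (z j) (\<eta> j)) (A (z i) (\<eta> i)))"
      by (intro sum.cong refl) (use z in \<open>simp add: eq A_adj\<close>)
    also have "\<dots> = (\<Sum>i<m. cinner E ?x (A (z i) (\<eta> i)))"
      by (intro sum.cong refl E.cinner_finsum_left[symmetric]) (use z in auto)
    also have "\<dots> = cinner E ?x ?x"
      by (rule E.cinner_finsum_right[symmetric]) (use z x in auto)
    also have "\<dots> \<in> \<real>\<^sub>\<ge>\<^sub>0"
      by (rule E.cinner_nonneg[OF x])
    finally show "(\<Sum>i<m. \<Sum>j<m. cinner F (\<eta> j \<ominus>\<^bsub>F\<^esub> (1 - herm (z i) (z j)) \<odot>\<^bsub>F\<^esub> K (z i) (z j) (\<eta> j)) (\<eta> i)) \<in> \<real>\<^sub>\<ge>\<^sub>0" .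
  qed
qed

text \<open>The type of vectors of \<open>E\<close> cannot be quantified inside the formula. The
  equivalence therefore takes functions from the ball, a type with room for the reproducing kernel
  space that is constructed, and the second conjunct extends the forward implication to Hilbert
  spaces over any type \<open>'e\<close>.\<close>

theorem theorem3p4:
  fixes F :: "'b hilbert"
    and K :: "complex ^ 'n \<Rightarrow> complex ^ 'n \<Rightarrow> 'b \<Rightarrow> 'b"
  assumes "hilbert_space F"
    and "is_kernel unit_ball F K"
  shows
    "((\<exists>(E :: ((complex ^ 'n) \<Rightarrow> 'b) hilbert) \<Theta>.
         hilbert_space E \<and> \<Theta> \<in> multipliers E F \<and>
         (\<forall>z\<in>unit_ball. \<forall>w\<in>unit_ball. \<forall>\<eta>\<in>carrier F.
            K z w \<eta> = (1 / (1 - herm z w)) \<odot>\<^bsub>F\<^esub> (\<eta> \<ominus>\<^bsub>F\<^esub> \<Theta> z (adjoint_op E F (\<Theta> w) \<eta>))))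
      \<longleftrightarrow> is_kernel unit_ball F (\<lambda>z w \<eta>. \<eta> \<ominus>\<^bsub>F\<^esub> (1 - herm z w) \<odot>\<^bsub>F\<^esub> K z w \<eta>))
     \<and>
     ((\<exists>(E :: 'e hilbert) \<Theta>.
         hilbert_space E \<and> \<Theta> \<in> multipliers E F \<and>
         (\<forall>z\<in>unit_ball. \<forall>w\<in>unit_ball. \<forall>\<eta>\<in>carrier F.
            K z w \<eta> = (1 / (1 - herm z w)) \<odot>\<^bsub>F\<^esub> (\<eta> \<ominus>\<^bsub>F\<^esub> \<Theta> z (adjoint_op E F (\<Theta> w) \<eta>))))
      \<longrightarrow> is_kernel unit_ball F (\<lambda>z w \<eta>. \<eta> \<ominus>\<^bsub>F\<^esub> (1 - herm z w) \<odot>\<^bsub>F\<^esub> K z w \<eta>))"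
proof (intro conjI iffI impI)
  let ?L = "\<lambda>z w \<eta>. \<eta> \<ominus>\<^bsub>F\<^esub> (1 - herm z w) \<odot>\<^bsub>F\<^esub> K z w \<eta>"
  assume L: "is_kernel unit_ball F ?L"
  interpret F: hilbert_space F by fact
  show "\<exists>(E :: ((complex ^ 'n) \<Rightarrow> 'b) hilbert) \<Theta>.
      hilbert_space E \<and> \<Theta> \<in> multipliers E F \<and>
      (\<forall>z\<in>unit_ball. \<forall>w\<in>unit_ball. \<forall>\<eta>\<in>carrier F.
         K z w \<eta> = (1 / (1 - herm z w)) \<odot>\<^bsub>F\<^esub> (\<eta> \<ominus>\<^bsub>F\<^esub> \<Theta> z (adjoint_op E F (\<Theta> w) \<eta>)))"
  proof (rule rkhs_exists[OF assms(1) L])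
    fix E :: "((complex ^ 'n) \<Rightarrow> 'b) hilbert"
    assume E: "function_hilbert_space unit_ball F E"
      and kE: "\<And>w \<eta>. w \<in> unit_ball \<Longrightarrow> \<eta> \<in> carrier F \<Longrightarrow> (\<lambda>z\<in>unit_ball. ?L z w \<eta>) \<in> carrier E"
      and rE: "\<And>w \<eta> f. w \<in> unit_ball \<Longrightarrow> \<eta> \<in> carrier F \<Longrightarrow> f \<in> carrier E \<Longrightarrow>
        cinner E f (\<lambda>z\<in>unit_ball. ?L z w \<eta>) = cinner F (f w) \<eta>"
    have hE: "hilbert_space E" using E by (simp add: function_hilbert_space_def)
    define \<Theta> :: "complex ^ 'n \<Rightarrow> (complex ^ 'n \<Rightarrow> 'b) \<Rightarrow> 'b" where "\<Theta> = (\<lambda>z f. f z)"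
    have \<Theta>: "\<Theta> z \<in> bounded_operators E F" if "z \<in> unit_ball" for z
      using E that by (simp add: \<Theta>_def function_hilbert_space_def)
    have adj: "adjoint_op E F (\<Theta> w) \<eta> = (\<lambda>z\<in>unit_ball. ?L z w \<eta>)" if "w \<in> unit_ball" "\<eta> \<in> carrier F" for w \<eta>
      using that by (intro adjoint_op_eqI hE kE) (simp_all add: rE \<Theta>_def)
    have K_eq: "K z w \<eta> = (1 / (1 - herm z w)) \<odot>\<^bsub>F\<^esub> (\<eta> \<ominus>\<^bsub>F\<^esub> \<Theta> z (adjoint_op E F (\<Theta> w) \<eta>))"
      if "z \<in> unit_ball" "w \<in> unit_ball" "\<eta> \<in> carrier F" for z w \<eta>
    proof -
      have "K z w \<eta> \<in> carrier F"
        using operator_kernel.L_closed[of F unit_ball K z w \<eta>] assms that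
        by (simp add: operator_kernel_def operator_kernel_axioms_def)
      then show ?thesis
        using that herm_neq_1[of z w]
        by (simp add: adj F.minus_minus F.smult_one_left flip: F.smult_assoc) (simp add: \<Theta>_def F.minus_minus F.smult_one_left flip: F.smult_assoc)
    qed
    have "\<Theta> \<in> multipliers E F"
      by (rule multiplier_if_kernel[OF hE assms(1) \<Theta> assms(2)]) (simp_all add: K_eq da_kernel_def)
    with hE K_eq show ?thesis by blast
  qed
\<comment> \<open>Both remaining goals are the forward implication, at the two types of
  \<open>E\<close>.\<close>
qed (auto intro: kernel_if_multiplier[OF _ assms])

end
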